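(* Let $\Phi^k = \frac{1}{\gamma}\left(f(\overline{x}_y^{k}) - f(x^* )\right) + \Phi_{\rm U}^{k} + \frac{1+\beta}{2\eta}\|\overline{z}^{k} - x^*\|^2 + c_4\Phi_{\rm C}^{k}$, where $\overline{x}_y^k := \overline{y}^k=\frac1n\mathbf 1^\top Y^k$, and let $$\delta = \min\left\{\frac{\gamma}{4},\ \widehat p,\ \frac{\beta}{1+\beta},\ \frac{p}{2},\ \tau,\ \frac{\theta}{2}\right\},\qquad \widehat p = \frac{\alpha p}{2\tau+\alpha}.$$ Suppose the parameters and stepsize of the SS-GT iteration satisfy all of the following: (i) $\frac{2(1 - \tau)}{2 - \tau} + \frac{192(1 - \tau)\gamma^2\beta^2}{\tau\theta^2} + \frac{\tau}{4} + \frac{16 p}{\theta} \leq 1 - \frac{\tau}{8}$, $\quad\frac{\alpha^2}{(1 - \tau)\gamma^2} \leq 1$, $\quad\frac{192(1 - \tau)\gamma^2\eta^2 L^2}{\tau\theta} \leq \frac{\theta}{2}$; (ii) $\frac{2\eta L^2}{qn} \leq \frac{c_3}{2}$, $\quad c_3c_2 \leq \frac{\eta}{2qn}$, $\quad\frac{8\eta L}{q} \leq \frac{\tau}{\alpha}$; (iii) $L\gamma \leq \frac{1}{4\eta}$, $\quad\frac{\beta}{2\eta} \leq \frac{\mu}{4}$, $\quad\frac{1}{\gamma} - \frac{1 - \alpha - \tau}{\alpha} - \frac{1}{2} \leq 0$, $\quad\frac{1 - \alpha - \tau}{\alpha} \leq \frac{1}{\gamma} - \frac{1}{4}$. Then $\mathbb{E}[\Phi^k]$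 converges linearly, with $$\mathbb{E}_k[\Phi^{k+1}] \leq (1 - \delta)\Phi^k\qquad\text{for all }k\ge 0.$$ Specifically, one can choose $$\tau = \tfrac{1}{2},\quad \alpha = \frac{1}{23\sqrt{\kappa}},\quad \gamma = \frac{4\alpha}{4 - 4\tau - 3\alpha},\quad p = q = \frac{\theta}{4232},\quad \eta = \frac{\theta\sqrt{\kappa}}{5000 L},\quad \beta = \frac{\mu\eta}{2}.$$ In this case, to achieve $\mathbb{E}[\Phi^K] \leq \epsilon\Phi^0$, the gradient computation complexity is $O\left(\sqrt{\kappa}\log\frac{1}{\epsilon}\right)$ and the communication complexity is $O\left(\frac{\sqrt{\kappa}}{\theta}\log\frac{1}{\epsilon}\right)$.
   Context: Problem. There are $n$ agents $\mathcal N=\{1,\dots,n\}$; each $f_i:\mathbb R^d\to\mathbb R$ is differentiable, $\mu$-strongly convex and $L$-smooth, $L\ge\mu>0$: for all $x,y$, $\langle x-y,\nabla f_i(x)-\nabla f_i(y)\rangle\ge\mu\|x-y\|^2$ and $\|\nabla f_i(x)-\nabla f_i(y)\|\le L\|x-y\|$. Let $f=\frac1n\sum_i f_i$, with unique minimizer $x^*$, and $\kappa=L/\mu$. The gossip matrix $W\in\mathbb R^{n\times n}$ (compatible with the undirected connected communication graph) satisfies $W\mathbf 1=\mathbf 1$, $W^\top\mathbf 1=\mathbf 1$ and $\|W-\frac{\mathbf 1\mathbf 1^\top}{n}\|_2=1-\theta$ with $\theta\in(0,1]$. Let $\Pi=I-\frac{\mathbf 1\mathbf 1^\top}{n}$.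 $\|\cdot\|$ is the Euclidean norm of vectors, $\|\cdot\|_F$ the Frobenius norm. Points of $\mathbb R^d$ are row vectors; for $X\in\mathbb R^{n\times d}$ with rows $x_i$, $\nabla F(X)\in\mathbb R^{n\times d}$ has $i$-th row $\nabla f_i(x_i)$. An overlined lower-case letter denotes the row average: $\overline x^k=\frac1n\mathbf 1^\top X^k$, and similarly $\overline y^k,\overline z^k,\overline u^k,\overline q^k,\overline g^k$. SS-GT iteration. Parameters $\alpha,\beta,\gamma,\tau,p,q\in(0,1)$, stepsize $\eta>0$. Start with $X^0\in\mathbb R^{n\times d}$, $Y^0=Z^0=U^0=Q^0=X^0$, $G^0=\nabla F(Q^0)$. For $k=0,1,2,\dots$, draw (independently across iterations) random variables $\xi^k\sim Bernoulli(p)$ and $\zeta^k$ with $\Pr[\zeta^k=1/q]=q$, $\Pr[\zeta^k=0]=1-q$, and set $X^{k} = (1 - \alpha- \tau)Y^k + \alpha Z^k + \tau U^k$; $Z^{k+1} = (1 + \beta)^{-1}W\big( Z^k + \beta X^k - \eta(G^k + \zeta^k( \nabla F(X^k)-\nabla F(Q^k) ))\big)$; $Y^{k+1} = X^k + \gamma(Z^{k+1} - Z^k)$; $Q^{k+1} = \xi^{k}X^k + (1 - \xi^k)Q^k$; $U^{k+1} = W(\xi^{k}X^k + (1 - \xi^k)U^k)$; $G^{k+1} = WG^k + \xi^k(\nabla F(X^k) - \nabla F(Q^k))$. $\mathcal F_k$ is the sigma-field generated by $\{\xi^j,\zeta^j\}_{0\le j\le k-1}$ and $\mathbb E_k[\cdot]$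 is the conditional expectation given $\mathcal F_k$. Lyapunov quantities and constants. $\Phi_{\rm U}^k=\frac{2\tau+\alpha}{2\alpha p}\left(f(\overline u^k)-f(x^* )\right)$; $\Phi_{\rm C}^k=\frac{8}{\tau}\Big(\frac{\tau}{4p}\|\Pi Q^k\|_F^2+\frac{4(1-\tau)}{4-\tau}\|\Pi Y^k\|_F^2+\frac{16}{\theta}\|\Pi U^k\|_F^2+\left(1-\frac\theta6\right)\frac{48(1-\tau)\gamma^2}{\tau\theta}\|\Pi Z^k\|_F^2+\frac{1}{\theta L^2}\|\Pi G^k\|_F^2\Big)$; $c_2=\frac{384(1-\tau)\gamma^2}{\tau^2\theta}\left(\frac{\eta^2}{q}+\frac{2\eta^2}{\theta}\right)+\frac{16p}{\tau\theta L^2}$; $c_3=\left(\frac{1-\alpha-\tau}{\alpha n}+\frac{1}{n\gamma}+\frac1n\right)L$; $c_4=\frac{c_3\tau q}{4\alpha\eta L}$. Complexities. The communication complexity is the number of communication rounds performed by each agent (in one round each agent may broadcast $O(1)$ vectors of length $O(d)$ to its neighbors; each SS-GT iteration uses one round). The gradient computation complexity is the number of local gradients $\nabla f_i(\cdot)$ each agent computes; a new gradient (at $x_i^k$) is computed in iteration $k$ only when $\xi^k\ne0$ or $\zeta^k\neq 0$, and the random number of gradient computations is counted in expectation. *)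

theory Defs
  imports "HOL-Probability.Probability"
begin

text \<open>
  There are \<open>CARD('n)\<close> agents, points of R^d are of type \<open>real ^ 'd\<close>, and an
  n x d matrix whose rows are such points is of type \<open>real ^ 'd ^ 'n\<close>. On the latter type \<open>norm\<close>
  is the Euclidean norm of the vector of row norms, i.e. the Frobenius norm.
\<close>

definition smooth_strongly_convex ::
    "real \<Rightarrow> real \<Rightarrow> ('a::euclidean_space \<Rightarrow> real) \<Rightarrow> ('a \<Rightarrow> 'a) \<Rightarrow> bool" where
  "smooth_strongly_convex \<mu> L h gh \<longleftrightarrow>
     (\<forall>x. GDERIV h x :> gh x) \<and>
     (\<forall>x y. (x - y) \<bullet> (gh x - gh y) \<ge> \<mu> * (norm (x - y))\<^sup>2) \<and>
     (\<forall>x y. norm (gh x - gh y) \<le> L * norm (x - y))"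

definition favg :: "('n::finite \<Rightarrow> 'a \<Rightarrow> real) \<Rightarrow> 'a \<Rightarrow> real" where
  "favg f x = (1 / real CARD('n)) * (\<Sum>i\<in>UNIV. f i x)"

definition avg_mat :: "real ^ 'n ^ 'n" where
  "avg_mat = (\<chi> i j. 1 / real CARD('n))"

definition Pi_mat :: "real ^ 'n ^ 'n" where
  "Pi_mat = mat 1 - avg_mat"

definition row_avg :: "real ^ 'd ^ 'n \<Rightarrow> real ^ 'd" where
  "row_avg A = (1 / real CARD('n)) *\<^sub>R (\<Sum>i\<in>UNIV. A $ i)"

definition gradF :: "('n \<Rightarrow> real ^ 'd \<Rightarrow> real ^ 'd) \<Rightarrow> real ^ 'd ^ 'n \<Rightarrow> real ^ 'd ^ 'n" where
  "gradF g A = (\<chi> i. g i (A $ i))"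

definition undirected_connected :: "('n \<times> 'n) set \<Rightarrow> bool" where
  "undirected_connected E \<longleftrightarrow> sym E \<and> (\<forall>i j. (i, j) \<in> E\<^sup>*)"

text \<open>The operator norm \<open>onorm\<close> with respect to the Euclidean norm is the spectral norm.\<close>

definition gossip_matrix :: "('n \<times> 'n) set \<Rightarrow> real \<Rightarrow> real ^ 'n ^ 'n \<Rightarrow> bool" where
  "gossip_matrix E \<theta> W \<longleftrightarrow>
     (\<forall>i j. i \<noteq> j \<longrightarrow> (i, j) \<notin> E \<longrightarrow> W $ i $ j = 0) \<and>
     W *v 1 = 1 \<and> transpose W *v 1 = 1 \<and>
     onorm (\<lambda>v. (W - avg_mat) *v v) = 1 - \<theta> \<and> 0 < \<theta> \<and> \<theta> \<le> 1"

text \<open>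
  Only the pairs \<open>(\<xi> k, \<zeta> k)\<close> are independent across \<open>k\<close>; the joint law of
  \<open>\<xi> k\<close> and \<open>\<zeta> k\<close> within one iteration is left arbitrary.
\<close>

definition ssgt_noise ::
    "'w measure \<Rightarrow> real \<Rightarrow> real \<Rightarrow> (nat \<Rightarrow> 'w \<Rightarrow> real) \<Rightarrow> (nat \<Rightarrow> 'w \<Rightarrow> real) \<Rightarrow> bool" where
  "ssgt_noise M p q \<xi> \<zeta> \<longleftrightarrow>
     prob_space M \<and>
     (\<forall>k. \<xi> k \<in> borel_measurable M \<and> \<zeta> k \<in> borel_measurable M) \<and>
     (\<forall>k. measure M {\<omega> \<in> space M. \<xi> k \<omega> = 1} = p \<and>
          measure M {\<omega> \<in> space M. \<xi> k \<omega> = 0} = 1 - p) \<and>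
     (\<forall>k. measure M {\<omega> \<in> space M. \<zeta> k \<omega> = 1 / q} = q \<and>
          measure M {\<omega> \<in> space M. \<zeta> k \<omega> = 0} = 1 - q) \<and>
     prob_space.indep_vars M (\<lambda>_. borel) (\<lambda>k \<omega>. (\<xi> k \<omega>, \<zeta> k \<omega>)) UNIV"

definition ssgt_filtration ::
    "'w measure \<Rightarrow> (nat \<Rightarrow> 'w \<Rightarrow> real) \<Rightarrow> (nat \<Rightarrow> 'w \<Rightarrow> real) \<Rightarrow> nat \<Rightarrow> 'w measure" where
  "ssgt_filtration M \<xi> \<zeta> k =
     sigma (space M)
       (\<Union>j<k. {\<xi> j -` B \<inter> space M | B. B \<in> sets borel} \<union>
              {\<zeta> j -` B \<inter> space M | B. B \<in> sets borel})"

text \<open>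
  The iteration along one sample path; \<open>x k\<close> and \<open>z k\<close> are the values of
  \<open>\<xi> k\<close> and \<open>\<zeta> k\<close> on that path.
\<close>

definition ssgt_iterates ::
    "('n::finite \<Rightarrow> real ^ 'd \<Rightarrow> real ^ 'd) \<Rightarrow> real ^ 'n ^ 'n \<Rightarrow>
     real \<Rightarrow> real \<Rightarrow> real \<Rightarrow> real \<Rightarrow> real \<Rightarrow> real ^ 'd ^ 'n \<Rightarrow>
     (nat \<Rightarrow> real) \<Rightarrow> (nat \<Rightarrow> real) \<Rightarrow>
     (nat \<Rightarrow> real ^ 'd ^ 'n) \<Rightarrow> (nat \<Rightarrow> real ^ 'd ^ 'n) \<Rightarrow> (nat \<Rightarrow> real ^ 'd ^ 'n) \<Rightarrow>
     (nat \<Rightarrow> real ^ 'd ^ 'n) \<Rightarrow> (nat \<Rightarrow> real ^ 'd ^ 'n) \<Rightarrow> (nat \<Rightarrow> real ^ 'd ^ 'n) \<Rightarrow> bool" where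
  "ssgt_iterates g W \<alpha> \<beta> \<gamma> \<tau> \<eta> X0 x z X Y Z U Q G \<longleftrightarrow>
     Y 0 = X0 \<and> Z 0 = X0 \<and> U 0 = X0 \<and> Q 0 = X0 \<and> G 0 = gradF g (Q 0) \<and>
     (\<forall>k.
       X k = (1 - \<alpha> - \<tau>) *\<^sub>R Y k + \<alpha> *\<^sub>R Z k + \<tau> *\<^sub>R U k \<and>
       Z (Suc k) = (1 / (1 + \<beta>)) *\<^sub>R (W ** (Z k + \<beta> *\<^sub>R X k
                     - \<eta> *\<^sub>R (G k + z k *\<^sub>R (gradF g (X k) - gradF g (Q k))))) \<and>
       Y (Suc k) = X k + \<gamma> *\<^sub>R (Z (Suc k) - Z k) \<and>
       Q (Suc k) = x k *\<^sub>R X k + (1 - x k) *\<^sub>R Q k \<and>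
       U (Suc k) = W ** (x k *\<^sub>R X k + (1 - x k) *\<^sub>R U k) \<and>
       G (Suc k) = W ** G k + x k *\<^sub>R (gradF g (X k) - gradF g (Q k)))"

definition c2 :: "real \<Rightarrow> real \<Rightarrow> real \<Rightarrow> real \<Rightarrow> real \<Rightarrow> real \<Rightarrow> real \<Rightarrow> real" where
  "c2 L \<theta> \<gamma> \<tau> p q \<eta> =
     384 * (1 - \<tau>) * \<gamma>\<^sup>2 / (\<tau>\<^sup>2 * \<theta>) * (\<eta>\<^sup>2 / q + 2 * \<eta>\<^sup>2 / \<theta>) + 16 * p / (\<tau> * \<theta> * L\<^sup>2)"

definition c3 :: "real \<Rightarrow> real \<Rightarrow> real \<Rightarrow> real \<Rightarrow> real \<Rightarrow> real" where
  "c3 n L \<alpha> \<gamma> \<tau> = ((1 - \<alpha> - \<tau>) / (\<alpha> * n) + 1 / (n * \<gamma>) + 1 / n) * L"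

definition c4 :: "real \<Rightarrow> real \<Rightarrow> real \<Rightarrow> real \<Rightarrow> real \<Rightarrow> real \<Rightarrow> real \<Rightarrow> real" where
  "c4 n L \<alpha> \<gamma> \<tau> q \<eta> = c3 n L \<alpha> \<gamma> \<tau> * \<tau> * q / (4 * \<alpha> * \<eta> * L)"

definition p_hat :: "real \<Rightarrow> real \<Rightarrow> real \<Rightarrow> real" where
  "p_hat \<alpha> \<tau> p = \<alpha> * p / (2 * \<tau> + \<alpha>)"

definition ssgt_delta :: "real \<Rightarrow> real \<Rightarrow> real \<Rightarrow> real \<Rightarrow> real \<Rightarrow> real \<Rightarrow> real" where
  "ssgt_delta \<theta> \<alpha> \<beta> \<gamma> \<tau> p =
     Min {\<gamma> / 4, p_hat \<alpha> \<tau> p, \<beta> / (1 + \<beta>), p / 2, \<tau>, \<theta> / 2}"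

definition Phi_U :: "(real ^ 'd \<Rightarrow> real) \<Rightarrow> real ^ 'd \<Rightarrow> real \<Rightarrow> real \<Rightarrow> real \<Rightarrow>
    real ^ 'd ^ 'n::finite \<Rightarrow> real" where
  "Phi_U F xs \<alpha> \<tau> p U = (2 * \<tau> + \<alpha>) / (2 * \<alpha> * p) * (F (row_avg U) - F xs)"

definition Phi_C :: "real \<Rightarrow> real \<Rightarrow> real \<Rightarrow> real \<Rightarrow> real \<Rightarrow>
    real ^ 'd ^ 'n \<Rightarrow> real ^ 'd ^ 'n \<Rightarrow> real ^ 'd ^ 'n \<Rightarrow> real ^ 'd ^ 'n \<Rightarrow> real ^ 'd ^ 'n::finite \<Rightarrow> real" where
  "Phi_C L \<theta> \<gamma> \<tau> p Y Z U Q G =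
     8 / \<tau> * (\<tau> / (4 * p) * (norm (Pi_mat ** Q))\<^sup>2
       + 4 * (1 - \<tau>) / (4 - \<tau>) * (norm (Pi_mat ** Y))\<^sup>2
       + 16 / \<theta> * (norm (Pi_mat ** U))\<^sup>2
       + (1 - \<theta> / 6) * (48 * (1 - \<tau>) * \<gamma>\<^sup>2 / (\<tau> * \<theta>)) * (norm (Pi_mat ** Z))\<^sup>2
       + 1 / (\<theta> * L\<^sup>2) * (norm (Pi_mat ** G))\<^sup>2)"

definition ssgt_Phi :: "('n::finite \<Rightarrow> real ^ 'd \<Rightarrow> real) \<Rightarrow> real ^ 'd \<Rightarrow> real \<Rightarrow> real \<Rightarrow>
    real \<Rightarrow> real \<Rightarrow> real \<Rightarrow> real \<Rightarrow> real \<Rightarrow> real \<Rightarrow> real \<Rightarrow>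
    real ^ 'd ^ 'n \<Rightarrow> real ^ 'd ^ 'n \<Rightarrow> real ^ 'd ^ 'n \<Rightarrow> real ^ 'd ^ 'n \<Rightarrow> real ^ 'd ^ 'n \<Rightarrow> real" where
  "ssgt_Phi f xs L \<theta> \<alpha> \<beta> \<gamma> \<tau> p q \<eta> Y Z U Q G =
     1 / \<gamma> * (favg f (row_avg Y) - favg f xs)
     + Phi_U (favg f) xs \<alpha> \<tau> p U
     + (1 + \<beta>) / (2 * \<eta>) * (norm (row_avg Z - xs))\<^sup>2
     + c4 (real CARD('n)) L \<alpha> \<gamma> \<tau> q \<eta> * Phi_C L \<theta> \<gamma> \<tau> p Y Z U Q G"

definition ssgt_param_range ::
    "real \<Rightarrow> real \<Rightarrow> real \<Rightarrow> real \<Rightarrow> real \<Rightarrow> real \<Rightarrow> real \<Rightarrow> bool" where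
  "ssgt_param_range \<alpha> \<beta> \<gamma> \<tau> p q \<eta> \<longleftrightarrow>
     {\<alpha>, \<beta>, \<gamma>, \<tau>, p, q} \<subseteq> {0<..<1} \<and> 0 < \<eta>"

definition ssgt_cond_i ::
    "real \<Rightarrow> real \<Rightarrow> real \<Rightarrow> real \<Rightarrow> real \<Rightarrow> real \<Rightarrow> real \<Rightarrow> real \<Rightarrow> bool" where
  "ssgt_cond_i L \<theta> \<alpha> \<beta> \<gamma> \<tau> p \<eta> \<longleftrightarrow>
     2 * (1 - \<tau>) / (2 - \<tau>) + 192 * (1 - \<tau>) * \<gamma>\<^sup>2 * \<beta>\<^sup>2 / (\<tau> * \<theta>\<^sup>2) + \<tau> / 4 + 16 * p / \<theta>
       \<le> 1 - \<tau> / 8 \<and>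
     \<alpha>\<^sup>2 / ((1 - \<tau>) * \<gamma>\<^sup>2) \<le> 1 \<and>
     192 * (1 - \<tau>) * \<gamma>\<^sup>2 * \<eta>\<^sup>2 * L\<^sup>2 / (\<tau> * \<theta>) \<le> \<theta> / 2"

definition ssgt_cond_ii ::
    "real \<Rightarrow> real \<Rightarrow> real \<Rightarrow> real \<Rightarrow> real \<Rightarrow> real \<Rightarrow> real \<Rightarrow> real \<Rightarrow> real \<Rightarrow> bool" where
  "ssgt_cond_ii n L \<theta> \<alpha> \<gamma> \<tau> p q \<eta> \<longleftrightarrow>
     2 * \<eta> * L\<^sup>2 / (q * n) \<le> c3 n L \<alpha> \<gamma> \<tau> / 2 \<and>
     c3 n L \<alpha> \<gamma> \<tau> * c2 L \<theta> \<gamma> \<tau> p q \<eta> \<le> \<eta> / (2 * q * n) \<and>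
     8 * \<eta> * L / q \<le> \<tau> / \<alpha>"

definition ssgt_cond_iii ::
    "real \<Rightarrow> real \<Rightarrow> real \<Rightarrow> real \<Rightarrow> real \<Rightarrow> real \<Rightarrow> real \<Rightarrow> bool" where
  "ssgt_cond_iii \<mu> L \<alpha> \<beta> \<gamma> \<tau> \<eta> \<longleftrightarrow>
     L * \<gamma> \<le> 1 / (4 * \<eta>) \<and>
     \<beta> / (2 * \<eta>) \<le> \<mu> / 4 \<and>
     1 / \<gamma> - (1 - \<alpha> - \<tau>) / \<alpha> - 1 / 2 \<le> 0 \<and>
     (1 - \<alpha> - \<tau>) / \<alpha> \<le> 1 / \<gamma> - 1 / 4"

definition ssgt_admissible :: "real \<Rightarrow> real \<Rightarrow> real \<Rightarrow> real \<Rightarrow>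
    real \<Rightarrow> real \<Rightarrow> real \<Rightarrow> real \<Rightarrow> real \<Rightarrow> real \<Rightarrow> real \<Rightarrow> bool" where
  "ssgt_admissible n \<mu> L \<theta> \<alpha> \<beta> \<gamma> \<tau> p q \<eta> \<longleftrightarrow>
     ssgt_param_range \<alpha> \<beta> \<gamma> \<tau> p q \<eta> \<and>
     ssgt_cond_i L \<theta> \<alpha> \<beta> \<gamma> \<tau> p \<eta> \<and>
     ssgt_cond_ii n L \<theta> \<alpha> \<gamma> \<tau> p q \<eta> \<and>
     ssgt_cond_iii \<mu> L \<alpha> \<beta> \<gamma> \<tau> \<eta>"

text \<open>Every iteration uses exactly one communication round.\<close>

definition comm_rounds :: "nat \<Rightarrow> nat" where
  "comm_rounds K = K"

text \<open>
  Number of local gradients computed by each agent during the first \<open>K\<close> iterations; the summand 1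
  is the gradient needed for the initialization of \<open>G\<close>. The gradient at the row of \<open>Q\<close> was
  computed in an earlier iteration, so it is not counted again.
\<close>

definition grad_count :: "(nat \<Rightarrow> 'w \<Rightarrow> real) \<Rightarrow> (nat \<Rightarrow> 'w \<Rightarrow> real) \<Rightarrow> nat \<Rightarrow> 'w \<Rightarrow> nat" where
  "grad_count \<xi> \<zeta> K \<omega> = 1 + card {k \<in> {..<K}. \<xi> k \<omega> \<noteq> 0 \<or> \<zeta> k \<omega> \<noteq> 0}"

text \<open>
  The constant hidden in the O-notation of the two complexity bounds. It must not depend on the
  problem instance, in particular not on the number of agents or the dimension. Since these are
  types here, a constant bound by an existential quantifier could depend on them; a numeral cannot.
  The value is generous.
\<close>

definition bigO_const :: real where
  "bigO_const = 10 ^ 6"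

end

theory Submission
  imports Defs
begin

text \<open>
In the average over the agents, the iteration is an accelerated gradient method with a randomly updated snapshot: the
points \<open>x\<close>, \<open>y\<close>, \<open>z\<close> and the snapshot \<open>u\<close> are averages of the rows of \<open>X\<close>, \<open>Y\<close>, \<open>Z\<close> and \<open>U\<close>. Its oracle is inexact, because
the agents linearize their functions at their own rows and not at \<open>x\<close>; the inexactness is \<open>L / (2 * n)\<close> times the squared
consensus error \<open>(norm (Pi_mat ** X))\<^sup>2\<close> (\<open>favg_le_model\<close>, \<open>model_le_favg\<close>). It is also noisy, with variance governed by
\<open>D = (norm (gradF g X - gradF g Q))\<^sup>2\<close>. The step analysis (\<open>accelerated_step\<close>) produces the required decrease of the averaged
part of the Lyapunov function and, in addition, \<open>- \<tau> / \<alpha>\<close> times the model gap at the snapshot, the amount by which \<open>favg f\<close>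
exceeds at \<open>u\<close> the linear model built at \<open>x\<close>.

The consensus errors form a second, linear system driven by \<open>D\<close> (\<open>consensus_weights\<close>): gossip contracts them, and the
weighted sum in the Lyapunov function decreases by the factor \<open>1 - \<delta>\<close> and moreover by \<open>(norm (Pi_mat ** X))\<^sup>2\<close> and half of
\<open>(norm (Pi_mat ** Q))\<^sup>2\<close>, up to \<open>c2 * D\<close>.

The two parts are coupled through \<open>D\<close> and the consensus errors only. By \<open>gradient_gap_le\<close>, \<open>D\<close> is at most
\<open>4 * n * L\<close> times the model gap at the snapshot plus \<open>2 * L\<^sup>2 * (norm (Pi_mat ** Q))\<^sup>2\<close>. The parameter conditions make the total
coefficient of \<open>D\<close> so small (\<open>noise_coeff_le\<close>) that the model gap is paid by the negative term of the accelerated step, and make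
\<open>c4\<close> so large (\<open>c4_ge_c3\<close>, \<open>c4_ge_tau\<close>) that all remaining consensus errors are paid by the extra decrease of the consensus
part. This bookkeeping is \<open>lyapunov_weights\<close>; it yields the decrease for a fixed state, \<open>expected_phi_decrease\<close>.

The new \<open>Y\<close> and \<open>Z\<close> depend on the fresh noise through \<open>\<zeta> k\<close> alone and the new \<open>U\<close>, \<open>Q\<close>, \<open>G\<close> through \<open>\<xi> k\<close> alone. Hence the
Lyapunov value splits into a sum over outcomes of either variable, and independence from the past turns the decrease for a fixed state
into the bound on the conditional expectation (\<open>cond_exp_Phi_Suc_le\<close>).

For the recommended parameters \<open>1 / \<delta>\<close> is of order \<open>sqrt \<kappa> / \<theta>\<close>, which is the number of rounds per factor of accuracy, while
a gradient is computed with probability of order \<open>\<theta>\<close> only; so the factor \<open>1 / \<theta>\<close> cancels in the expected number of gradients.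
\<close>

section \<open>Quadratic bounds for smooth and strongly convex functions\<close>

lemma has_real_derivative_on_segment:
  assumes "GDERIV h (x + t *\<^sub>R d) :> D"
  shows "((\<lambda>t. h (x + t *\<^sub>R d)) has_real_derivative (D \<bullet> d)) (at t)"
proof -
  have "((\<lambda>t. h (x + t *\<^sub>R d)) has_derivative (\<lambda>s. (s *\<^sub>R d) \<bullet> D)) (at t)"
    by (rule has_derivative_compose[of "\<lambda>t. x + t *\<^sub>R d" "\<lambda>s. s *\<^sub>R d" t UNIV h, simplified])
      (use assms in \<open>auto simp: gderiv_def intro!: derivative_eq_intros\<close>)
  then show ?thesis
    by (simp add: has_field_derivative_def inner_commute mult_commute_abs)
qed

lemma smooth_upper_bound:
  assumes "smooth_strongly_convex \<mu> L h gh"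
  shows "h y \<le> h x + gh x \<bullet> (y - x) + L / 2 * (norm (y - x))\<^sup>2"
proof -
  define d where "d = y - x"
  define \<phi> where "\<phi> t = h (x + t *\<^sub>R d) - t * (gh x \<bullet> d) - L / 2 * t\<^sup>2 * (norm d)\<^sup>2" for t
  have G: "GDERIV h w :> gh w" for w
    using assms by (auto simp: smooth_strongly_convex_def)
  have Lip: "norm (gh a - gh b) \<le> L * norm (a - b)" for a b
    using assms by (auto simp: smooth_strongly_convex_def)
  have der: "(\<phi> has_real_derivative (gh (x + t *\<^sub>R d) \<bullet> d - gh x \<bullet> d - L * t * (norm d)\<^sup>2)) (at t)" for t
    unfolding \<phi>_def by (auto intro!: derivative_eq_intros has_real_derivative_on_segment[OF G])
  have "\<phi> 1 \<le> \<phi> 0"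
  proof (rule DERIV_nonpos_imp_nonincreasing[of 0 1 \<phi>])
    fix t :: real assume t: "0 \<le> t" "t \<le> 1"
    have "(gh (x + t *\<^sub>R d) - gh x) \<bullet> d \<le> norm (gh (x + t *\<^sub>R d) - gh x) * norm d"
      by (rule norm_cauchy_schwarz)
    also have "\<dots> \<le> (L * norm (t *\<^sub>R d)) * norm d"
      using Lip[of "x + t *\<^sub>R d" x] by (intro mult_right_mono) auto
    also have "\<dots> = L * t * (norm d)\<^sup>2"
      using t by (simp add: power2_eq_square)
    finally show "\<exists>y. (\<phi> has_real_derivative y) (at t) \<and> y \<le> 0"
      using der[of t] by (auto simp: inner_diff_left)
  qed simp
  then show ?thesis
    by (simp add: \<phi>_def d_def)
qed

lemma strongly_convex_lower_bound:
  assumes "smooth_strongly_convex \<mu> L h gh"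
  shows "h x + gh x \<bullet> (y - x) + \<mu> / 2 * (norm (y - x))\<^sup>2 \<le> h y"
proof -
  define d where "d = y - x"
  define \<phi> where "\<phi> t = h (x + t *\<^sub>R d) - t * (gh x \<bullet> d) - \<mu> / 2 * t\<^sup>2 * (norm d)\<^sup>2" for t
  have G: "GDERIV h w :> gh w" for w
    using assms by (auto simp: smooth_strongly_convex_def)
  have mono: "\<mu> * (norm (a - b))\<^sup>2 \<le> (a - b) \<bullet> (gh a - gh b)" for a b
    using assms by (auto simp: smooth_strongly_convex_def)
  have der: "(\<phi> has_real_derivative (gh (x + t *\<^sub>R d) \<bullet> d - gh x \<bullet> d - \<mu> * t * (norm d)\<^sup>2)) (at t)" for t
    unfolding \<phi>_def by (auto intro!: derivative_eq_intros has_real_derivative_on_segment[OF G])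
  have "\<phi> 0 \<le> \<phi> 1"
  proof (rule DERIV_nonneg_imp_nondecreasing[of 0 1 \<phi>])
    fix t :: real assume t: "0 \<le> t" "t \<le> 1"
    have "\<mu> * t * (norm d)\<^sup>2 \<le> (gh (x + t *\<^sub>R d) - gh x) \<bullet> d"
    proof (cases "t = 0")
      case False
      with t have "0 < t" by simp
      have "t * (\<mu> * t * (norm d)\<^sup>2) \<le> t * ((gh (x + t *\<^sub>R d) - gh x) \<bullet> d)"
        using mono[of "x + t *\<^sub>R d" x] t
        by (simp add: power_mult_distrib inner_commute power2_eq_square mult_ac)
      with \<open>0 < t\<close> show ?thesis by simp
    qed simp
    then show "\<exists>y. (\<phi> has_real_derivative y) (at t) \<and> 0 \<le> y"
      using der[of t] by (auto simp: inner_diff_left)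
  qed simp
  then show ?thesis
    by (simp add: \<phi>_def d_def)
qed

text \<open>
Minimize, over \<open>w\<close>, the quadratic upper bound of \<open>h\<close> at \<open>y\<close> minus the tangent of \<open>h\<close> at \<open>x\<close>. The
minimizer is one gradient step of length \<open>1 / L\<close> from \<open>y\<close>, and there the difference is still
nonnegative because the tangent lies below \<open>h\<close>.
\<close>

lemma gradient_gap_lower_bound:
  assumes S: "smooth_strongly_convex \<mu> L h gh" and "0 \<le> \<mu>" "0 < L"
  shows "h x + gh x \<bullet> (y - x) + 1 / (2 * L) * (norm (gh y - gh x))\<^sup>2 \<le> h y"
proof -
  define r where "r = gh y - gh x"
  define w where "w = y - (1 / L) *\<^sub>R r"
  have "h x + gh x \<bullet> (w - x) \<le> h x + gh x \<bullet> (w - x) + \<mu> / 2 * (norm (w - x))\<^sup>2"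
    using \<open>0 \<le> \<mu>\<close> by simp
  also have "\<dots> \<le> h w"
    by (rule strongly_convex_lower_bound[OF S])
  also have "\<dots> \<le> h y + gh y \<bullet> (w - y) + L / 2 * (norm (w - y))\<^sup>2"
    by (rule smooth_upper_bound[OF S])
  finally have "h x + gh x \<bullet> (w - x) \<le> h y + gh y \<bullet> (w - y) + L / 2 * (norm (w - y))\<^sup>2" .
  moreover have "gh x \<bullet> (w - x) = gh x \<bullet> (y - x) - gh x \<bullet> r / L"
    by (simp add: w_def algebra_simps)
  moreover have "gh y \<bullet> (w - y) = - (gh x \<bullet> r / L) - (r \<bullet> r) / L"
    by (simp add: w_def r_def algebra_simps add_divide_distrib diff_divide_distrib)
  moreover have "L / 2 * (norm (w - y))\<^sup>2 = (r \<bullet> r) / (2 * L)"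
    using \<open>0 < L\<close> by (simp add: w_def power_divide power2_norm_eq_inner[symmetric] power2_eq_square)
  moreover have "(r \<bullet> r) / L = 2 * ((r \<bullet> r) / (2 * L))"
    by simp
  ultimately have "h x + gh x \<bullet> (y - x) + (r \<bullet> r) / (2 * L) \<le> h y"
    by linarith
  then show ?thesis
    by (simp add: r_def power2_norm_eq_inner)
qed


section \<open>Row averages and consensus errors\<close>

lemma linear_matrix_mult_right: "linear (\<lambda>A. (W :: real ^ 'n ^ 'm) ** (A :: real ^ 'd ^ 'n))"
  by (rule linearI)
    (simp_all add: matrix_matrix_mult_def vec_eq_iff algebra_simps sum.distrib sum_distrib_left)

lemmas matrix_mult_right_linear =
  linear_add[OF linear_matrix_mult_right] linear_diff[OF linear_matrix_mult_right]
  linear_scale[OF linear_matrix_mult_right]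

lemma matrix_diff_mult_distrib:
  "(V - V') ** A = V ** A - V' ** (A :: real ^ 'd ^ 'n)" for V V' :: "real ^ 'n ^ 'm"
  by (simp add: vec_eq_iff matrix_matrix_mult_def left_diff_distrib sum_subtractf)

lemma linear_row_avg: "linear (row_avg :: real ^ 'd ^ 'n \<Rightarrow> real ^ 'd)"
  by (rule linearI)
    (simp_all add: row_avg_def sum.distrib scaleR_add_right scaleR_sum_right)

lemmas row_avg_linear =
  linear_add[OF linear_row_avg] linear_diff[OF linear_row_avg] linear_scale[OF linear_row_avg]

lemma sum_rows_eq: "(\<Sum>i\<in>UNIV. A $ i) = real CARD('n) *\<^sub>R row_avg (A :: real ^ 'd ^ 'n)"
  by (simp add: row_avg_def)

lemma norm_sq_eq_sum_rows: "(norm (A :: real ^ 'd ^ 'n))\<^sup>2 = (\<Sum>i\<in>UNIV. (norm (A $ i))\<^sup>2)"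
  by (simp add: norm_vec_def L2_set_def sum_nonneg)

lemma avg_mat_row: "(avg_mat ** (A :: real ^ 'd ^ 'n)) $ i = row_avg A"
  by (simp add: avg_mat_def row_avg_def matrix_matrix_mult_def vec_eq_iff sum_distrib_left)

lemma Pi_mat_row: "(Pi_mat ** (A :: real ^ 'd ^ 'n)) $ i = A $ i - row_avg A"
proof -
  have "Pi_mat ** A = A - avg_mat ** A"
    by (simp add: Pi_mat_def matrix_diff_mult_distrib)
  then show ?thesis
    by (simp add: avg_mat_row)
qed

text \<open>
The parallel axis theorem for the rows of a matrix. It is the only link between agents and
averages: it turns sums of squared distances over agents into a consensus error plus a distance
of averages, without loss.
\<close>

lemma sum_dist_sq_eq:
  "(\<Sum>i\<in>UNIV. (norm (y - A $ i))\<^sup>2)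
     = (norm (Pi_mat ** (A :: real ^ 'd ^ 'n)))\<^sup>2 + real CARD('n) * (norm (y - row_avg A))\<^sup>2"
proof -
  define a where "a = row_avg A"
  have "(\<Sum>i\<in>UNIV. (norm (y - A $ i))\<^sup>2)
      = (\<Sum>i\<in>UNIV. (norm (A $ i - a))\<^sup>2 + (norm (y - a))\<^sup>2 - 2 * ((y - a) \<bullet> (A $ i - a)))"
    by (intro sum.cong refl) (simp add: power2_norm_eq_inner algebra_simps inner_commute)
  also have "\<dots> = (\<Sum>i\<in>UNIV. (norm (A $ i - a))\<^sup>2) + real CARD('n) * (norm (y - a))\<^sup>2
      - 2 * ((y - a) \<bullet> (\<Sum>i\<in>UNIV. A $ i - a))"
    by (simp only: sum.distrib sum_subtractf sum_distrib_left[symmetric] inner_sum_right[symmetric]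
        sum_constant)
  also have "(\<Sum>i\<in>UNIV. A $ i - a) = 0"
    by (simp add: sum_subtractf sum_rows_eq a_def sum_constant_scaleR del: sum_constant)
  finally show ?thesis
    by (simp add: norm_sq_eq_sum_rows[of "Pi_mat ** A"] Pi_mat_row a_def)
qed

lemma norm_sq_eq_consensus_split:
  "(norm (A :: real ^ 'd ^ 'n))\<^sup>2
     = (norm (Pi_mat ** A))\<^sup>2 + real CARD('n) * (norm (row_avg A))\<^sup>2"
  using sum_dist_sq_eq[of 0 A] by (simp add: norm_sq_eq_sum_rows[of A])

lemma norm_Pi_mat_le: "norm (Pi_mat ** (A :: real ^ 'd ^ 'n)) \<le> norm A"
  by (rule power2_le_imp_le) (use norm_sq_eq_consensus_split[of A] in simp_all)

lemma norm_row_avg_le: "real CARD('n) * (norm (row_avg A))\<^sup>2 \<le> (norm (A :: real ^ 'd ^ 'n))\<^sup>2"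
  using norm_sq_eq_consensus_split[of A] by simp

lemma norm_sq_eq_sum_columns:
  "(norm (A :: real ^ 'd ^ 'n))\<^sup>2 = (\<Sum>j\<in>UNIV. (norm (column j A))\<^sup>2)"
  unfolding norm_sq_eq_sum_rows
  by (simp add: norm_vec_def L2_set_def sum_nonneg column_def) (rule sum.swap)

text \<open>
The Frobenius norm is Euclidean in the columns, and matrix multiplication acts on each column.
\<close>

lemma norm_matrix_mult_le_onorm:
  "norm ((V :: real ^ 'n ^ 'm) ** (A :: real ^ 'd ^ 'n)) \<le> onorm (\<lambda>v. V *v v) * norm A"
proof (rule power2_le_imp_le)
  have bl: "bounded_linear (\<lambda>v. V *v v)"
    by (rule matrix_vector_mul_bounded_linear)
  have col: "column j (V ** A) = V *v column j A" for j
    by (simp add: column_def matrix_matrix_mult_def matrix_vector_mult_def vec_eq_iff)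
  have "(norm (V ** A))\<^sup>2 = (\<Sum>j\<in>UNIV. (norm (V *v column j A))\<^sup>2)"
    by (simp add: norm_sq_eq_sum_columns col)
  also have "\<dots> \<le> (\<Sum>j\<in>UNIV. (onorm (\<lambda>v. V *v v) * norm (column j A))\<^sup>2)"
    by (intro sum_mono power_mono onorm[OF bl]) auto
  also have "\<dots> = (onorm (\<lambda>v. V *v v) * norm A)\<^sup>2"
    by (simp add: power_mult_distrib norm_sq_eq_sum_columns sum_distrib_left)
  finally show "(norm (V ** A))\<^sup>2 \<le> (onorm (\<lambda>v. V *v v) * norm A)\<^sup>2" .
  show "0 \<le> onorm (\<lambda>v. V *v v) * norm A"
    by (simp add: onorm_pos_le[OF bl])
qed

lemma row_avg_gossip:
  fixes W :: "real ^ 'n ^ 'n" and A :: "real ^ 'd ^ 'n"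
  assumes "gossip_matrix E \<theta> W"
  shows "row_avg (W ** A) = row_avg A"
proof -
  have "transpose W *v 1 = 1"
    using assms by (simp add: gossip_matrix_def)
  then have col: "(\<Sum>i\<in>UNIV. W $ i $ k) = 1" for k
    by (simp add: vec_eq_iff matrix_vector_mult_def transpose_def)
  have "(\<Sum>i\<in>UNIV. \<Sum>k\<in>UNIV. W $ i $ k * A $ k $ j) = (\<Sum>k\<in>UNIV. A $ k $ j)" for j
    by (subst sum.swap) (simp add: sum_distrib_right[symmetric] col)
  then show ?thesis
    by (simp add: row_avg_def vec_eq_iff matrix_matrix_mult_def)
qed

text \<open>
One gossip round contracts the consensus error: since the rows and the columns of \<open>W\<close> sum to \<open>1\<close>,
\<open>Pi_mat ** W = (W - avg_mat) ** Pi_mat\<close>, and \<open>1 - \<theta>\<close> is the spectral norm of \<open>W - avg_mat\<close>.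
\<close>

lemma Pi_mat_gossip_le:
  fixes W :: "real ^ 'n ^ 'n" and A :: "real ^ 'd ^ 'n"
  assumes "gossip_matrix E \<theta> W"
  shows "norm (Pi_mat ** (W ** A)) \<le> (1 - \<theta>) * norm (Pi_mat ** A)"
proof -
  have "W *v 1 = 1"
    using assms by (simp add: gossip_matrix_def)
  then have row: "(\<Sum>j\<in>UNIV. W $ i $ j) = 1" for i
    by (simp add: vec_eq_iff matrix_vector_mult_def)
  have "Pi_mat ** (W ** A) = (W - avg_mat) ** (Pi_mat ** A)"
  proof -
    have "((W - avg_mat) ** (Pi_mat ** A)) $ i = (Pi_mat ** (W ** A)) $ i" for i
    proof -
      have Wrow: "(W ** B) $ i = (\<Sum>k\<in>UNIV. W $ i $ k *\<^sub>R B $ k)" for B :: "real ^ 'd ^ 'n"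
        by (simp add: vec_eq_iff matrix_matrix_mult_def)
      have "row_avg (Pi_mat ** A) = 0"
        by (simp add: row_avg_def[of "Pi_mat ** A"] Pi_mat_row sum_subtractf sum_rows_eq
            sum_constant_scaleR del: sum_constant)
      then have "((W - avg_mat) ** (Pi_mat ** A)) $ i = (\<Sum>k\<in>UNIV. W $ i $ k *\<^sub>R (A $ k - row_avg A))"
        by (simp add: matrix_diff_mult_distrib avg_mat_row Wrow Pi_mat_row)
      also have "\<dots> = (W ** A) $ i - (\<Sum>k\<in>UNIV. W $ i $ k) *\<^sub>R row_avg A"
        by (simp add: Wrow scaleR_diff_right sum_subtractf scaleR_sum_left)
      finally show ?thesis
        by (simp add: row Pi_mat_row row_avg_gossip[OF assms])
    qed
    then show ?thesis
      by (rule iffD2[OF vec_eq_iff, OF allI, THEN sym])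
  qed
  moreover have "onorm (\<lambda>v. (W - avg_mat) *v v) = 1 - \<theta>"
    using assms by (simp add: gossip_matrix_def)
  ultimately show ?thesis
    using norm_matrix_mult_le_onorm[of "W - avg_mat" "Pi_mat ** A"] by simp
qed

section \<open>Linearization at the rows as an inexact oracle\<close>

text \<open>
The value at \<open>row_avg A\<close> of the average of the tangents to \<open>f i\<close> at the rows of \<open>A\<close>. Together with the
average of the agents' gradients it is an inexact first-order oracle for \<open>favg f\<close> at \<open>row_avg A\<close>.
\<close>

definition model_value ::
    "('n::finite \<Rightarrow> real ^ 'd \<Rightarrow> real) \<Rightarrow> ('n \<Rightarrow> real ^ 'd \<Rightarrow> real ^ 'd) \<Rightarrow> real ^ 'd ^ 'n \<Rightarrow> real" where
  "model_value f g A =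
     (1 / real CARD('n)) * (\<Sum>i\<in>UNIV. f i (A $ i) + g i (A $ i) \<bullet> (row_avg A - A $ i))"

lemma sum_linearizations_eq:
  fixes f :: "'n::finite \<Rightarrow> real ^ 'd \<Rightarrow> real"
  shows "(\<Sum>i\<in>UNIV. f i (A $ i) + g i (A $ i) \<bullet> (y - A $ i))
    = real CARD('n) * (model_value f g A + row_avg (gradF g A) \<bullet> (y - row_avg A))"
proof -
  have "(\<Sum>i\<in>UNIV. f i (A $ i) + g i (A $ i) \<bullet> (y - A $ i))
     = (\<Sum>i\<in>UNIV. (f i (A $ i) + g i (A $ i) \<bullet> (row_avg A - A $ i))
          + gradF g A $ i \<bullet> (y - row_avg A))"
    by (intro sum.cong refl) (simp add: gradF_def inner_diff_right)
  also have "\<dots> = (\<Sum>i\<in>UNIV. f i (A $ i) + g i (A $ i) \<bullet> (row_avg A - A $ i))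
          + (\<Sum>i\<in>UNIV. gradF g A $ i) \<bullet> (y - row_avg A)"
    by (simp only: sum.distrib[symmetric] inner_sum_left)
  finally show ?thesis
    by (simp add: model_value_def sum_rows_eq distrib_left)
qed

text \<open>
Each agent contributes \<open>L / 2\<close> times its squared distance to \<open>y\<close>; by \<open>sum_dist_sq_eq\<close> the price of
linearizing at the rows instead of at their average is the last summand only.
\<close>

lemma favg_le_model:
  fixes f :: "'n::finite \<Rightarrow> real ^ 'd \<Rightarrow> real"
  assumes "\<forall>i. smooth_strongly_convex \<mu> L (f i) (g i)"
  shows "favg f y \<le> model_value f g A + row_avg (gradF g A) \<bullet> (y - row_avg A)
    + L / 2 * (norm (y - row_avg A))\<^sup>2 + L / (2 * real CARD('n)) * (norm (Pi_mat ** A))\<^sup>2"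
proof -
  have "(\<Sum>i\<in>UNIV. f i y)
      \<le> (\<Sum>i\<in>UNIV. (f i (A $ i) + g i (A $ i) \<bullet> (y - A $ i)) + L / 2 * (norm (y - A $ i))\<^sup>2)"
    using assms by (intro sum_mono smooth_upper_bound) auto
  also have "\<dots> = real CARD('n) * (model_value f g A + row_avg (gradF g A) \<bullet> (y - row_avg A))
      + L / 2 * ((norm (Pi_mat ** A))\<^sup>2 + real CARD('n) * (norm (y - row_avg A))\<^sup>2)"
    by (simp only: sum.distrib[of _ "\<lambda>i. L / 2 * _ i"] sum_linearizations_eq
        sum_distrib_left[symmetric] sum_dist_sq_eq)
  finally show ?thesis
    unfolding favg_def by (simp add: field_simps)
qed

lemma model_le_favg:
  fixes f :: "'n::finite \<Rightarrow> real ^ 'd \<Rightarrow> real"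
  assumes "\<forall>i. smooth_strongly_convex \<mu> L (f i) (g i)" and "0 \<le> \<mu>"
  shows "model_value f g A + row_avg (gradF g A) \<bullet> (y - row_avg A)
    + \<mu> / 2 * (norm (y - row_avg A))\<^sup>2 \<le> favg f y"
proof -
  have "real CARD('n) * (model_value f g A + row_avg (gradF g A) \<bullet> (y - row_avg A))
      + \<mu> / 2 * (real CARD('n) * (norm (y - row_avg A))\<^sup>2)
      \<le> real CARD('n) * (model_value f g A + row_avg (gradF g A) \<bullet> (y - row_avg A))
      + \<mu> / 2 * ((norm (Pi_mat ** A))\<^sup>2 + real CARD('n) * (norm (y - row_avg A))\<^sup>2)"
    using \<open>0 \<le> \<mu>\<close> by (simp add: mult_left_mono)
  also have "\<dots> = (\<Sum>i\<in>UNIV. (f i (A $ i) + g i (A $ i) \<bullet> (y - A $ i)) + \<mu> / 2 * (norm (y - A $ i))\<^sup>2)"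
    by (simp only: sum.distrib[of _ "\<lambda>i. \<mu> / 2 * _ i"] sum_linearizations_eq
        sum_distrib_left[symmetric] sum_dist_sq_eq)
  also have "\<dots> \<le> (\<Sum>i\<in>UNIV. f i y)"
    using assms(1) by (intro sum_mono strongly_convex_lower_bound) auto
  finally show ?thesis
    unfolding favg_def by (simp add: field_simps)
qed

text \<open>
Insert the gradients at the common point \<open>row_avg B\<close>. The distance to the gradients at the rows
of \<open>A\<close> is controlled by the gap between \<open>favg f\<close> and its model (\<open>gradient_gap_lower_bound\<close>), the
distance to the gradients at the rows of \<open>B\<close> by Lipschitz continuity. In the analysis \<open>row_avg B\<close> is the
average of the snapshot, where the model gap occurs with a negative sign and pays for this bound.
\<close>

lemma gradient_gap_le:
  fixes f :: "'n::finite \<Rightarrow> real ^ 'd \<Rightarrow> real"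
  assumes S: "\<forall>i. smooth_strongly_convex \<mu> L (f i) (g i)" and "0 \<le> \<mu>" "0 < L"
  shows "(norm (gradF g A - gradF g B))\<^sup>2
    \<le> 4 * L * real CARD('n) * (favg f (row_avg B) - model_value f g A
          - row_avg (gradF g A) \<bullet> (row_avg B - row_avg A))
      + 2 * L\<^sup>2 * (norm (Pi_mat ** B))\<^sup>2"
proof -
  define u where "u = row_avg B"
  have "(norm (g i (A $ i) - g i (B $ i)))\<^sup>2
      \<le> 4 * L * (f i u - (f i (A $ i) + g i (A $ i) \<bullet> (u - A $ i)))
        + 2 * L\<^sup>2 * (norm (u - B $ i))\<^sup>2" for i
  proof -
    have "norm (g i (A $ i) - g i (B $ i)) \<le> norm (g i u - g i (A $ i)) + norm (g i u - g i (B $ i))"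
      using norm_triangle_sub[of "g i (A $ i) - g i (B $ i)" "g i u - g i (B $ i)"]
      by (simp add: norm_minus_commute)
    then have "(norm (g i (A $ i) - g i (B $ i)))\<^sup>2
        \<le> (norm (g i u - g i (A $ i)) + norm (g i u - g i (B $ i)))\<^sup>2"
      by (rule power_mono) simp
    also have "\<dots> \<le> 2 * (norm (g i u - g i (A $ i)))\<^sup>2 + 2 * (norm (g i u - g i (B $ i)))\<^sup>2"
      using sum_squares_bound[of "norm (g i u - g i (A $ i))" "norm (g i u - g i (B $ i))"]
      by (simp add: power2_sum)
    also have "(norm (g i u - g i (B $ i)))\<^sup>2 \<le> (L * norm (u - B $ i))\<^sup>2"
      using S by (intro power_mono) (auto simp: smooth_strongly_convex_def)
    also have "(norm (g i u - g i (A $ i)))\<^sup>2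
        \<le> 2 * L * (f i u - (f i (A $ i) + g i (A $ i) \<bullet> (u - A $ i)))"
      using gradient_gap_lower_bound[OF S[rule_format] assms(2,3), of i "A $ i" u] \<open>0 < L\<close>
      by (simp add: field_simps)
    finally show ?thesis
      by (simp add: power_mult_distrib)
  qed
  then have "(\<Sum>i\<in>UNIV. (norm (g i (A $ i) - g i (B $ i)))\<^sup>2)
      \<le> (\<Sum>i\<in>UNIV. 4 * L * (f i u - (f i (A $ i) + g i (A $ i) \<bullet> (u - A $ i)))
        + 2 * L\<^sup>2 * (norm (u - B $ i))\<^sup>2)"
    by (rule sum_mono)
  also have "\<dots> = 4 * L * ((\<Sum>i\<in>UNIV. f i u)
      - (\<Sum>i\<in>UNIV. f i (A $ i) + g i (A $ i) \<bullet> (u - A $ i)))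
      + 2 * L\<^sup>2 * (\<Sum>i\<in>UNIV. (norm (u - B $ i))\<^sup>2)"
    by (simp only: sum.distrib[of _ "\<lambda>i. 2 * L\<^sup>2 * _ i"] sum_subtractf sum_distrib_left[symmetric])
  also have "\<dots> = 4 * L * (real CARD('n) * favg f u
      - real CARD('n) * (model_value f g A + row_avg (gradF g A) \<bullet> (u - row_avg A)))
      + 2 * L\<^sup>2 * (norm (Pi_mat ** B))\<^sup>2"
    by (simp only: sum_linearizations_eq sum_dist_sq_eq) (simp add: favg_def u_def)
  also have "(\<Sum>i\<in>UNIV. (norm (g i (A $ i) - g i (B $ i)))\<^sup>2) = (norm (gradF g A - gradF g B))\<^sup>2"
    unfolding norm_sq_eq_sum_rows by (simp add: gradF_def)
  finally show ?thesis
    by (simp add: u_def algebra_simps)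
qed

section \<open>One accelerated step of the averages\<close>

text \<open>
The coupling argument of accelerated methods with a snapshot point \<open>u\<close>. Here \<open>l\<close> is the model value and
\<open>v\<close> the exact gradient of the model at \<open>x\<close>, \<open>c\<close> the error of the upper model, and \<open>e *\<^sub>R d\<close> the noise of the
stochastic gradient; \<open>e\<close> stays in the conclusion so that its mean and variance can be inserted later. The step
for \<open>z\<close> is a proximal step, hence satisfies a three-point identity. Its gradient term splits into the
change from \<open>z\<close> to \<open>z'\<close>, which the descent bound on \<open>F'\<close> removes, and a term at \<open>z\<close>, which the definition of
\<open>x\<close> rewrites as a combination of differences to \<open>xs\<close>, \<open>y\<close> and \<open>u\<close>.
\<close>

lemma accelerated_step:
  fixes x y z u xs v d z' :: "'a :: real_inner"
  assumes x: "x = (1 - \<alpha> - \<tau>) *\<^sub>R y + \<alpha> *\<^sub>R z + \<tau> *\<^sub>R u"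
    and z': "z' = (1 / (1 + \<beta>)) *\<^sub>R (z + \<beta> *\<^sub>R x - \<eta> *\<^sub>R (v + e *\<^sub>R d))"
    and upper: "F' \<le> l + v \<bullet> (\<gamma> *\<^sub>R (z' - z)) + L / 2 * (norm (\<gamma> *\<^sub>R (z' - z)))\<^sup>2 + c"
    and lower_xs: "l + v \<bullet> (xs - x) + \<mu> / 2 * (norm (xs - x))\<^sup>2 \<le> Fs"
    and lower_y: "l + v \<bullet> (y - x) \<le> Fy"
    and pos: "0 < \<alpha>" "0 \<le> 1 - \<alpha> - \<tau>" "0 < \<beta>" "0 < \<gamma>" "0 < \<eta>"
    and step: "L * \<gamma> \<le> 1 / (4 * \<eta>)" and mom: "\<beta> / (2 * \<eta>) \<le> \<mu> / 2"
  shows "F' / \<gamma> + (1 + \<beta>) / (2 * \<eta>) * (norm (z' - xs))\<^sup>2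
    \<le> 1 / (2 * \<eta>) * (norm (z - xs))\<^sup>2 + (Fs - l) + (1 - \<alpha> - \<tau>) / \<alpha> * (Fy - l)
      + \<tau> / \<alpha> * (v \<bullet> (u - x)) + (l + c) / \<gamma> - e * (d \<bullet> (z - xs)) + \<eta> * e\<^sup>2 * (norm d)\<^sup>2"
proof -
  define a b w where "a = z - xs" and "b = x - xs" and "w = z' - z"
  define s where "s = v + e *\<^sub>R d"
  have prox: "(1 + \<beta>) *\<^sub>R (a + w) = a + \<beta> *\<^sub>R b - \<eta> *\<^sub>R s"
  proof -
    have "(1 + \<beta>) *\<^sub>R z' = z + \<beta> *\<^sub>R x - \<eta> *\<^sub>R s"
      using pos by (simp add: z' s_def)
    then show ?thesis
      by (simp add: a_def b_def w_def algebra_simps)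
  qed
  have three_point: "(1 + \<beta>) * (norm (a + w))\<^sup>2
      = (norm a)\<^sup>2 + \<beta> * (norm b)\<^sup>2 - (norm w)\<^sup>2 - \<beta> * (norm (a + w - b))\<^sup>2 - 2 * \<eta> * (s \<bullet> (a + w))"
  proof -
    have "(1 + \<beta>) * (norm (a + w))\<^sup>2 = 2 * (((1 + \<beta>) *\<^sub>R (a + w)) \<bullet> (a + w)) - (1 + \<beta>) * (norm (a + w))\<^sup>2"
      by (simp add: power2_norm_eq_inner)
    also have "\<dots> = 2 * ((a + \<beta> *\<^sub>R b - \<eta> *\<^sub>R s) \<bullet> (a + w)) - (1 + \<beta>) * (norm (a + w))\<^sup>2"
      by (simp only: prox)
    also have "\<dots> = (norm a)\<^sup>2 + \<beta> * (norm b)\<^sup>2 - (norm w)\<^sup>2 - \<beta> * (norm (a + w - b))\<^sup>2 - 2 * \<eta> * (s \<bullet> (a + w))"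
      by (simp add: power2_norm_eq_inner algebra_simps inner_commute)
    finally show ?thesis .
  qed
  have "(1 + \<beta>) / (2 * \<eta>) * (norm (a + w))\<^sup>2
      = 1 / (2 * \<eta>) * (norm a)\<^sup>2 + \<beta> / (2 * \<eta>) * (norm b)\<^sup>2 - 1 / (2 * \<eta>) * (norm w)\<^sup>2
        - \<beta> / (2 * \<eta>) * (norm (a + w - b))\<^sup>2 - s \<bullet> (a + w)"
  proof -
    have "(1 + \<beta>) / (2 * \<eta>) * (norm (a + w))\<^sup>2 = 1 / (2 * \<eta>) * ((1 + \<beta>) * (norm (a + w))\<^sup>2)"
      by simp
    also have "\<dots> = 1 / (2 * \<eta>) * (norm a)\<^sup>2 + \<beta> / (2 * \<eta>) * (norm b)\<^sup>2 - 1 / (2 * \<eta>) * (norm w)\<^sup>2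
        - \<beta> / (2 * \<eta>) * (norm (a + w - b))\<^sup>2 - s \<bullet> (a + w)"
      unfolding three_point using pos by (simp add: diff_divide_distrib add_divide_distrib distrib_left right_diff_distrib)
    finally show ?thesis .
  qed
  moreover have "\<beta> / (2 * \<eta>) * (norm b)\<^sup>2 \<le> \<mu> / 2 * (norm b)\<^sup>2"
    using mom by (intro mult_right_mono) auto
  moreover have "0 \<le> \<beta> / (2 * \<eta>) * (norm (a + w - b))\<^sup>2"
    using pos by simp
  moreover have "s \<bullet> (a + w) = v \<bullet> a + e * (d \<bullet> a) + v \<bullet> w + e * (d \<bullet> w)"
    by (simp add: s_def algebra_simps)
  moreover have "- (e * (d \<bullet> w)) \<le> \<eta> * e\<^sup>2 * (norm d)\<^sup>2 + 1 / (4 * \<eta>) * (norm w)\<^sup>2"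
  proof -
    have "0 \<le> \<eta> * (norm (e *\<^sub>R d + (1 / (2 * \<eta>)) *\<^sub>R w))\<^sup>2"
      using pos by simp
    also have "\<dots> = \<eta> * e\<^sup>2 * (norm d)\<^sup>2 + 1 / (4 * \<eta>) * (norm w)\<^sup>2 + e * (d \<bullet> w)"
      using pos unfolding power2_norm_eq_inner
      by (simp add: inner_add_left inner_add_right inner_commute field_simps power2_eq_square)
    finally show ?thesis by simp
  qed
  moreover have "F' / \<gamma> \<le> (l + c) / \<gamma> + v \<bullet> w + 1 / (8 * \<eta>) * (norm w)\<^sup>2"
  proof -
    have "F' / \<gamma> \<le> (l + \<gamma> * (v \<bullet> w) + L / 2 * (\<gamma>\<^sup>2 * (norm w)\<^sup>2) + c) / \<gamma>"
      using upper pos by (intro divide_right_mono) (auto simp: w_def power_mult_distrib)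
    also have "\<dots> = (l + c) / \<gamma> + v \<bullet> w + (L * \<gamma>) / 2 * (norm w)\<^sup>2"
      using pos by (simp add: field_simps power2_eq_square)
    also have "(L * \<gamma>) / 2 * (norm w)\<^sup>2 \<le> 1 / (8 * \<eta>) * (norm w)\<^sup>2"
      using step by (intro mult_right_mono) (simp_all add: field_simps)
    finally show ?thesis by simp
  qed
  moreover have "- (v \<bullet> a) \<le> Fs - l - \<mu> / 2 * (norm b)\<^sup>2 + (1 - \<alpha> - \<tau>) / \<alpha> * (Fy - l)
      + \<tau> / \<alpha> * (v \<bullet> (u - x))"
  proof -
    have "\<alpha> *\<^sub>R (x - z) = (1 - \<alpha> - \<tau>) *\<^sub>R (y - x) + \<tau> *\<^sub>R (u - x)"
    proof -
      have "\<alpha> *\<^sub>R (x - z) - ((1 - \<alpha> - \<tau>) *\<^sub>R (y - x) + \<tau> *\<^sub>R (u - x))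
          = x - ((1 - \<alpha> - \<tau>) *\<^sub>R y + \<alpha> *\<^sub>R z + \<tau> *\<^sub>R u)"
        by (simp add: algebra_simps)
      also have "\<dots> = 0"
        using x by simp
      finally show ?thesis by simp
    qed
    then have "(1 / \<alpha>) *\<^sub>R (\<alpha> *\<^sub>R (x - z)) = (1 / \<alpha>) *\<^sub>R ((1 - \<alpha> - \<tau>) *\<^sub>R (y - x) + \<tau> *\<^sub>R (u - x))"
      by simp
    then have "x - z = ((1 - \<alpha> - \<tau>) / \<alpha>) *\<^sub>R (y - x) + (\<tau> / \<alpha>) *\<^sub>R (u - x)"
      using pos by (simp add: scaleR_add_right)
    moreover have "- (v \<bullet> a) = v \<bullet> (xs - x) + v \<bullet> (x - z)"
      by (simp add: a_def inner_diff_right)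
    ultimately have "- (v \<bullet> a) = v \<bullet> (xs - x) + (1 - \<alpha> - \<tau>) / \<alpha> * (v \<bullet> (y - x)) + \<tau> / \<alpha> * (v \<bullet> (u - x))"
      by (simp add: inner_add_right)
    moreover have "(1 - \<alpha> - \<tau>) / \<alpha> * (v \<bullet> (y - x)) \<le> (1 - \<alpha> - \<tau>) / \<alpha> * (Fy - l)"
      using lower_y pos by (intro mult_left_mono) auto
    moreover have "norm (xs - x) = norm b"
      by (simp add: b_def norm_minus_commute)
    ultimately show ?thesis
      using lower_xs by simp
  qed
  moreover have "1 / (8 * \<eta>) * (norm w)\<^sup>2 + 1 / (4 * \<eta>) * (norm w)\<^sup>2 \<le> 1 / (2 * \<eta>) * (norm w)\<^sup>2"
    using pos by (simp add: field_simps)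
  moreover have "z' - xs = a + w" "z - xs = a"
    by (simp_all add: a_def w_def)
  ultimately show ?thesis
    by simp
qed

section \<open>Mean squares of perturbed vectors\<close>

lemma norm_sq_add_le:
  fixes a b :: "'a :: real_inner"
  assumes "0 < s"
  shows "(norm (a + b))\<^sup>2 \<le> (1 + s) * (norm a)\<^sup>2 + (1 + 1 / s) * (norm b)\<^sup>2"
proof -
  have "0 \<le> (1 / s) * (norm (s *\<^sub>R a - b))\<^sup>2"
    using assms by simp
  also have "\<dots> = s * (norm a)\<^sup>2 + (1 / s) * (norm b)\<^sup>2 - 2 * (a \<bullet> b)"
    using assms unfolding power2_norm_eq_inner
    by (simp add: inner_diff_left inner_diff_right inner_commute field_simps power2_eq_square)
  finally show ?thesis
    by (simp add: power2_norm_eq_inner inner_add_left inner_add_right inner_commute algebra_simps)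
qed

lemma norm_sq_convex:
  fixes a b :: "'a :: real_inner"
  assumes "0 \<le> t" "t \<le> 1"
  shows "(norm ((1 - t) *\<^sub>R a + t *\<^sub>R b))\<^sup>2 \<le> (1 - t) * (norm a)\<^sup>2 + t * (norm b)\<^sup>2"
proof -
  have "0 \<le> t * (1 - t) * (norm (a - b))\<^sup>2"
    using assms by simp
  also have "\<dots> = (1 - t) * (norm a)\<^sup>2 + t * (norm b)\<^sup>2 - (norm ((1 - t) *\<^sub>R a + t *\<^sub>R b))\<^sup>2"
    unfolding power2_norm_eq_inner
    by (simp add: inner_diff_left inner_diff_right inner_add_left inner_add_right
        inner_commute algebra_simps)
  finally show ?thesis by simp
qed

text \<open>
Averaging before applying Young's inequality to the cross term is essential: the coefficient of \<open>b\<close> is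
then \<open>p + p\<^sup>2 / s\<close>, whereas Young's inequality for the outcome \<open>a + b\<close> would give \<open>p + p / s\<close>. For the tracking
variable \<open>G\<close> one has \<open>s = \<theta>\<close> and \<open>p\<close> at most of order \<open>\<theta>\<close>, so a factor \<open>1 / \<theta>\<close> is saved.
\<close>

lemma bernoulli_mean_norm_sq_le:
  fixes a b :: "'a :: real_inner"
  assumes "0 < s"
  shows "p * (norm (a + b))\<^sup>2 + (1 - p) * (norm a)\<^sup>2
    \<le> (1 + s) * (norm a)\<^sup>2 + (p + p\<^sup>2 / s) * (norm b)\<^sup>2"
proof -
  have "0 \<le> (1 / s) * (norm (s *\<^sub>R a - p *\<^sub>R b))\<^sup>2"
    using assms by simp
  also have "\<dots> = s * (norm a)\<^sup>2 + (p\<^sup>2 / s) * (norm b)\<^sup>2 - 2 * p * (a \<bullet> b)"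
    using assms unfolding power2_norm_eq_inner
    by (simp add: inner_diff_left inner_diff_right inner_commute field_simps power2_eq_square)
  finally show ?thesis
    by (simp add: power2_norm_eq_inner inner_add_left inner_add_right inner_commute algebra_simps)
qed

text \<open>
Bias-variance decomposition for the variable that is \<open>1 / q\<close> with probability \<open>q\<close> and \<open>0\<close> otherwise: its
mean is \<open>1\<close> and its variance \<open>1 / q - 1\<close>.
\<close>

lemma scaled_bernoulli_mean_norm_sq:
  fixes a r :: "'a :: real_inner"
  assumes "0 < q"
  shows "q * (norm (a - (1 / q) *\<^sub>R r))\<^sup>2 + (1 - q) * (norm a)\<^sup>2
    = (norm (a - r))\<^sup>2 + (1 / q - 1) * (norm r)\<^sup>2"
  using assms unfolding power2_norm_eq_inner
  by (simp add: inner_diff_left inner_diff_right inner_commute field_simps)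

section \<open>Consensus errors in one iteration\<close>

text \<open>
A Young parameter proportional to \<open>\<tau>\<close> keeps the coefficient of \<open>Y\<close> below \<open>1\<close>, since the weight \<open>1 - \<tau>\<close> of the
pair \<open>Y, Z\<close> leaves room of order \<open>\<tau>\<close>. The coefficient of \<open>Z\<close> is then of order \<open>(1 - \<tau>) * \<gamma>\<^sup>2 / \<tau>\<close> because \<open>Z\<close> has
relative weight \<open>\<alpha> / (1 - \<tau>) \<le> \<gamma>\<close> in the pair.
\<close>

lemma consensus_mix_le:
  fixes Y Z U :: "real ^ 'd ^ 'n"
  assumes "0 < \<tau>" "\<tau> < 1" "0 \<le> \<alpha>" "\<alpha> \<le> (1 - \<tau>) * \<gamma>" "\<alpha> \<le> 1 - \<tau>"
  shows "(norm (Pi_mat ** ((1 - \<alpha> - \<tau>) *\<^sub>R Y + \<alpha> *\<^sub>R Z + \<tau> *\<^sub>R U)))\<^sup>2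
    \<le> (1 - \<tau>) * (1 + \<tau> / 5) * (norm (Pi_mat ** Y))\<^sup>2
      + 6 * (1 - \<tau>) * \<gamma>\<^sup>2 / \<tau> * (norm (Pi_mat ** Z))\<^sup>2 + \<tau> * (norm (Pi_mat ** U))\<^sup>2"
proof -
  define \<rho> where "\<rho> = \<alpha> / (1 - \<tau>)"
  have \<rho>: "0 \<le> \<rho>" "\<rho> \<le> 1" "\<rho> \<le> \<gamma>" and \<alpha>: "\<alpha> = (1 - \<tau>) * \<rho>"
    using assms by (simp_all add: \<rho>_def field_simps)
  define y z u where "y = Pi_mat ** Y" and "z = Pi_mat ** Z" and "u = Pi_mat ** U"
  define c where "c = (1 - \<rho>) *\<^sub>R y + \<rho> *\<^sub>R z"
  have "(norm c)\<^sup>2 \<le> (1 + \<tau> / 5) * (norm ((1 - \<rho>) *\<^sub>R y))\<^sup>2 + (1 + 1 / (\<tau> / 5)) * (norm (\<rho> *\<^sub>R z))\<^sup>2"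
    unfolding c_def using assms by (intro norm_sq_add_le) auto
  also have "\<dots> \<le> (1 + \<tau> / 5) * (norm y)\<^sup>2 + 6 * \<gamma>\<^sup>2 / \<tau> * (norm z)\<^sup>2"
  proof (rule add_mono)
    have "(norm ((1 - \<rho>) *\<^sub>R y))\<^sup>2 \<le> (norm y)\<^sup>2"
      using \<rho> by (intro power_mono) (auto simp: mult_left_le_one_le)
    then show "(1 + \<tau> / 5) * (norm ((1 - \<rho>) *\<^sub>R y))\<^sup>2 \<le> (1 + \<tau> / 5) * (norm y)\<^sup>2"
      using assms by (intro mult_left_mono) auto
    have "(1 + 1 / (\<tau> / 5)) * \<rho>\<^sup>2 \<le> (6 / \<tau>) * \<gamma>\<^sup>2"
      using assms \<rho> by (intro mult_mono power_mono) (auto simp: field_simps)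
    then have "(1 + 1 / (\<tau> / 5)) * \<rho>\<^sup>2 * (norm z)\<^sup>2 \<le> (6 / \<tau>) * \<gamma>\<^sup>2 * (norm z)\<^sup>2"
      by (rule mult_right_mono) simp
    then show "(1 + 1 / (\<tau> / 5)) * (norm (\<rho> *\<^sub>R z))\<^sup>2 \<le> 6 * \<gamma>\<^sup>2 / \<tau> * (norm z)\<^sup>2"
      by (simp add: power_mult_distrib mult.assoc)
  qed
  finally have c_le: "(norm c)\<^sup>2 \<le> (1 + \<tau> / 5) * (norm y)\<^sup>2 + 6 * \<gamma>\<^sup>2 / \<tau> * (norm z)\<^sup>2" .
  have "Pi_mat ** ((1 - \<alpha> - \<tau>) *\<^sub>R Y + \<alpha> *\<^sub>R Z + \<tau> *\<^sub>R U) = (1 - \<tau>) *\<^sub>R c + \<tau> *\<^sub>R u"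
    by (simp add: matrix_mult_right_linear c_def y_def z_def u_def \<alpha> algebra_simps)
  also have "(norm ((1 - \<tau>) *\<^sub>R c + \<tau> *\<^sub>R u))\<^sup>2 \<le> (1 - \<tau>) * (norm c)\<^sup>2 + \<tau> * (norm u)\<^sup>2"
    using assms by (intro norm_sq_convex) auto
  also have "\<dots> \<le> (1 - \<tau>) * ((1 + \<tau> / 5) * (norm y)\<^sup>2 + 6 * \<gamma>\<^sup>2 / \<tau> * (norm z)\<^sup>2) + \<tau> * (norm u)\<^sup>2"
    using assms c_le by (intro add_right_mono mult_left_mono) auto
  finally show ?thesis
    using assms by (simp add: y_def z_def u_def algebra_simps)
qed

text \<open>
The Young parameter \<open>\<tau> / (4 - 2 * \<tau>)\<close> is chosen such that the factor of \<open>X\<close>, multiplied by the Lyapunov weight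
\<open>4 * (1 - \<tau>) / (4 - \<tau>)\<close> of \<open>Y\<close>, becomes \<open>2 * (1 - \<tau>) / (2 - \<tau>)\<close>, the first term of \<open>ssgt_cond_i\<close>.
\<close>

lemma consensus_Y_step_le:
  fixes X Z Z' :: "real ^ 'd ^ 'n"
  assumes "0 < \<tau>" "\<tau> < 1"
  shows "(norm (Pi_mat ** (X + \<gamma> *\<^sub>R (Z' - Z))))\<^sup>2
    \<le> (4 - \<tau>) / (4 - 2 * \<tau>) * (norm (Pi_mat ** X))\<^sup>2
      + (4 - \<tau>) / \<tau> * \<gamma>\<^sup>2 * (2 * (norm (Pi_mat ** Z'))\<^sup>2 + 2 * (norm (Pi_mat ** Z))\<^sup>2)"
proof -
  define s where "s = \<tau> / (4 - 2 * \<tau>)"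
  have s: "0 < s" "1 + s = (4 - \<tau>) / (4 - 2 * \<tau>)" "1 + 1 / s = (4 - \<tau>) / \<tau>"
    using assms by (simp_all add: s_def field_simps)
  have "Pi_mat ** (X + \<gamma> *\<^sub>R (Z' - Z)) = Pi_mat ** X + \<gamma> *\<^sub>R (Pi_mat ** Z' - Pi_mat ** Z)"
    by (simp add: matrix_mult_right_linear)
  also have "(norm \<dots>)\<^sup>2 \<le> (1 + s) * (norm (Pi_mat ** X))\<^sup>2
      + (1 + 1 / s) * (norm (\<gamma> *\<^sub>R (Pi_mat ** Z' - Pi_mat ** Z)))\<^sup>2"
    by (rule norm_sq_add_le[OF s(1)])
  also have "\<dots> = (1 + s) * (norm (Pi_mat ** X))\<^sup>2
      + (1 + 1 / s) * \<gamma>\<^sup>2 * (norm (Pi_mat ** Z' + (- (Pi_mat ** Z))))\<^sup>2"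
    by (simp add: power_mult_distrib)
  also have "\<dots> \<le> (1 + s) * (norm (Pi_mat ** X))\<^sup>2
      + (1 + 1 / s) * \<gamma>\<^sup>2 * (2 * (norm (Pi_mat ** Z'))\<^sup>2 + 2 * (norm (Pi_mat ** Z))\<^sup>2)"
    using norm_sq_add_le[of 1 "Pi_mat ** Z'" "- (Pi_mat ** Z)"] s(1)
    by (intro add_left_mono mult_left_mono) auto
  finally show ?thesis
    by (simp only: s)
qed

lemma gossip_matrix_range:
  assumes "gossip_matrix E \<theta> W" shows "0 < \<theta>" "\<theta> \<le> 1"
  using assms by (auto simp: gossip_matrix_def)

lemma Pi_mat_gossip_sq_le:
  fixes A :: "real ^ 'd ^ 'n"
  assumes "gossip_matrix E \<theta> W"
  shows "(norm (Pi_mat ** (W ** A)))\<^sup>2 \<le> (1 - \<theta>)\<^sup>2 * (norm (Pi_mat ** A))\<^sup>2"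
  using power_mono[OF Pi_mat_gossip_le[OF assms, of A], of 2] by (simp add: power_mult_distrib)

lemma gossip_rate_bounds:
  fixes \<theta> :: real
  assumes "0 < \<theta>" "\<theta> \<le> 1"
  shows "(1 - \<theta>)\<^sup>2 \<le> 1 - \<theta>" "(1 - \<theta>)\<^sup>2 * (1 + \<theta>) \<le> 1 - \<theta>" "(1 - \<theta>)\<^sup>2 * (1 + 1 / \<theta>) \<le> 1 / \<theta>"
proof -
  show "(1 - \<theta>)\<^sup>2 \<le> 1 - \<theta>"
    using assms by (simp add: power2_eq_square mult_left_le)
  have "(1 - \<theta>) * (1 - \<theta>\<^sup>2) \<le> (1 - \<theta>) * 1"
    using assms by (intro mult_left_mono) auto
  then show *: "(1 - \<theta>)\<^sup>2 * (1 + \<theta>) \<le> 1 - \<theta>"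
    by (simp add: power2_eq_square algebra_simps)
  have "(1 - \<theta>)\<^sup>2 * (1 + 1 / \<theta>) = ((1 - \<theta>)\<^sup>2 * (1 + \<theta>)) / \<theta>"
    using assms by (simp add: field_simps)
  also have "\<dots> \<le> 1 / \<theta>"
    using * assms by (intro divide_right_mono) auto
  finally show "(1 - \<theta>)\<^sup>2 * (1 + 1 / \<theta>) \<le> 1 / \<theta>" .
qed

lemma consensus_G_step_le:
  fixes G \<Delta> :: "real ^ 'd ^ 'n"
  assumes W: "gossip_matrix E \<theta> W" and "0 \<le> p"
  shows "p * (norm (Pi_mat ** (W ** G + \<Delta>)))\<^sup>2 + (1 - p) * (norm (Pi_mat ** (W ** G)))\<^sup>2
    \<le> (1 - \<theta>) * (norm (Pi_mat ** G))\<^sup>2 + (p + p\<^sup>2 / \<theta>) * (norm \<Delta>)\<^sup>2"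
proof -
  note th = gossip_matrix_range[OF W]
  have "p * (norm (Pi_mat ** (W ** G + \<Delta>)))\<^sup>2 + (1 - p) * (norm (Pi_mat ** (W ** G)))\<^sup>2
      \<le> (1 + \<theta>) * (norm (Pi_mat ** (W ** G)))\<^sup>2 + (p + p\<^sup>2 / \<theta>) * (norm (Pi_mat ** \<Delta>))\<^sup>2"
    unfolding matrix_mult_right_linear by (rule bernoulli_mean_norm_sq_le[OF th(1)])
  also have "\<dots> \<le> (1 + \<theta>) * ((1 - \<theta>)\<^sup>2 * (norm (Pi_mat ** G))\<^sup>2) + (p + p\<^sup>2 / \<theta>) * (norm \<Delta>)\<^sup>2"
    using th \<open>0 \<le> p\<close> by (intro add_mono mult_left_mono Pi_mat_gossip_sq_le[OF W] power_mono norm_Pi_mat_le) auto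
  also have "(1 + \<theta>) * ((1 - \<theta>)\<^sup>2 * (norm (Pi_mat ** G))\<^sup>2)
      = (1 - \<theta>)\<^sup>2 * (1 + \<theta>) * (norm (Pi_mat ** G))\<^sup>2"
    by simp
  also have "\<dots> \<le> (1 - \<theta>) * (norm (Pi_mat ** G))\<^sup>2"
    by (rule mult_right_mono[OF gossip_rate_bounds(2)[OF th]]) simp
  finally show ?thesis by simp
qed

text \<open>
In the mean the step applies \<open>W\<close> to \<open>Z\<close> plus a perturbation; Young's inequality with parameter \<open>\<theta>\<close> uses up one
of the two factors in \<open>(1 - \<theta>)\<^sup>2\<close> and multiplies the perturbation by \<open>1 / \<theta>\<close>. The variance is added without a
factor \<open>1 / \<theta>\<close> thanks to the exact bias-variance decomposition.
\<close>

lemma consensus_Z_step_le: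
  fixes X Z G \<Delta> :: "real ^ 'd ^ 'n" and \<eta> :: real
  assumes W: "gossip_matrix E \<theta> W" and "0 < q" "q \<le> 1" "0 \<le> \<beta>"
  defines "Z' \<equiv> \<lambda>\<zeta>. (1 / (1 + \<beta>)) *\<^sub>R (W ** (Z + \<beta> *\<^sub>R X - \<eta> *\<^sub>R (G + \<zeta> *\<^sub>R \<Delta>)))"
  shows "q * (norm (Pi_mat ** Z' (1 / q)))\<^sup>2 + (1 - q) * (norm (Pi_mat ** Z' 0))\<^sup>2
    \<le> (1 - \<theta>) * (norm (Pi_mat ** Z))\<^sup>2
      + 1 / \<theta> * (4 * \<beta>\<^sup>2 * (norm (Pi_mat ** X))\<^sup>2 + 4 * \<eta>\<^sup>2 * (norm (Pi_mat ** G))\<^sup>2 + 2 * \<eta>\<^sup>2 * (norm \<Delta>)\<^sup>2)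
      + \<eta>\<^sup>2 / q * (norm \<Delta>)\<^sup>2"
proof -
  note th = gossip_matrix_range[OF W]
  define P where "P = Z + \<beta> *\<^sub>R X - \<eta> *\<^sub>R G"
  define a r where "a = Pi_mat ** (W ** P)" and "r = Pi_mat ** (W ** (\<eta> *\<^sub>R \<Delta>))"
  have Z'_le: "(norm (Pi_mat ** Z' \<zeta>))\<^sup>2 \<le> (norm (a - \<zeta> *\<^sub>R r))\<^sup>2" for \<zeta>
  proof -
    have "Pi_mat ** Z' \<zeta> = (1 / (1 + \<beta>)) *\<^sub>R (a - \<zeta> *\<^sub>R r)"
      by (simp add: Z'_def a_def r_def P_def matrix_mult_right_linear algebra_simps)
    moreover have "norm ((1 / (1 + \<beta>)) *\<^sub>R v) \<le> norm v" for v :: "real ^ 'd ^ 'n"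
      using \<open>0 \<le> \<beta>\<close> by (simp add: divide_le_eq algebra_simps)
    ultimately show ?thesis by (metis norm_ge_zero power_mono)
  qed
  have \<Delta>_le: "(norm (Pi_mat ** \<Delta>))\<^sup>2 \<le> (norm \<Delta>)\<^sup>2"
    by (intro power_mono norm_Pi_mat_le) auto
  have r_le: "(norm r)\<^sup>2 \<le> \<eta>\<^sup>2 * (norm \<Delta>)\<^sup>2"
  proof -
    have "(norm r)\<^sup>2 \<le> (1 - \<theta>)\<^sup>2 * (norm (Pi_mat ** (\<eta> *\<^sub>R \<Delta>)))\<^sup>2"
      unfolding r_def by (rule Pi_mat_gossip_sq_le[OF W])
    also have "\<dots> \<le> 1 * (norm (Pi_mat ** (\<eta> *\<^sub>R \<Delta>)))\<^sup>2"
      using th by (intro mult_right_mono) (auto simp: power_le_one)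
    also have "\<dots> \<le> \<eta>\<^sup>2 * (norm \<Delta>)\<^sup>2"
      using \<Delta>_le by (simp add: matrix_mult_right_linear power_mult_distrib mult_left_mono)
    finally show ?thesis .
  qed
  define h where "h = \<beta> *\<^sub>R (Pi_mat ** X) - \<eta> *\<^sub>R (Pi_mat ** G) - \<eta> *\<^sub>R (Pi_mat ** \<Delta>)"
  have h_le: "(norm h)\<^sup>2 \<le> 4 * \<beta>\<^sup>2 * (norm (Pi_mat ** X))\<^sup>2 + 4 * \<eta>\<^sup>2 * (norm (Pi_mat ** G))\<^sup>2
      + 2 * \<eta>\<^sup>2 * (norm \<Delta>)\<^sup>2"
  proof -
    have "(norm h)\<^sup>2 \<le> 2 * (norm (\<beta> *\<^sub>R (Pi_mat ** X) - \<eta> *\<^sub>R (Pi_mat ** G)))\<^sup>2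
        + 2 * (norm (\<eta> *\<^sub>R (Pi_mat ** \<Delta>)))\<^sup>2"
      using norm_sq_add_le[of 1 "\<beta> *\<^sub>R (Pi_mat ** X) - \<eta> *\<^sub>R (Pi_mat ** G)" "- (\<eta> *\<^sub>R (Pi_mat ** \<Delta>))"]
      by (simp add: h_def)
    moreover have "(norm (\<beta> *\<^sub>R (Pi_mat ** X) - \<eta> *\<^sub>R (Pi_mat ** G)))\<^sup>2
        \<le> 2 * (norm (\<beta> *\<^sub>R (Pi_mat ** X)))\<^sup>2 + 2 * (norm (\<eta> *\<^sub>R (Pi_mat ** G)))\<^sup>2"
      using norm_sq_add_le[of 1 "\<beta> *\<^sub>R (Pi_mat ** X)" "- (\<eta> *\<^sub>R (Pi_mat ** G))"] by simp
    moreover have "\<eta>\<^sup>2 * (norm (Pi_mat ** \<Delta>))\<^sup>2 \<le> \<eta>\<^sup>2 * (norm \<Delta>)\<^sup>2"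
      by (intro mult_left_mono \<Delta>_le) auto
    ultimately show ?thesis
      by (simp add: power_mult_distrib)
  qed
  have ar_le: "(norm (a - r))\<^sup>2 \<le> (1 - \<theta>) * (norm (Pi_mat ** Z))\<^sup>2 + 1 / \<theta> * (norm h)\<^sup>2"
  proof -
    have "a - r = Pi_mat ** (W ** (P - \<eta> *\<^sub>R \<Delta>))"
      by (simp add: a_def r_def matrix_mult_right_linear)
    then have "(norm (a - r))\<^sup>2 \<le> (1 - \<theta>)\<^sup>2 * (norm (Pi_mat ** (P - \<eta> *\<^sub>R \<Delta>)))\<^sup>2"
      by (simp add: Pi_mat_gossip_sq_le[OF W])
    also have "Pi_mat ** (P - \<eta> *\<^sub>R \<Delta>) = Pi_mat ** Z + h"
      by (simp add: P_def h_def matrix_mult_right_linear)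
    also have "(1 - \<theta>)\<^sup>2 * (norm (Pi_mat ** Z + h))\<^sup>2
        \<le> (1 - \<theta>)\<^sup>2 * ((1 + \<theta>) * (norm (Pi_mat ** Z))\<^sup>2 + (1 + 1 / \<theta>) * (norm h)\<^sup>2)"
      by (intro mult_left_mono norm_sq_add_le[OF th(1)]) auto
    also have "\<dots> = (1 - \<theta>)\<^sup>2 * (1 + \<theta>) * (norm (Pi_mat ** Z))\<^sup>2
        + (1 - \<theta>)\<^sup>2 * (1 + 1 / \<theta>) * (norm h)\<^sup>2"
      by (simp add: algebra_simps)
    also have "\<dots> \<le> (1 - \<theta>) * (norm (Pi_mat ** Z))\<^sup>2 + 1 / \<theta> * (norm h)\<^sup>2"
      by (intro add_mono mult_right_mono gossip_rate_bounds[OF th]) auto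
    finally show ?thesis .
  qed
  have "q * (norm (Pi_mat ** Z' (1 / q)))\<^sup>2 + (1 - q) * (norm (Pi_mat ** Z' 0))\<^sup>2
      \<le> q * (norm (a - (1 / q) *\<^sub>R r))\<^sup>2 + (1 - q) * (norm a)\<^sup>2"
    using Z'_le[of "1 / q"] Z'_le[of 0] assms(2,3) by (intro add_mono mult_left_mono) auto
  also have "\<dots> = (norm (a - r))\<^sup>2 + (1 / q - 1) * (norm r)\<^sup>2"
    by (rule scaled_bernoulli_mean_norm_sq[OF \<open>0 < q\<close>])
  also have "\<dots> \<le> (norm (a - r))\<^sup>2 + 1 / q * (\<eta>\<^sup>2 * (norm \<Delta>)\<^sup>2)"
    using assms(2,3) r_le by (intro add_left_mono mult_mono) auto
  also have "\<dots> \<le> ((1 - \<theta>) * (norm (Pi_mat ** Z))\<^sup>2 + 1 / \<theta> * (4 * \<beta>\<^sup>2 * (norm (Pi_mat ** X))\<^sup>2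
      + 4 * \<eta>\<^sup>2 * (norm (Pi_mat ** G))\<^sup>2 + 2 * \<eta>\<^sup>2 * (norm \<Delta>)\<^sup>2)) + 1 / q * (\<eta>\<^sup>2 * (norm \<Delta>)\<^sup>2)"
    using ar_le mult_left_mono[OF h_le, of "1 / \<theta>"] th by simp
  finally show ?thesis by simp
qed

text \<open>
The weights in the consensus part of the Lyapunov function are arranged such that all terms proportional to
the consensus error \<open>x\<close> of the extrapolated point add up to at most \<open>1 - \<tau> / 8\<close>. One writes this as
\<open>x - \<tau> / 8 * x\<close>, bounds the first \<open>x\<close> by the errors \<open>y\<close>, \<open>z\<close>, \<open>u\<close> of the points it is mixed from, and keeps the negative
second one, which the outer factor \<open>8 / \<tau>\<close> turns into \<open>- x\<close>. The variables \<open>v\<close>, \<open>g\<close> are the errors of \<open>Q\<close> and \<open>G\<close>, the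
prefix \<open>E\<close> marks expectations after the step, and \<open>D\<close> is the squared change of the gradients. The factor
\<open>1 - \<theta> / 6\<close> in the weight of \<open>z\<close> reserves \<open>b * \<theta> / 6\<close> for the \<open>Ez\<close> that enters through \<open>Ey\<close>.
\<close>

lemma consensus_weights:
  fixes x y z u v g D :: real
  assumes rng: "ssgt_param_range \<alpha> \<beta> \<gamma> \<tau> p q \<eta>" and th: "0 < \<theta>" "\<theta> \<le> 1" and L: "0 < L"
    and condi: "ssgt_cond_i L \<theta> \<alpha> \<beta> \<gamma> \<tau> p \<eta>"
    and \<delta>: "0 \<le> \<delta>" "\<delta> \<le> p / 2"
    and nonneg: "0 \<le> x" "0 \<le> y" "0 \<le> z" "0 \<le> u" "0 \<le> v" "0 \<le> g" "0 \<le> D"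
    and mix: "x \<le> (1 - \<tau>) * (1 + \<tau> / 5) * y + 6 * (1 - \<tau>) * \<gamma>\<^sup>2 / \<tau> * z + \<tau> * u"
    and Ev: "Ev = p * x + (1 - p) * v"
    and Ey: "Ey \<le> (4 - \<tau>) / (4 - 2 * \<tau>) * x + (4 - \<tau>) / \<tau> * \<gamma>\<^sup>2 * (2 * Ez + 2 * z)"
    and Eu: "Eu \<le> (1 - \<theta>) * (p * x + (1 - p) * u)"
    and Ez: "Ez \<le> (1 - \<theta>) * z + 1 / \<theta> * (4 * \<beta>\<^sup>2 * x + 4 * \<eta>\<^sup>2 * g + 2 * \<eta>\<^sup>2 * D) + \<eta>\<^sup>2 / q * D"
    and Eg: "Eg \<le> (1 - \<theta>) * g + (p + p\<^sup>2 / \<theta>) * D"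
  defines "\<Psi> \<equiv> \<lambda>v y u z g. 8 / \<tau> * (\<tau> / (4 * p) * v + 4 * (1 - \<tau>) / (4 - \<tau>) * y + 16 / \<theta> * u
       + (1 - \<theta> / 6) * (48 * (1 - \<tau>) * \<gamma>\<^sup>2 / (\<tau> * \<theta>)) * z + 1 / (\<theta> * L\<^sup>2) * g)"
  shows "\<Psi> Ev Ey Eu Ez Eg \<le> (1 - \<delta>) * \<Psi> v y u z g - x - v / 2 + c2 L \<theta> \<gamma> \<tau> p q \<eta> * D"
proof -
  have r: "0 < \<beta>" "0 < \<gamma>" "0 < \<tau>" "\<tau> < 1" "0 < p" "p < 1" "0 < q" "q < 1" "0 < \<eta>"
    using rng by (auto simp: ssgt_param_range_def)
  define b where "b = 48 * (1 - \<tau>) * \<gamma>\<^sup>2 / (\<tau> * \<theta>)"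
  have b: "0 \<le> b"
    using r th by (simp add: b_def)
  define w where "w = 192 * (1 - \<tau>) * \<gamma>\<^sup>2 * \<beta>\<^sup>2 / (\<tau> * \<theta>\<^sup>2)"
  have w: "0 \<le> w"
    using r by (simp add: w_def)
  have cx: "2 * (1 - \<tau>) / (2 - \<tau>) + w + \<tau> / 4 + 16 * p / \<theta> \<le> 1 - \<tau> / 8"
    using condi by (simp add: ssgt_cond_i_def w_def)
  have cg: "192 * (1 - \<tau>) * \<gamma>\<^sup>2 * \<eta>\<^sup>2 * L\<^sup>2 / (\<tau> * \<theta>) \<le> \<theta> / 2"
    using condi by (simp add: ssgt_cond_i_def)
  \<comment> \<open>\<open>ssgt_cond_i\<close> forces \<open>p\<close>, and hence \<open>\<delta>\<close>, to be small compared with \<open>\<tau> * \<theta>\<close>; the slack in \<open>y\<close>, \<open>u\<close>, \<open>z\<close>, \<open>g\<close> absorbs such a \<open>\<delta>\<close>\<close>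
  have p_le: "16 * p / \<theta> \<le> 5 / 8 * \<tau>"
  proof -
    have "1 - \<tau> \<le> 2 * (1 - \<tau>) / (2 - \<tau>)"
      using r by (simp add: field_simps)
    with cx w show ?thesis by simp
  qed
  then have p_le': "p \<le> 5 / 128 * (\<tau> * \<theta>)"
    using th by (simp add: field_simps)
  then have \<delta>_\<tau>\<theta>: "\<delta> \<le> 5 / 256 * (\<tau> * \<theta>)"
    using \<delta> by simp
  have "\<tau> * \<theta> \<le> \<tau>" "\<tau> * \<theta> \<le> \<theta>"
    using r th by (simp_all add: mult_left_le mult_left_le_one_le)
  with \<delta>_\<tau>\<theta> have \<delta>_\<tau>: "\<delta> \<le> 5 / 256 * \<tau>" and \<delta>_\<theta>: "\<delta> \<le> 5 / 256 * \<theta>"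
    by simp_all
  define S where "S v y u z g = \<tau> / (4 * p) * v + 4 * (1 - \<tau>) / (4 - \<tau>) * y + 16 / \<theta> * u
       + (1 - \<theta> / 6) * b * z + 1 / (\<theta> * L\<^sup>2) * g" for v y u z g
  have tv: "\<tau> / (4 * p) * Ev = \<tau> / 4 * x + (\<tau> / (4 * p) - \<tau> / 4) * v"
    using r by (simp add: Ev field_simps)
  have ty: "4 * (1 - \<tau>) / (4 - \<tau>) * Ey \<le> 2 * (1 - \<tau>) / (2 - \<tau>) * x + b * \<theta> / 6 * (Ez + z)"
  proof -
    have "4 * (1 - \<tau>) / (4 - \<tau>) * Ey \<le> 4 * (1 - \<tau>) / (4 - \<tau>) *
        ((4 - \<tau>) / (4 - 2 * \<tau>) * x + (4 - \<tau>) / \<tau> * \<gamma>\<^sup>2 * (2 * Ez + 2 * z))"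
      using r by (intro mult_left_mono Ey) auto
    also have "\<dots> = 4 * (1 - \<tau>) / (4 - \<tau>) * ((4 - \<tau>) / (4 - 2 * \<tau>)) * x
        + 4 * (1 - \<tau>) / (4 - \<tau>) * ((4 - \<tau>) / \<tau> * \<gamma>\<^sup>2 * 2) * (Ez + z)"
      by (simp only: distrib_left mult.assoc)
    also have "4 * (1 - \<tau>) / (4 - \<tau>) * ((4 - \<tau>) / (4 - 2 * \<tau>)) = 2 * (1 - \<tau>) / (2 - \<tau>)"
    proof -
      have "4 * t / c * (c / (2 * d)) = 2 * t / d" if "c \<noteq> 0" for t c d :: real
        using that by simp
      from this[of "4 - \<tau>" "1 - \<tau>" "2 - \<tau>"] show ?thesis
        using r by simp
    qed
    also have "4 * (1 - \<tau>) / (4 - \<tau>) * ((4 - \<tau>) / \<tau> * \<gamma>\<^sup>2 * 2) = b * \<theta> / 6"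
      using r th by (simp add: b_def field_simps)
    finally show ?thesis .
  qed
  have tu: "16 / \<theta> * Eu \<le> 16 * p / \<theta> * x + (16 / \<theta> - 16) * u"
  proof -
    have "p * x + (1 - p) * u \<ge> 0"
      using r nonneg by simp
    have "16 / \<theta> * Eu \<le> 16 / \<theta> * ((1 - \<theta>) * (p * x + (1 - p) * u))"
      using th by (intro mult_left_mono Eu) auto
    also have "\<dots> \<le> 16 / \<theta> * (p * x + (1 - \<theta>) * u)"
    proof (intro mult_left_mono)
      have "(1 - \<theta>) * (p * x) \<le> p * x" "(1 - p) * ((1 - \<theta>) * u) \<le> (1 - \<theta>) * u"
        using r th nonneg by (intro mult_left_le_one_le; simp)+
      then show "(1 - \<theta>) * (p * x + (1 - p) * u) \<le> p * x + (1 - \<theta>) * u"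
        by (simp add: algebra_simps)
    qed (use th in auto)
    also have "\<dots> = 16 * p / \<theta> * x + (16 / \<theta> - 16) * u"
      using th by (simp add: field_simps)
    finally show ?thesis .
  qed
  have tz: "b * Ez \<le> b * (1 - \<theta>) * z + w * x + 1 / (2 * L\<^sup>2) * g + b * (\<eta>\<^sup>2 / q + 2 * \<eta>\<^sup>2 / \<theta>) * D"
  proof -
    have "b * Ez \<le> b * ((1 - \<theta>) * z + 1 / \<theta> * (4 * \<beta>\<^sup>2 * x + 4 * \<eta>\<^sup>2 * g + 2 * \<eta>\<^sup>2 * D) + \<eta>\<^sup>2 / q * D)"
      by (rule mult_left_mono[OF Ez b])
    also have "\<dots> = b * (1 - \<theta>) * z + (4 * b * \<beta>\<^sup>2 / \<theta>) * x + (4 * b * \<eta>\<^sup>2 / \<theta>) * g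
        + b * (\<eta>\<^sup>2 / q + 2 * \<eta>\<^sup>2 / \<theta>) * D"
      using th by (simp add: algebra_simps add_divide_distrib)
    also have "4 * b * \<beta>\<^sup>2 / \<theta> = w"
      using th r by (simp add: b_def w_def field_simps power2_eq_square)
    also have "(4 * b * \<eta>\<^sup>2 / \<theta>) * g \<le> 1 / (2 * L\<^sup>2) * g"
    proof (rule mult_right_mono)
      have "(192 * (1 - \<tau>) * \<gamma>\<^sup>2 * \<eta>\<^sup>2 * L\<^sup>2 / (\<tau> * \<theta>)) / (\<theta> * L\<^sup>2) \<le> (\<theta> / 2) / (\<theta> * L\<^sup>2)"
        using th L by (intro divide_right_mono cg) auto
      also have "(192 * (1 - \<tau>) * \<gamma>\<^sup>2 * \<eta>\<^sup>2 * L\<^sup>2 / (\<tau> * \<theta>)) / (\<theta> * L\<^sup>2) = 4 * b * \<eta>\<^sup>2 / \<theta>"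
        using th L r by (simp add: b_def field_simps)
      finally show "4 * b * \<eta>\<^sup>2 / \<theta> \<le> 1 / (2 * L\<^sup>2)"
        using th by simp
    qed (use nonneg in auto)
    finally show ?thesis by simp
  qed
  have tg: "1 / (\<theta> * L\<^sup>2) * Eg \<le> (1 / (\<theta> * L\<^sup>2) - 1 / L\<^sup>2) * g + 2 * p / (\<theta> * L\<^sup>2) * D"
  proof -
    have "p + p\<^sup>2 / \<theta> \<le> 2 * p"
    proof -
      have "p \<le> \<theta>"
        using p_le' \<open>\<tau> * \<theta> \<le> \<theta>\<close> th by linarith
      then have "p * (p / \<theta>) \<le> p * 1"
        using r th by (intro mult_left_mono) auto
      then show ?thesis by (simp add: power2_eq_square)
    qed
    then have "(p + p\<^sup>2 / \<theta>) * D \<le> 2 * p * D"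
      by (rule mult_right_mono) (use nonneg in simp)
    then have "1 / (\<theta> * L\<^sup>2) * Eg \<le> 1 / (\<theta> * L\<^sup>2) * ((1 - \<theta>) * g + 2 * p * D)"
      using th Eg by (intro mult_left_mono) auto
    also have "\<dots> = (1 / (\<theta> * L\<^sup>2) - 1 / L\<^sup>2) * g + 2 * p / (\<theta> * L\<^sup>2) * D"
      using th L by (simp add: field_simps)
    finally show ?thesis .
  qed
  have sum1: "S Ev Ey Eu Ez Eg
      \<le> (2 * (1 - \<tau>) / (2 - \<tau>) + w + \<tau> / 4 + 16 * p / \<theta>) * x
        + (\<tau> / (4 * p) - \<tau> / 4) * v + (16 / \<theta> - 16) * u + b * (1 - 5 / 6 * \<theta>) * z
        + (1 / (\<theta> * L\<^sup>2) - 1 / (2 * L\<^sup>2)) * g + (b * (\<eta>\<^sup>2 / q + 2 * \<eta>\<^sup>2 / \<theta>) + 2 * p / (\<theta> * L\<^sup>2)) * D"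
  proof -
    have "S Ev Ey Eu Ez Eg = \<tau> / (4 * p) * Ev + (4 * (1 - \<tau>) / (4 - \<tau>) * Ey - b * \<theta> / 6 * Ez)
        + 16 / \<theta> * Eu + b * Ez + 1 / (\<theta> * L\<^sup>2) * Eg"
      by (simp add: S_def algebra_simps)
    also have "\<dots> \<le> (\<tau> / 4 * x + (\<tau> / (4 * p) - \<tau> / 4) * v)
        + (2 * (1 - \<tau>) / (2 - \<tau>) * x + b * \<theta> / 6 * z) + (16 * p / \<theta> * x + (16 / \<theta> - 16) * u)
        + (b * (1 - \<theta>) * z + w * x + 1 / (2 * L\<^sup>2) * g + b * (\<eta>\<^sup>2 / q + 2 * \<eta>\<^sup>2 / \<theta>) * D)
        + ((1 / (\<theta> * L\<^sup>2) - 2 * (1 / (2 * L\<^sup>2))) * g + 2 * p / (\<theta> * L\<^sup>2) * D)"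
    proof (intro add_mono eq_refl[OF tv] tu tz)
      show "4 * (1 - \<tau>) / (4 - \<tau>) * Ey - b * \<theta> / 6 * Ez \<le> 2 * (1 - \<tau>) / (2 - \<tau>) * x + b * \<theta> / 6 * z"
        using ty unfolding distrib_left[of "b * \<theta> / 6"] by linarith
      show "1 / (\<theta> * L\<^sup>2) * Eg \<le> (1 / (\<theta> * L\<^sup>2) - 2 * (1 / (2 * L\<^sup>2))) * g + 2 * p / (\<theta> * L\<^sup>2) * D"
        using tg by simp
    qed
    also have "\<dots> = (2 * (1 - \<tau>) / (2 - \<tau>) + w + \<tau> / 4 + 16 * p / \<theta>) * x
        + (\<tau> / (4 * p) - \<tau> / 4) * v + (16 / \<theta> - 16) * u + b * (1 - 5 / 6 * \<theta>) * z
        + (1 / (\<theta> * L\<^sup>2) - 1 / (2 * L\<^sup>2)) * g + (b * (\<eta>\<^sup>2 / q + 2 * \<eta>\<^sup>2 / \<theta>) + 2 * p / (\<theta> * L\<^sup>2)) * D"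
    proof -
      have "(\<tau> / 4 * x + (k3 - \<tau> / 4) * v) + (k1 * x + b * \<theta> / 6 * z) + (k2 * x + (k4 - 16) * u)
          + (b * (1 - \<theta>) * z + w * x + h * g + m1 * D) + ((k5 - 2 * h) * g + m2 * D)
        = (k1 + w + \<tau> / 4 + k2) * x + (k3 - \<tau> / 4) * v + (k4 - 16) * u + b * (1 - 5 / 6 * \<theta>) * z
          + (k5 - h) * g + (m1 + m2) * D" for k1 k2 k3 k4 k5 h m1 m2 :: real
        by (simp add: algebra_simps)
      then show ?thesis .
    qed
    finally show ?thesis .
  qed
  have x_le: "(2 * (1 - \<tau>) / (2 - \<tau>) + w + \<tau> / 4 + 16 * p / \<theta>) * x \<le> (1 - \<tau> / 8) * x"
    using nonneg by (intro mult_right_mono cx)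
  have sum2: "(2 * (1 - \<tau>) / (2 - \<tau>) + w + \<tau> / 4 + 16 * p / \<theta>) * x
      \<le> (1 - \<tau>) * (1 + \<tau> / 5) * y + b * \<theta> / 8 * z + \<tau> * u - \<tau> / 8 * x"
  proof -
    have eq: "6 * (1 - \<tau>) * \<gamma>\<^sup>2 / \<tau> = b * \<theta> / 8"
      using th r by (simp add: b_def field_simps)
    have "(1 - \<tau> / 8) * x = x - \<tau> / 8 * x"
      by (simp add: left_diff_distrib)
    with x_le mix[unfolded eq] show ?thesis by linarith
  qed
  have cv: "(\<tau> / (4 * p) - \<tau> / 4) * v \<le> (1 - \<delta>) * (\<tau> / (4 * p) * v) - \<tau> / 16 * v"
  proof -
    have "\<delta> * (\<tau> / (4 * p)) \<le> p / 2 * (\<tau> / (4 * p))"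
      using r \<delta> by (intro mult_right_mono) auto
    also have "\<dots> = \<tau> / 8"
      using r by simp
    finally have "\<tau> / (4 * p) - \<tau> / 4 \<le> (1 - \<delta>) * (\<tau> / (4 * p)) - \<tau> / 16"
      unfolding left_diff_distrib using r by linarith
    then have "(\<tau> / (4 * p) - \<tau> / 4) * v \<le> ((1 - \<delta>) * (\<tau> / (4 * p)) - \<tau> / 16) * v"
      by (rule mult_right_mono) (use nonneg in auto)
    also have "\<dots> = (1 - \<delta>) * (\<tau> / (4 * p) * v) - \<tau> / 16 * v"
      by (simp only: left_diff_distrib[of "(1 - \<delta>) * (\<tau> / (4 * p))"] mult.assoc)
    finally show ?thesis .
  qed
  have cy: "(1 - \<tau>) * (1 + \<tau> / 5) * y \<le> (1 - \<delta>) * (4 * (1 - \<tau>) / (4 - \<tau>) * y)"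
  proof -
    have "(1 + \<tau> / 5) * (4 - \<tau>) \<le> 4 - 5 / 64 * \<tau>"
      using r by (simp add: algebra_simps)
    also have "\<dots> \<le> (1 - \<delta>) * 4"
      using \<delta>_\<tau> by simp
    finally have "1 + \<tau> / 5 \<le> (1 - \<delta>) * (4 / (4 - \<tau>))"
      using r by (simp add: field_simps)
    then have "(1 + \<tau> / 5) * ((1 - \<tau>) * y) \<le> (1 - \<delta>) * (4 / (4 - \<tau>)) * ((1 - \<tau>) * y)"
      by (rule mult_right_mono) (use r nonneg in auto)
    moreover have "4 * (1 - \<tau>) / (4 - \<tau>) * y = 4 / (4 - \<tau>) * ((1 - \<tau>) * y)"
      by (simp only: times_divide_eq_left times_divide_eq_right mult.assoc)
    moreover have "(1 - \<tau>) * (1 + \<tau> / 5) * y = (1 + \<tau> / 5) * ((1 - \<tau>) * y)"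
      by (simp only: mult_ac)
    ultimately show ?thesis by (simp only: mult.assoc)
  qed
  have cu: "(16 / \<theta> - 16) * u + \<tau> * u \<le> (1 - \<delta>) * (16 / \<theta> * u)"
  proof -
    have "\<delta> * (16 / \<theta>) \<le> 5 / 256 * \<theta> * (16 / \<theta>)"
      using th by (intro mult_right_mono \<delta>_\<theta>) auto
    also have "\<dots> \<le> 15"
      using th by simp
    finally have "16 / \<theta> - 16 + \<tau> \<le> (1 - \<delta>) * (16 / \<theta>)"
      unfolding left_diff_distrib using r by linarith
    then have "(16 / \<theta> - 16 + \<tau>) * u \<le> (1 - \<delta>) * (16 / \<theta>) * u"
      by (rule mult_right_mono) (use nonneg in auto)
    then show ?thesis by (simp only: algebra_simps)
  qed
  have cz: "b * (1 - 5 / 6 * \<theta>) * z + b * \<theta> / 8 * z \<le> (1 - \<delta>) * ((1 - \<theta> / 6) * b * z)"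
  proof -
    have "\<delta> * (1 - \<theta> / 6) \<le> \<delta> * 1"
      using \<delta> th by (intro mult_left_mono) auto
    then have "(1 - 5 / 6 * \<theta>) + \<theta> / 8 \<le> (1 - \<delta>) * (1 - \<theta> / 6)"
      using \<delta>_\<theta> th by (simp add: left_diff_distrib)
    then have "((1 - 5 / 6 * \<theta>) + \<theta> / 8) * (b * z) \<le> (1 - \<delta>) * (1 - \<theta> / 6) * (b * z)"
      by (rule mult_right_mono) (use nonneg b in auto)
    then show ?thesis by (simp add: algebra_simps)
  qed
  have cg': "(1 / (\<theta> * L\<^sup>2) - 1 / (2 * L\<^sup>2)) * g \<le> (1 - \<delta>) * (1 / (\<theta> * L\<^sup>2) * g)"
  proof -
    have "\<delta> * (1 / (\<theta> * L\<^sup>2)) \<le> \<theta> / 2 * (1 / (\<theta> * L\<^sup>2))"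
      using th \<delta>_\<theta> by (intro mult_right_mono) auto
    also have "\<theta> / 2 * (1 / (\<theta> * L\<^sup>2)) = 1 / (2 * L\<^sup>2)"
      using th by simp
    finally have "1 / (\<theta> * L\<^sup>2) - 1 / (2 * L\<^sup>2) \<le> (1 - \<delta>) * (1 / (\<theta> * L\<^sup>2))"
      unfolding left_diff_distrib by linarith
    then have "(1 / (\<theta> * L\<^sup>2) - 1 / (2 * L\<^sup>2)) * g \<le> (1 - \<delta>) * (1 / (\<theta> * L\<^sup>2)) * g"
      by (rule mult_right_mono) (use nonneg in auto)
    then show ?thesis by (simp only: mult.assoc)
  qed
  have "S Ev Ey Eu Ez Eg \<le> (1 - \<delta>) * S v y u z g - \<tau> / 8 * x - \<tau> / 16 * v
      + (b * (\<eta>\<^sup>2 / q + 2 * \<eta>\<^sup>2 / \<theta>) + 2 * p / (\<theta> * L\<^sup>2)) * D"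
    unfolding S_def[of v y u z g] distrib_left[of "1 - \<delta>"]
    using sum1 sum2 cv cy cu cz cg' by linarith
  then have "8 / \<tau> * S Ev Ey Eu Ez Eg \<le> 8 / \<tau> * ((1 - \<delta>) * S v y u z g - \<tau> / 8 * x - \<tau> / 16 * v
      + (b * (\<eta>\<^sup>2 / q + 2 * \<eta>\<^sup>2 / \<theta>) + 2 * p / (\<theta> * L\<^sup>2)) * D)"
    using r by (intro mult_left_mono) auto
  also have "\<dots> = (1 - \<delta>) * (8 / \<tau> * S v y u z g) - 8 / \<tau> * (\<tau> / 8) * x - 8 / \<tau> * (\<tau> / 16) * v
      + 8 / \<tau> * (b * (\<eta>\<^sup>2 / q + 2 * \<eta>\<^sup>2 / \<theta>) + 2 * p / (\<theta> * L\<^sup>2)) * D"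
    by (simp only: algebra_simps)
  also have "8 / \<tau> * (\<tau> / 8) = 1"
    using r by simp
  also have "8 / \<tau> * (\<tau> / 16) = 1 / 2"
    using r by simp
  also have "8 / \<tau> * (b * (\<eta>\<^sup>2 / q + 2 * \<eta>\<^sup>2 / \<theta>) + 2 * p / (\<theta> * L\<^sup>2)) = c2 L \<theta> \<gamma> \<tau> p q \<eta>"
  proof -
    have "8 / \<tau> * b = 384 * (1 - \<tau>) * \<gamma>\<^sup>2 / (\<tau>\<^sup>2 * \<theta>)"
      using r th by (simp add: b_def field_simps power2_eq_square)
    moreover have "8 / \<tau> * (2 * p / (\<theta> * L\<^sup>2)) = 16 * p / (\<tau> * \<theta> * L\<^sup>2)"
      by simp
    ultimately show ?thesis
      by (simp only: c2_def distrib_left[of "8 / \<tau>"] mult.assoc[symmetric])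
  qed
  finally show ?thesis
    by (simp only: \<Psi>_def S_def b_def mult_1 times_divide_eq_left)
qed

section \<open>Decrease of the Lyapunov function for a fixed state\<close>

locale ssgt_method =
  fixes f :: "'n::finite \<Rightarrow> real ^ 'd \<Rightarrow> real"
    and g :: "'n \<Rightarrow> real ^ 'd \<Rightarrow> real ^ 'd"
    and xs :: "real ^ 'd"
    and E :: "('n \<times> 'n) set"
    and W :: "real ^ 'n ^ 'n"
    and N \<mu> L \<theta> \<alpha> \<beta> \<gamma> \<tau> p q \<eta> :: real
  assumes N_eq: "N = real CARD('n)"
    and mu_pos: "0 < \<mu>" and mu_le_L: "\<mu> \<le> L"
    and agents: "\<forall>i. smooth_strongly_convex \<mu> L (f i) (g i)"
    and minimizer: "\<And>x. favg f xs \<le> favg f x"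
    and gossip: "gossip_matrix E \<theta> W"
    and admissible: "ssgt_admissible N \<mu> L \<theta> \<alpha> \<beta> \<gamma> \<tau> p q \<eta>"
begin

abbreviation (input) A :: real where "A \<equiv> (1 - \<alpha> - \<tau>) / \<alpha>"
abbreviation (input) C2 :: real where "C2 \<equiv> c2 L \<theta> \<gamma> \<tau> p q \<eta>"
abbreviation (input) C3 :: real where "C3 \<equiv> c3 N L \<alpha> \<gamma> \<tau>"
abbreviation (input) C4 :: real where "C4 \<equiv> c4 N L \<alpha> \<gamma> \<tau> q \<eta>"
abbreviation (input) \<delta> :: real where "\<delta> \<equiv> ssgt_delta \<theta> \<alpha> \<beta> \<gamma> \<tau> p"

lemma L_pos: "0 < L"
  using mu_pos mu_le_L by simp

lemma N_pos: "0 < N"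
  by (simp add: N_eq)

lemma param_range:
  "0 < \<alpha>" "\<alpha> < 1" "0 < \<beta>" "\<beta> < 1" "0 < \<gamma>" "\<gamma> < 1" "0 < \<tau>" "\<tau> < 1"
  "0 < p" "p < 1" "0 < q" "q < 1" "0 < \<eta>"
  using admissible by (auto simp: ssgt_admissible_def ssgt_param_range_def)

lemmas theta = gossip_matrix_range[OF gossip]

lemma
  shows cond_i: "ssgt_cond_i L \<theta> \<alpha> \<beta> \<gamma> \<tau> p \<eta>"
    and cond_ii: "2 * \<eta> * L\<^sup>2 / (q * N) \<le> C3 / 2" "C3 * C2 \<le> \<eta> / (2 * q * N)" "8 * \<eta> * L / q \<le> \<tau> / \<alpha>"
    and cond_iii: "L * \<gamma> \<le> 1 / (4 * \<eta>)" "\<beta> / (2 * \<eta>) \<le> \<mu> / 4" "1 / \<gamma> - A - 1 / 2 \<le> 0" "A \<le> 1 / \<gamma> - 1 / 4"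
  using admissible by (auto simp: ssgt_admissible_def ssgt_cond_ii_def ssgt_cond_iii_def)

lemma A_pos: "0 < A"
proof -
  have "1 < 1 / \<gamma>"
    using param_range by simp
  then show ?thesis
    using cond_iii(3) by linarith
qed

lemma mix_weight_pos: "0 < 1 - \<alpha> - \<tau>"
  using A_pos param_range by (simp add: zero_less_divide_iff)

text \<open>
The lower bound on \<open>(1 - \<alpha> - \<tau>) / \<alpha>\<close> in \<open>ssgt_cond_iii\<close> says \<open>1 / \<gamma> + 1 / 2 \<le> (1 - \<tau>) / \<alpha>\<close>. This controls the weight of
\<open>Z\<close> relative to that of \<open>Y\<close> and \<open>Z\<close> together even when \<open>\<tau>\<close> is close to \<open>1\<close>.
\<close>

lemma alpha_le: "\<alpha> \<le> (1 - \<tau>) * \<gamma>"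
proof -
  have "A = (1 - \<tau>) / \<alpha> - 1"
    using param_range by (simp add: field_simps)
  then have "1 / \<gamma> \<le> (1 - \<tau>) / \<alpha>"
    using cond_iii(3) by simp
  then show ?thesis
    using param_range by (simp add: field_simps)
qed

lemma c3_pos: "0 < C3"
  using A_pos param_range L_pos N_pos by (simp add: c3_def zero_less_divide_iff add_pos_pos)

lemma c4_ge_c3: "2 * C3 \<le> C4"
proof -
  have "8 \<le> \<tau> * q / (\<alpha> * \<eta> * L)"
    using cond_ii(3) param_range L_pos N_pos by (simp add: field_simps)
  then have "C3 * 8 \<le> C3 * (\<tau> * q / (\<alpha> * \<eta> * L))"
    using c3_pos by (intro mult_left_mono) auto
  also have "C3 * (\<tau> * q / (\<alpha> * \<eta> * L)) = 4 * C4"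
    using param_range L_pos by (simp add: c4_def)
  finally show ?thesis by simp
qed

text \<open>
The consensus error of \<open>X\<close> is also multiplied by \<open>\<tau> / \<alpha>\<close>, the weight of the snapshot, which \<open>c3\<close> does
not contain. The first inequality of \<open>ssgt_cond_ii\<close> shows that \<open>c4\<close> dominates this term too.
\<close>

lemma c4_ge_tau: "\<tau> * L / (\<alpha> * N) \<le> C4"
proof -
  have "4 * \<eta> * L\<^sup>2 / (q * N) * (\<tau> * q / (4 * \<alpha> * \<eta> * L)) \<le> C3 * (\<tau> * q / (4 * \<alpha> * \<eta> * L))"
    using cond_ii(1) param_range L_pos N_pos by (intro mult_right_mono) auto
  also have "4 * \<eta> * L\<^sup>2 / (q * N) * (\<tau> * q / (4 * \<alpha> * \<eta> * L)) = \<tau> * L / (\<alpha> * N)"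
    using param_range L_pos N_pos by (simp add: field_simps power2_eq_square)
  finally show ?thesis
    by (simp add: c4_def)
qed

text \<open>
Both terms multiply \<open>(norm (gradF g X - gradF g Q))\<^sup>2\<close>: the first is the variance of the averaged stochastic gradient, the
second its effect on the consensus errors. The bound is what makes \<open>gradient_gap_le\<close>, multiplied by it, produce at most
\<open>\<tau> / \<alpha>\<close> times the model gap at the snapshot, the amount gained in \<open>accelerated_step\<close>.
\<close>

lemma noise_coeff_le: "\<eta> / (q * N) + C4 * C2 \<le> \<tau> / (4 * \<alpha> * N * L)"
proof -
  have "C3 * C2 * (\<tau> * q / (4 * \<alpha> * \<eta> * L)) \<le> \<eta> / (2 * q * N) * (\<tau> * q / (4 * \<alpha> * \<eta> * L))"
    using cond_ii(2) param_range L_pos N_pos by (intro mult_right_mono) auto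
  also have "\<dots> = \<tau> / (8 * \<alpha> * N * L)"
    using param_range L_pos N_pos by (simp add: field_simps)
  finally have 1: "C4 * C2 \<le> \<tau> / (8 * \<alpha> * N * L)"
    by (simp add: c4_def mult_ac)
  have "8 * \<eta> * L / q * (1 / (8 * N * L)) \<le> \<tau> / \<alpha> * (1 / (8 * N * L))"
    using cond_ii(3) L_pos N_pos by (intro mult_right_mono) auto
  then have 2: "\<eta> / (q * N) \<le> \<tau> / (8 * \<alpha> * N * L)"
    using param_range L_pos N_pos by (simp add: mult_ac)
  have "\<tau> / (8 * \<alpha> * N * L) + \<tau> / (8 * \<alpha> * N * L) = \<tau> / (4 * \<alpha> * N * L)"
    by simp
  with 1 2 show ?thesis by linarith
qed

lemma delta_bounds:
  "\<delta> \<le> \<gamma> / 4" "\<delta> \<le> p_hat \<alpha> \<tau> p" "\<delta> \<le> \<beta> / (1 + \<beta>)" "\<delta> \<le> p / 2"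
  unfolding ssgt_delta_def by (rule Min_le; simp)+

lemma delta_pos: "0 < \<delta>"
  using param_range theta by (simp add: ssgt_delta_def p_hat_def)

lemma delta_less_1: "\<delta> < 1"
  using delta_bounds(4) param_range by simp

definition mix_point :: "real ^ 'd ^ 'n \<Rightarrow> real ^ 'd ^ 'n \<Rightarrow> real ^ 'd ^ 'n \<Rightarrow> real ^ 'd ^ 'n" where
  "mix_point Y Z U = (1 - \<alpha> - \<tau>) *\<^sub>R Y + \<alpha> *\<^sub>R Z + \<tau> *\<^sub>R U"

text \<open>
The bookkeeping of the Lyapunov function. \<open>ET\<close> and \<open>EC\<close> stand for the expected values of its averaged and its
consensus part, \<open>x\<close> and \<open>v\<close> for the consensus errors of \<open>X\<close> and \<open>Q\<close>, and \<open>l\<close> for the model value. The weight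
\<open>(2 * \<tau> + \<alpha>) / (2 * \<alpha> * p)\<close> of the snapshot makes the new snapshot value \<open>Fx\<close> appear with factor \<open>\<tau> / \<alpha> + 1 / 2\<close>, which cancels
the \<open>- \<tau> / \<alpha> * l\<close> contained in \<open>\<tau> / \<alpha> * vu\<close> up to the error of the model. What remains of \<open>Fs - l\<close> has the nonnegative coefficient
\<open>A + 1 / 2 - 1 / \<gamma>\<close>, and \<open>Fs - l\<close> is at most the model error because \<open>Fs\<close> is a minimum.
\<close>

lemma lyapunov_weights:
  fixes l Fs Fx Fy Fu zz x v D vu ET EC PC :: real
  assumes ET: "ET \<le> 1 / (2 * \<eta>) * zz + (Fs - l) + A * (Fy - l) + \<tau> / \<alpha> * vu
        + (l + L / (2 * N) * x) / \<gamma> + \<eta> / (q * N) * D"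
    and EC: "EC \<le> (1 - \<delta>) * PC - x - v / 2 + C2 * D"
    and Fx: "Fx \<le> l + L / (2 * N) * x"
    and D: "D \<le> 4 * L * N * (Fu - l - vu) + 2 * L\<^sup>2 * v"
    and nonneg: "0 \<le> zz" "0 \<le> x" "0 \<le> v" "0 \<le> D" "Fs \<le> Fx" "Fs \<le> Fy" "Fs \<le> Fu"
  shows "ET - Fs / \<gamma> + (2 * \<tau> + \<alpha>) / (2 * \<alpha> * p) * (p * (Fx - Fs) + (1 - p) * (Fu - Fs)) + C4 * EC
    \<le> (1 - \<delta>) * (1 / \<gamma> * (Fy - Fs) + (2 * \<tau> + \<alpha>) / (2 * \<alpha> * p) * (Fu - Fs)
        + (1 + \<beta>) / (2 * \<eta>) * zz + C4 * PC)"
proof -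
  define c where "c = L / (2 * N) * x"
  define K where "K = (2 * \<tau> + \<alpha>) / (2 * \<alpha> * p)"
  have Kp: "K * p = \<tau> / \<alpha> + 1 / 2" and K: "0 \<le> K"
    using param_range by (simp_all add: K_def field_simps)
  have "K * p_hat \<alpha> \<tau> p = 1 / 2"
    using param_range by (simp add: K_def p_hat_def)
  moreover have "\<delta> * K \<le> p_hat \<alpha> \<tau> p * K"
    using K delta_bounds by (intro mult_right_mono) auto
  ultimately have "\<tau> / \<alpha> + K * (1 - p) \<le> (1 - \<delta>) * K"
    using Kp by (simp add: right_diff_distrib left_diff_distrib mult.commute)
  then have u_part: "\<tau> / \<alpha> * (Fu - Fs) + K * (1 - p) * (Fu - Fs) \<le> (1 - \<delta>) * (K * (Fu - Fs))"
    using mult_right_mono[of "\<tau> / \<alpha> + K * (1 - p)" "(1 - \<delta>) * K" "Fu - Fs"] nonneg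
    by (simp add: distrib_right mult.assoc)
  have y_part: "A * (Fy - Fs) \<le> (1 - \<delta>) * (1 / \<gamma> * (Fy - Fs))"
  proof -
    have "\<delta> * (1 / \<gamma>) \<le> \<gamma> / 4 * (1 / \<gamma>)"
      using param_range delta_bounds by (intro mult_right_mono) auto
    also have "\<gamma> / 4 * (1 / \<gamma>) = 1 / 4"
      using param_range by simp
    finally have "A \<le> (1 - \<delta>) * (1 / \<gamma>)"
      unfolding left_diff_distrib using cond_iii(4) by linarith
    then have "A * (Fy - Fs) \<le> (1 - \<delta>) * (1 / \<gamma>) * (Fy - Fs)"
      using nonneg by (intro mult_right_mono) auto
    then show ?thesis by (simp only: mult.assoc)
  qed
  have z_part: "1 / (2 * \<eta>) * zz \<le> (1 - \<delta>) * ((1 + \<beta>) / (2 * \<eta>) * zz)"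
  proof -
    have "(1 - \<beta> / (1 + \<beta>)) * (1 + \<beta>) \<le> (1 - \<delta>) * (1 + \<beta>)"
      using delta_bounds param_range by (intro mult_right_mono) auto
    then have "1 \<le> (1 - \<delta>) * (1 + \<beta>)"
      using param_range by (simp add: left_diff_distrib)
    then have "1 * (zz / (2 * \<eta>)) \<le> (1 - \<delta>) * (1 + \<beta>) * (zz / (2 * \<eta>))"
      using nonneg param_range by (intro mult_right_mono) auto
    then show ?thesis by simp
  qed
  have x_part: "(1 + A) * c + \<tau> / \<alpha> * c \<le> C4 * x"
  proof -
    have "(1 + A) * L / N \<le> C3"
    proof -
      have "C3 = (1 + A) * L / N + L / (N * \<gamma>)"
        by (simp add: c3_def algebra_simps add_divide_distrib)
      moreover have "0 \<le> L / (N * \<gamma>)"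
        using L_pos N_pos param_range by simp
      ultimately show ?thesis by linarith
    qed
    then have "(1 + A) * L / N \<le> C4 / 2"
      using c4_ge_c3 by linarith
    then have "(1 + A) * L / N * (x / 2) + \<tau> * L / (\<alpha> * N) * (x / 2) \<le> C4 / 2 * (x / 2) + C4 * (x / 2)"
      using c4_ge_tau nonneg by (intro add_mono mult_right_mono) auto
    also have "\<dots> \<le> C4 * x"
      using c4_ge_c3 c3_pos nonneg by simp
    finally have "(1 + A) * L / N * (x / 2) + \<tau> * L / (\<alpha> * N) * (x / 2) \<le> C4 * x" .
    moreover have "(1 + A) * c = (1 + A) * L / N * (x / 2)" "\<tau> / \<alpha> * c = \<tau> * L / (\<alpha> * N) * (x / 2)"
      by (simp_all add: c_def mult_ac)
    ultimately show ?thesis by simp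
  qed
  have D_part: "\<eta> / (q * N) * D + C4 * (C2 * D) - \<tau> / \<alpha> * (Fu - l - vu) \<le> C4 * (v / 2)"
  proof -
    have "\<eta> / (q * N) * D + C4 * (C2 * D) = (\<eta> / (q * N) + C4 * C2) * D"
      by (simp add: distrib_right mult.assoc)
    also have "\<dots> \<le> \<tau> / (4 * \<alpha> * N * L) * D"
      by (rule mult_right_mono[OF noise_coeff_le nonneg(4)])
    also have "\<dots> \<le> \<tau> / (4 * \<alpha> * N * L) * (4 * L * N * (Fu - l - vu) + 2 * L\<^sup>2 * v)"
      using param_range L_pos N_pos by (intro mult_left_mono D) auto
    also have "\<dots> = \<tau> / \<alpha> * (Fu - l - vu) + \<tau> * L / (\<alpha> * N) * (v / 2)"
      using param_range L_pos N_pos by (simp add: field_simps power2_eq_square)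
    also have "\<tau> * L / (\<alpha> * N) * (v / 2) \<le> C4 * (v / 2)"
      using nonneg by (intro mult_right_mono c4_ge_tau) auto
    finally show ?thesis by linarith
  qed
  have C_part: "C4 * EC \<le> (1 - \<delta>) * (C4 * PC) - C4 * x - C4 * (v / 2) + C4 * (C2 * D)"
    using mult_left_mono[OF EC, of C4] c4_ge_c3 c3_pos
    by (simp add: algebra_simps)
  have l_part: "(Fs - l) * (A + 1 / 2 - 1 / \<gamma>) \<le> c * (A + 1 / 2 - 1 / \<gamma>)"
  proof (rule mult_right_mono)
    show "Fs - l \<le> c"
      using nonneg Fx by (simp add: c_def)
    show "0 \<le> A + 1 / 2 - 1 / \<gamma>"
      using cond_iii(3) by linarith
  qed
  have "K * (p * (Fx - Fs)) = (\<tau> / \<alpha> + 1 / 2) * (Fx - Fs)"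
    by (simp only: Kp[symmetric] mult.assoc)
  also have "\<dots> \<le> (\<tau> / \<alpha> + 1 / 2) * (l + c - Fs)"
    using Fx param_range by (intro mult_left_mono) (auto simp: c_def)
  finally have x_func: "K * (p * (Fx - Fs)) \<le> (\<tau> / \<alpha> + 1 / 2) * (l + c - Fs)" .
  have "ET - Fs / \<gamma> + K * (p * (Fx - Fs) + (1 - p) * (Fu - Fs)) + C4 * EC
      = ET - Fs / \<gamma> + K * (p * (Fx - Fs)) + K * (1 - p) * (Fu - Fs) + C4 * EC"
    by (simp add: algebra_simps)
  also have "\<dots> \<le> (1 / (2 * \<eta>) * zz + (Fs - l) + A * (Fy - l) + \<tau> / \<alpha> * vu + (l + c) / \<gamma> + \<eta> / (q * N) * D)
      - Fs / \<gamma> + (\<tau> / \<alpha> + 1 / 2) * (l + c - Fs) + K * (1 - p) * (Fu - Fs) + C4 * EC"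
    using ET x_func by (simp add: c_def)
  also have "\<dots> = 1 / (2 * \<eta>) * zz + A * (Fy - Fs) + (\<tau> / \<alpha> * (Fu - Fs) + K * (1 - p) * (Fu - Fs))
      + (Fs - l) * (A + 1 / 2 - 1 / \<gamma>) + c / \<gamma> + (\<tau> / \<alpha> + 1 / 2) * c
      + (\<eta> / (q * N) * D - \<tau> / \<alpha> * (Fu - l - vu)) + C4 * EC"
  proof -
    have "w + (Fs - l) + a * (Fy - l) + t * vu + k * (l + c) + e - k * Fs + (t + 1 / 2) * (l + c - Fs)
          + h * (Fu - Fs) + r
        = w + a * (Fy - Fs) + (t * (Fu - Fs) + h * (Fu - Fs)) + (Fs - l) * (a + 1 / 2 - k) + k * c
          + (t + 1 / 2) * c + (e - t * (Fu - l - vu)) + r" for w a t k e h r :: real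
      by (simp add: field_simps)
    from this[where k = "1 / \<gamma>" and a = A and t = "\<tau> / \<alpha>"] show ?thesis by simp
  qed
  also have "\<dots> \<le> 1 / (2 * \<eta>) * zz + A * (Fy - Fs) + (\<tau> / \<alpha> * (Fu - Fs) + K * (1 - p) * (Fu - Fs))
      + c * (A + 1 / 2 - 1 / \<gamma>) + c / \<gamma> + (\<tau> / \<alpha> + 1 / 2) * c
      + (\<eta> / (q * N) * D - \<tau> / \<alpha> * (Fu - l - vu)) + C4 * EC"
    using l_part by simp
  also have "\<dots> = 1 / (2 * \<eta>) * zz + A * (Fy - Fs) + (\<tau> / \<alpha> * (Fu - Fs) + K * (1 - p) * (Fu - Fs))
      + ((1 + A) * c + \<tau> / \<alpha> * c) + (\<eta> / (q * N) * D - \<tau> / \<alpha> * (Fu - l - vu)) + C4 * EC"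
    by (simp add: algebra_simps)
  also have "\<dots> \<le> (1 - \<delta>) * ((1 + \<beta>) / (2 * \<eta>) * zz) + (1 - \<delta>) * (1 / \<gamma> * (Fy - Fs)) + (1 - \<delta>) * (K * (Fu - Fs))
      + (1 - \<delta>) * (C4 * PC)"
    using z_part y_part u_part x_part D_part C_part by linarith
  finally show ?thesis
    by (simp add: K_def distrib_left)
qed

definition next_Z :: "real \<Rightarrow> real ^ 'd ^ 'n \<Rightarrow> real ^ 'd ^ 'n \<Rightarrow> real ^ 'd ^ 'n \<Rightarrow> real ^ 'd ^ 'n \<Rightarrow> real ^ 'd ^ 'n" where
  "next_Z b X Z Q G = (1 / (1 + \<beta>)) *\<^sub>R (W ** (Z + \<beta> *\<^sub>R X
     - \<eta> *\<^sub>R (G + b *\<^sub>R (gradF g X - gradF g Q))))"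

text \<open>
The Lyapunov function is split according to the randomness that the next iterate depends on: \<open>Y\<close> and \<open>Z\<close> use only
\<open>\<zeta>\<close>, while \<open>U\<close>, \<open>Q\<close> and \<open>G\<close> use only \<open>\<xi>\<close>.
\<close>

definition phi_YZ :: "real ^ 'd ^ 'n \<Rightarrow> real ^ 'd ^ 'n \<Rightarrow> real" where
  "phi_YZ Y Z = 1 / \<gamma> * (favg f (row_avg Y) - favg f xs)
     + (1 + \<beta>) / (2 * \<eta>) * (norm (row_avg Z - xs))\<^sup>2
     + C4 * (8 / \<tau> * (4 * (1 - \<tau>) / (4 - \<tau>) * (norm (Pi_mat ** Y))\<^sup>2
         + (1 - \<theta> / 6) * (48 * (1 - \<tau>) * \<gamma>\<^sup>2 / (\<tau> * \<theta>)) * (norm (Pi_mat ** Z))\<^sup>2))"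

definition phi_UQG :: "real ^ 'd ^ 'n \<Rightarrow> real ^ 'd ^ 'n \<Rightarrow> real ^ 'd ^ 'n \<Rightarrow> real" where
  "phi_UQG U Q G = (2 * \<tau> + \<alpha>) / (2 * \<alpha> * p) * (favg f (row_avg U) - favg f xs)
     + C4 * (8 / \<tau> * (\<tau> / (4 * p) * (norm (Pi_mat ** Q))\<^sup>2 + 16 / \<theta> * (norm (Pi_mat ** U))\<^sup>2
         + 1 / (\<theta> * L\<^sup>2) * (norm (Pi_mat ** G))\<^sup>2))"

abbreviation (input) phi where
  "phi Y Z U Q G \<equiv> ssgt_Phi f xs L \<theta> \<alpha> \<beta> \<gamma> \<tau> p q \<eta> Y Z U Q G"

lemma phi_split: "phi Y Z U Q G = phi_YZ Y Z + phi_UQG U Q G"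
  unfolding ssgt_Phi_def Phi_U_def Phi_C_def phi_YZ_def phi_UQG_def N_eq[symmetric]
  by (simp only: distrib_left add_ac)

lemma phi_nonneg: "0 \<le> phi Y Z U Q G"
proof -
  have "0 \<le> phi_YZ Y Z"
    unfolding phi_YZ_def using param_range theta minimizer[of "row_avg Y"] c4_ge_c3 c3_pos
    by (intro add_nonneg_nonneg mult_nonneg_nonneg) auto
  moreover have "0 \<le> phi_UQG U Q G"
    unfolding phi_UQG_def using param_range theta minimizer[of "row_avg U"] c4_ge_c3 c3_pos
    by (intro add_nonneg_nonneg mult_nonneg_nonneg) auto
  ultimately show ?thesis
    by (simp add: phi_split)
qed

text \<open>
The expected decrease for a fixed state, as a weighted sum over the two outcomes of \<open>\<zeta>\<close> and the two outcomes of \<open>\<xi>\<close>. The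
two hypotheses are invariants of the iteration: \<open>Q\<close> has the same average as \<open>U\<close>, so that the snapshot gradients are the
ones compared in \<open>gradient_gap_le\<close>, and \<open>G\<close> tracks the average gradient at \<open>Q\<close>, which makes the stochastic gradient of the
averages unbiased.
\<close>

lemma expected_phi_decrease:
  fixes Y Z U Q G :: "real ^ 'd ^ 'n"
  assumes avgU: "row_avg U = row_avg Q" and avgG: "row_avg G = row_avg (gradF g Q)"
  defines "X \<equiv> mix_point Y Z U"
  defines "Z' \<equiv> \<lambda>b. next_Z b X Z Q G"
  defines "Y' \<equiv> \<lambda>b. X + \<gamma> *\<^sub>R (Z' b - Z)"
  defines "U' \<equiv> \<lambda>a. W ** (a *\<^sub>R X + (1 - a) *\<^sub>R U)"
  defines "Q' \<equiv> \<lambda>a. a *\<^sub>R X + (1 - a) *\<^sub>R Q"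
  defines "G' \<equiv> \<lambda>a. W ** G + a *\<^sub>R (gradF g X - gradF g Q)"
  shows "(q * phi_YZ (Y' (1 / q)) (Z' (1 / q)) + (1 - q) * phi_YZ (Y' 0) (Z' 0))
      + (p * phi_UQG (U' 1) (Q' 1) (G' 1) + (1 - p) * phi_UQG (U' 0) (Q' 0) (G' 0))
    \<le> (1 - \<delta>) * phi Y Z U Q G"
proof -
  define \<Delta> where "\<Delta> = gradF g X - gradF g Q"
  define D where "D = (norm \<Delta>)\<^sup>2"
  define cs where "cs V = (norm (Pi_mat ** V))\<^sup>2" for V :: "real ^ 'd ^ 'n"
  define v where "v = row_avg (gradF g X)"
  define d where "d = row_avg \<Delta>"
  define l where "l = model_value f g X"
  define xb yb zb ub where "xb = row_avg X" and "yb = row_avg Y" and "zb = row_avg Z" and "ub = row_avg U"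
  have xb_eq: "xb = (1 - \<alpha> - \<tau>) *\<^sub>R yb + \<alpha> *\<^sub>R zb + \<tau> *\<^sub>R ub"
    by (simp add: xb_def yb_def zb_def ub_def X_def mix_point_def row_avg_linear)

  \<comment> \<open>the averaged sequences, for a fixed outcome of the noise\<close>
  have avg_Z': "row_avg (Z' b) = (1 / (1 + \<beta>)) *\<^sub>R (zb + \<beta> *\<^sub>R xb - \<eta> *\<^sub>R (v + (b - 1) *\<^sub>R d))" for b
  proof -
    have "row_avg G + b *\<^sub>R d = v + (b - 1) *\<^sub>R d"
      by (simp add: avgG v_def d_def \<Delta>_def row_avg_linear algebra_simps)
    moreover have "row_avg (Z' b) = (1 / (1 + \<beta>)) *\<^sub>R (zb + \<beta> *\<^sub>R xb - \<eta> *\<^sub>R (row_avg G + b *\<^sub>R d))"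
      by (simp add: Z'_def next_Z_def row_avg_linear row_avg_gossip[OF gossip] zb_def xb_def d_def \<Delta>_def)
    ultimately show ?thesis by simp
  qed
  have avg_Y': "row_avg (Y' b) = xb + \<gamma> *\<^sub>R (row_avg (Z' b) - zb)" for b
    by (simp add: Y'_def row_avg_linear xb_def zb_def)
  define T where "T b = favg f (row_avg (Y' b)) / \<gamma>
      + (1 + \<beta>) / (2 * \<eta>) * (norm (row_avg (Z' b) - xs))\<^sup>2" for b
  define R where "R = 1 / (2 * \<eta>) * (norm (zb - xs))\<^sup>2 + (favg f xs - l) + A * (favg f yb - l)
      + \<tau> / \<alpha> * (v \<bullet> (ub - xb)) + (l + L / (2 * N) * cs X) / \<gamma>"
  have T_le: "T b \<le> R - (b - 1) * (d \<bullet> (zb - xs)) + \<eta> * (b - 1)\<^sup>2 * (norm d)\<^sup>2" for b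
    unfolding T_def R_def
  proof (rule accelerated_step[OF xb_eq avg_Z'])
    show "favg f (row_avg (Y' b)) \<le> l + v \<bullet> (\<gamma> *\<^sub>R (row_avg (Z' b) - zb))
        + L / 2 * (norm (\<gamma> *\<^sub>R (row_avg (Z' b) - zb)))\<^sup>2 + L / (2 * N) * cs X"
      using favg_le_model[OF agents, of "row_avg (Y' b)" X]
      by (simp add: avg_Y' l_def v_def xb_def cs_def N_eq)
    show "l + v \<bullet> (xs - xb) + \<mu> / 2 * (norm (xs - xb))\<^sup>2 \<le> favg f xs"
      using model_le_favg[OF agents, of X xs] mu_pos by (simp add: l_def v_def xb_def)
    have "0 \<le> \<mu> / 2 * (norm (yb - xb))\<^sup>2"
      using mu_pos by simp
    moreover have "l + v \<bullet> (yb - xb) + \<mu> / 2 * (norm (yb - xb))\<^sup>2 \<le> favg f yb"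
      using model_le_favg[OF agents, of X yb] mu_pos by (simp add: l_def v_def xb_def)
    ultimately show "l + v \<bullet> (yb - xb) \<le> favg f yb"
      by linarith
    show "\<beta> / (2 * \<eta>) \<le> \<mu> / 2"
      using cond_iii(2) mu_pos by simp
  qed (use param_range mix_weight_pos cond_iii(1) in auto)
  have d_le: "(norm d)\<^sup>2 \<le> D / N"
    using norm_row_avg_le[of \<Delta>] N_pos by (simp add: d_def D_def N_eq field_simps)
  \<comment> \<open>the noise \<open>b - 1\<close> has mean \<open>0\<close> and variance \<open>1 / q - 1\<close>\<close>
  have ET: "q * T (1 / q) + (1 - q) * T 0 \<le> R + \<eta> / (q * N) * D"
  proof -
    have "q * T (1 / q) + (1 - q) * T 0
        \<le> q * (R - (1 / q - 1) * (d \<bullet> (zb - xs)) + \<eta> * (1 / q - 1)\<^sup>2 * (norm d)\<^sup>2)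
          + (1 - q) * (R - (0 - 1) * (d \<bullet> (zb - xs)) + \<eta> * (0 - 1)\<^sup>2 * (norm d)\<^sup>2)"
      using param_range by (intro add_mono mult_left_mono T_le) auto
    also have "\<dots> = R + \<eta> * (1 / q - 1) * (norm d)\<^sup>2"
      using param_range by (simp add: field_simps power2_eq_square)
    also have "\<dots> \<le> R + \<eta> * (1 / q) * (D / N)"
      using param_range d_le by (intro add_left_mono mult_mono) auto
    finally show ?thesis by simp
  qed

  define Ey where "Ey = q * cs (Y' (1 / q)) + (1 - q) * cs (Y' 0)"
  define Ez where "Ez = q * cs (Z' (1 / q)) + (1 - q) * cs (Z' 0)"
  define Eu where "Eu = p * cs (U' 1) + (1 - p) * cs (U' 0)"
  define Ev where "Ev = p * cs (Q' 1) + (1 - p) * cs (Q' 0)"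
  define Eg where "Eg = p * cs (G' 1) + (1 - p) * cs (G' 0)"
  define \<Psi> where "\<Psi> v y u z g = 8 / \<tau> * (\<tau> / (4 * p) * v + 4 * (1 - \<tau>) / (4 - \<tau>) * y + 16 / \<theta> * u
       + (1 - \<theta> / 6) * (48 * (1 - \<tau>) * \<gamma>\<^sup>2 / (\<tau> * \<theta>)) * z + 1 / (\<theta> * L\<^sup>2) * g)" for v y u z g :: real
  have EC: "\<Psi> Ev Ey Eu Ez Eg \<le> (1 - \<delta>) * \<Psi> (cs Q) (cs Y) (cs U) (cs Z) (cs G)
      - cs X - cs Q / 2 + C2 * D"
    unfolding \<Psi>_def
  proof (rule consensus_weights)
    show "ssgt_param_range \<alpha> \<beta> \<gamma> \<tau> p q \<eta>"
      using admissible by (simp add: ssgt_admissible_def)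
    show "cs X \<le> (1 - \<tau>) * (1 + \<tau> / 5) * cs Y + 6 * (1 - \<tau>) * \<gamma>\<^sup>2 / \<tau> * cs Z + \<tau> * cs U"
      unfolding cs_def X_def mix_point_def using param_range alpha_le mix_weight_pos
      by (intro consensus_mix_le) auto
    show "Ev = p * cs X + (1 - p) * cs Q"
      by (simp add: Ev_def Q'_def)
    show "Ey \<le> (4 - \<tau>) / (4 - 2 * \<tau>) * cs X + (4 - \<tau>) / \<tau> * \<gamma>\<^sup>2 * (2 * Ez + 2 * cs Z)"
    proof -
      define k1 k2 where "k1 = (4 - \<tau>) / (4 - 2 * \<tau>)" and "k2 = (4 - \<tau>) / \<tau> * \<gamma>\<^sup>2"
      have "cs (Y' b) \<le> k1 * cs X + k2 * (2 * cs (Z' b) + 2 * cs Z)" for b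
        unfolding cs_def Y'_def k1_def k2_def using param_range by (intro consensus_Y_step_le) auto
      then have "Ey \<le> q * (k1 * cs X + k2 * (2 * cs (Z' (1 / q)) + 2 * cs Z))
          + (1 - q) * (k1 * cs X + k2 * (2 * cs (Z' 0) + 2 * cs Z))"
        unfolding Ey_def using param_range by (intro add_mono mult_left_mono) auto
      also have "\<dots> = k1 * cs X + k2 * (2 * Ez + 2 * cs Z)"
        by (simp add: Ez_def algebra_simps)
      finally show ?thesis
        by (simp only: k1_def k2_def)
    qed
    show "Eu \<le> (1 - \<theta>) * (p * cs X + (1 - p) * cs U)"
    proof -
      have W_le: "cs (W ** V) \<le> (1 - \<theta>) * cs V" for V :: "real ^ 'd ^ 'n"
        using Pi_mat_gossip_sq_le[OF gossip, of V]
          mult_right_mono[OF gossip_rate_bounds(1)[OF theta], of "(norm (Pi_mat ** V))\<^sup>2"]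
        by (simp add: cs_def)
      have "Eu \<le> p * ((1 - \<theta>) * cs X) + (1 - p) * ((1 - \<theta>) * cs U)"
        unfolding Eu_def U'_def using param_range by (intro add_mono mult_left_mono) (auto simp: W_le)
      then show ?thesis by (simp add: algebra_simps)
    qed
    show "Ez \<le> (1 - \<theta>) * cs Z + 1 / \<theta> * (4 * \<beta>\<^sup>2 * cs X + 4 * \<eta>\<^sup>2 * cs G + 2 * \<eta>\<^sup>2 * D) + \<eta>\<^sup>2 / q * D"
      unfolding Ez_def cs_def D_def Z'_def next_Z_def \<Delta>_def[symmetric] using param_range
      by (intro consensus_Z_step_le[OF gossip]) auto
    show "Eg \<le> (1 - \<theta>) * cs G + (p + p\<^sup>2 / \<theta>) * D"
      using consensus_G_step_le[OF gossip, of p G \<Delta>] param_range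
      by (simp add: Eg_def cs_def D_def G'_def \<Delta>_def)
  qed (use theta L_pos cond_i delta_pos delta_bounds in \<open>auto simp: cs_def D_def\<close>)

  have avg_U': "row_avg (U' 1) = xb" "row_avg (U' 0) = ub"
    by (simp_all add: U'_def row_avg_gossip[OF gossip] xb_def ub_def)
  have "(q * phi_YZ (Y' (1 / q)) (Z' (1 / q)) + (1 - q) * phi_YZ (Y' 0) (Z' 0))
      + (p * phi_UQG (U' 1) (Q' 1) (G' 1) + (1 - p) * phi_UQG (U' 0) (Q' 0) (G' 0))
    = (q * T (1 / q) + (1 - q) * T 0) - 1 / \<gamma> * favg f xs
      + (2 * \<tau> + \<alpha>) / (2 * \<alpha> * p) * (p * (favg f xb - favg f xs) + (1 - p) * (favg f ub - favg f xs))
      + C4 * \<Psi> Ev Ey Eu Ez Eg"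
  proof -
    have T_alt: "T b = 1 / \<gamma> * favg f (row_avg (Y' b))
        + (1 + \<beta>) / (2 * \<eta>) * (norm (row_avg (Z' b) - xs))\<^sup>2" for b
      by (simp add: T_def)
    \<comment> \<open>with the fractions generalized to variables, the regrouping is a ring identity\<close>
    have "(q * (k1 * (y1 - Fs) + k2 * z1 + k3 * (k4 * (k5 * cy1 + k6 * cz1)))
          + (1 - q) * (k1 * (y0 - Fs) + k2 * z0 + k3 * (k4 * (k5 * cy0 + k6 * cz0))))
        + (p * (k7 * (u1 - Fs) + k3 * (k4 * (k8 * cq1 + k9 * cu1 + k10 * cg1)))
          + (1 - p) * (k7 * (u0 - Fs) + k3 * (k4 * (k8 * cq0 + k9 * cu0 + k10 * cg0))))
      = (q * (k1 * y1 + k2 * z1) + (1 - q) * (k1 * y0 + k2 * z0)) - k1 * Fs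
        + k7 * (p * (u1 - Fs) + (1 - p) * (u0 - Fs))
        + k3 * (k4 * (k8 * (p * cq1 + (1 - p) * cq0) + k5 * (q * cy1 + (1 - q) * cy0)
          + k9 * (p * cu1 + (1 - p) * cu0) + k6 * (q * cz1 + (1 - q) * cz0) + k10 * (p * cg1 + (1 - p) * cg0)))"
      for k1 k2 k3 k4 k5 k6 k7 k8 k9 k10 y1 y0 Fs z1 z0 cy1 cy0 cz1 cz0 u1 u0 cq1 cq0 cu1 cu0 cg1 cg0 :: real
      by (simp add: algebra_simps)
    from this[of "1 / \<gamma>"] show ?thesis
      unfolding phi_YZ_def phi_UQG_def \<Psi>_def Ev_def Ey_def Eu_def Ez_def Eg_def T_alt cs_def avg_U' .
  qed
  also have "1 / \<gamma> * favg f xs = favg f xs / \<gamma>"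
    by simp
  also have "(q * T (1 / q) + (1 - q) * T 0) - favg f xs / \<gamma>
      + (2 * \<tau> + \<alpha>) / (2 * \<alpha> * p) * (p * (favg f xb - favg f xs) + (1 - p) * (favg f ub - favg f xs))
      + C4 * \<Psi> Ev Ey Eu Ez Eg \<le> (1 - \<delta>) * (1 / \<gamma> * (favg f yb - favg f xs)
      + (2 * \<tau> + \<alpha>) / (2 * \<alpha> * p) * (favg f ub - favg f xs)
      + (1 + \<beta>) / (2 * \<eta>) * (norm (zb - xs))\<^sup>2 + C4 * \<Psi> (cs Q) (cs Y) (cs U) (cs Z) (cs G))"
  proof (rule lyapunov_weights[OF _ EC])
    show "q * T (1 / q) + (1 - q) * T 0
        \<le> 1 / (2 * \<eta>) * (norm (zb - xs))\<^sup>2 + (favg f xs - l) + A * (favg f yb - l)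
          + \<tau> / \<alpha> * (v \<bullet> (ub - xb)) + (l + L / (2 * N) * cs X) / \<gamma> + \<eta> / (q * N) * D"
      using ET by (simp only: R_def)
    show "favg f xb \<le> l + L / (2 * N) * cs X"
      using favg_le_model[OF agents, of xb X] by (simp add: l_def xb_def cs_def N_eq)
    show "D \<le> 4 * L * N * (favg f ub - l - v \<bullet> (ub - xb)) + 2 * L\<^sup>2 * cs Q"
      using gradient_gap_le[OF agents, of X Q] mu_pos L_pos
      by (simp add: D_def \<Delta>_def l_def v_def ub_def avgU xb_def cs_def N_eq)
  qed (simp_all add: cs_def D_def minimizer)
  also have "\<dots> = (1 - \<delta>) * phi Y Z U Q G"
    by (simp add: ssgt_Phi_def Phi_U_def Phi_C_def \<Psi>_def cs_def yb_def zb_def ub_def N_eq)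
  finally show ?thesis .
qed

end

section \<open>Conditioning on the past noise\<close>

lemma (in prob_space) integrable_finite_range:
  fixes h :: "'b \<Rightarrow> real"
  assumes "finite S" and "AE \<omega> in M. s \<omega> \<in> S" and "(\<lambda>\<omega>. h (s \<omega>)) \<in> borel_measurable M"
  shows "integrable M (\<lambda>\<omega>. h (s \<omega>))"
proof (rule integrable_const_bound[where B = "\<Sum>x\<in>S. \<bar>h x\<bar>"])
  show "AE \<omega> in M. norm (h (s \<omega>)) \<le> (\<Sum>x\<in>S. \<bar>h x\<bar>)"
    using assms(2)
  proof eventually_elim
    case (elim \<omega>)
    then show ?case
      using member_le_sum[of "s \<omega>" S "\<lambda>x. \<bar>h x\<bar>"] \<open>finite S\<close> by simp
  qed
qed (rule assms(3))

lemma (in prob_space) real_cond_exp_indep_event: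
  fixes H :: "'a \<Rightarrow> real"
  assumes F: "subalgebra M F" and B: "B \<in> events"
    and indep: "\<And>A. A \<in> sets F \<Longrightarrow> prob (A \<inter> B) = prob A * prob B"
    and H: "H \<in> borel_measurable F" "integrable M H"
  shows "AE \<omega> in M. real_cond_exp M F (\<lambda>\<omega>. H \<omega> * indicator B \<omega>) \<omega> = H \<omega> * prob B"
proof -
  interpret finite_measure_subalgebra M F
    by unfold_locales (rule F)
  have int: "integrable M (\<lambda>\<omega>. H \<omega> * indicator B \<omega>)"
    using integrable_mult_indicator[OF B H(2)] by (simp add: mult.commute)
  have int_B: "integrable M (indicat_real B)"
    using B by (intro integrable_real_indicator) (auto simp: less_top[symmetric])
  have "AE \<omega> in M. real_cond_exp M F (indicator B) \<omega> = prob B"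
  proof (rule real_cond_exp_charact)
    fix A assume A: "A \<in> sets F"
    then have A': "A \<in> events"
      using F by (auto simp: subalgebra_def)
    have "(\<integral>x\<in>A. indicat_real B x \<partial>M) = (\<integral>x. indicat_real (A \<inter> B) x \<partial>M)"
      by (simp add: set_lebesgue_integral_def indicator_inter_arith)
    also have "\<dots> = prob A * prob B"
      using A' B indep[OF A] by simp
    also have "\<dots> = (\<integral>x\<in>A. prob B \<partial>M)"
      using A' by (simp add: set_lebesgue_integral_def)
    finally show "(\<integral>x\<in>A. indicat_real B x \<partial>M) = (\<integral>x\<in>A. prob B \<partial>M)" .
  qed (use int_B in auto)
  moreover have "AE \<omega> in M. real_cond_exp M F (\<lambda>\<omega>. H \<omega> * indicator B \<omega>) \<omega>
      = H \<omega> * real_cond_exp M F (indicator B) \<omega>"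
    using B by (intro real_cond_exp_mult H int) auto
  ultimately show ?thesis
    by eventually_elim simp
qed

lemma space_filtration [simp]: "space (ssgt_filtration M \<xi> \<zeta> k) = space M"
  by (simp add: ssgt_filtration_def space_measure_of_conv)

lemma filtration_generators_subset:
  "(\<Union>j<k. {\<xi> j -` B \<inter> space M | B. B \<in> sets borel} \<union> {\<zeta> j -` B \<inter> space M | B. B \<in> sets borel})
    \<subseteq> Pow (space M)"
  by auto

lemma sets_filtration:
  "sets (ssgt_filtration M \<xi> \<zeta> k) = sigma_sets (space M)
     (\<Union>j<k. {\<xi> j -` B \<inter> space M | B. B \<in> sets borel} \<union> {\<zeta> j -` B \<inter> space M | B. B \<in> sets borel})"
  unfolding ssgt_filtration_def by (rule sets_measure_of[OF filtration_generators_subset])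

lemma subalgebra_filtration:
  assumes "\<And>j. \<xi> j \<in> borel_measurable M" "\<And>j. \<zeta> j \<in> borel_measurable M"
  shows "subalgebra M (ssgt_filtration M \<xi> \<zeta> k)"
  unfolding subalgebra_def sets_filtration
  using assms by (auto intro!: sets.sigma_sets_subset measurable_sets)

lemma noise_measurable_filtration:
  assumes "j < k"
  shows "\<xi> j \<in> borel_measurable (ssgt_filtration M \<xi> \<zeta> k)"
    and "\<zeta> j \<in> borel_measurable (ssgt_filtration M \<xi> \<zeta> k)"
proof -
  show "\<xi> j \<in> borel_measurable (ssgt_filtration M \<xi> \<zeta> k)"
    by (rule measurableI) (auto simp: sets_filtration intro!: sigma_sets.Basic bexI[of _ j] assms)
  show "\<zeta> j \<in> borel_measurable (ssgt_filtration M \<xi> \<zeta> k)"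
    by (rule measurableI) (auto simp: sets_filtration intro!: sigma_sets.Basic bexI[of _ j] assms)
qed

text \<open>
The filtration is generated by the pairs of noise variables with index below \<open>k\<close>, so grouping the independent pairs
into these and the one with index \<open>k\<close> gives independent sigma-algebras.
\<close>

lemma (in prob_space) indep_filtration_event:
  assumes ind: "indep_vars (\<lambda>_. borel) (\<lambda>k \<omega>. (\<xi> k \<omega> :: real, \<zeta> k \<omega> :: real)) UNIV"
    and A: "A \<in> sets (ssgt_filtration M \<xi> \<zeta> k)"
    and S: "S \<in> sets borel"
  defines "B \<equiv> {\<omega> \<in> space M. (\<xi> k \<omega>, \<zeta> k \<omega>) \<in> S}"
  shows "prob (A \<inter> B) = prob A * prob B"
proof -
  define \<E> where "\<E> j = {(\<lambda>\<omega>. (\<xi> j \<omega>, \<zeta> j \<omega>)) -` A \<inter> space M | A. A \<in> sets borel}" for j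
  define J where "J b = (if b then {..<k} else {k})" for b
  have "indep_sets \<E> (\<Union>b\<in>UNIV. J b)"
    using ind unfolding indep_vars_def2 \<E>_def by (auto intro: indep_sets_mono_index)
  then have "indep_sets (\<lambda>b. sigma_sets (space M) (\<Union>j\<in>J b. \<E> j)) UNIV"
  proof (rule indep_sets_collect_sigma)
    show "Int_stable (\<E> i)" for i
    proof (rule Int_stableI)
      fix a b assume "a \<in> \<E> i" "b \<in> \<E> i"
      then obtain a' b' where "a = (\<lambda>\<omega>. (\<xi> i \<omega>, \<zeta> i \<omega>)) -` a' \<inter> space M" "a' \<in> sets borel"
        "b = (\<lambda>\<omega>. (\<xi> i \<omega>, \<zeta> i \<omega>)) -` b' \<inter> space M" "b' \<in> sets borel"
        by (auto simp: \<E>_def)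
      then show "a \<inter> b \<in> \<E> i"
        unfolding \<E>_def by (auto intro!: exI[of _ "a' \<inter> b'"])
    qed
    show "disjoint_family_on J UNIV"
      by (auto simp: disjoint_family_on_def J_def)
  qed
  then have "prob (\<Inter>b\<in>UNIV. if b then A else B) = (\<Prod>b\<in>UNIV. prob (if b then A else B))"
  proof (rule indep_setsD)
    have "A \<in> sigma_sets (space M) (\<Union>j<k. \<E> j)"
    proof (rule subsetD[OF sigma_sets_mono A[unfolded sets_filtration]], rule subsetI)
      fix C assume "C \<in> (\<Union>j<k. {\<xi> j -` B \<inter> space M | B. B \<in> sets borel}
          \<union> {\<zeta> j -` B \<inter> space M | B. B \<in> sets borel})"
      then obtain j B' where j: "j < k" and B': "B' \<in> sets borel"
        and C: "C = \<xi> j -` B' \<inter> space M \<or> C = \<zeta> j -` B' \<inter> space M"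
        by blast
      have "B' \<times> UNIV \<in> sets (borel :: (real \<times> real) measure)" "UNIV \<times> B' \<in> sets (borel :: (real \<times> real) measure)"
        using B' by (simp_all add: borel_Times)
      moreover from C have "C = (\<lambda>\<omega>. (\<xi> j \<omega>, \<zeta> j \<omega>)) -` (B' \<times> UNIV) \<inter> space M
          \<or> C = (\<lambda>\<omega>. (\<xi> j \<omega>, \<zeta> j \<omega>)) -` (UNIV \<times> B') \<inter> space M"
        by auto
      ultimately have "C \<in> \<E> j"
        unfolding \<E>_def by blast
      then show "C \<in> sigma_sets (space M) (\<Union>j<k. \<E> j)"
        using j by (intro sigma_sets.Basic) auto
    qed
    moreover have "B = (\<lambda>\<omega>. (\<xi> k \<omega>, \<zeta> k \<omega>)) -` S \<inter> space M"
      by (auto simp: B_def)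
    then have "B \<in> \<E> k"
      unfolding \<E>_def using S by blast
    ultimately show "\<forall>b\<in>UNIV. (if b then A else B) \<in> sigma_sets (space M) (\<Union>j\<in>J b. \<E> j)"
      by (auto simp: J_def)
  qed auto
  then show ?thesis
    by (simp add: UNIV_bool Int_commute mult.commute)
qed

section \<open>The random iteration\<close>

lemma continuous_on_gradF:
  fixes g :: "'n::finite \<Rightarrow> real ^ 'd \<Rightarrow> real ^ 'd"
  assumes "\<forall>i. smooth_strongly_convex \<mu> L (f i) (g i)"
  shows "continuous_on UNIV (gradF g)"
proof -
  have cont_g: "continuous_on UNIV (g i)" for i
  proof -
    have "(max 0 L)-lipschitz_on UNIV (g i)"
    proof (rule lipschitz_onI)
      fix x y
      have "norm (g i x - g i y) \<le> L * norm (x - y)"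
        using assms by (auto simp: smooth_strongly_convex_def)
      also have "\<dots> \<le> max 0 L * norm (x - y)"
        by (intro mult_right_mono) auto
      finally show "dist (g i x) (g i y) \<le> max 0 L * dist x y"
        by (simp add: dist_norm)
    qed simp
    then show ?thesis
      by (rule lipschitz_on_continuous_on)
  qed
  have "continuous_on UNIV (\<lambda>A :: real ^ 'd ^ 'n. g i (A $ i))" for i
    by (rule continuous_on_compose2[OF cont_g linear_continuous_on[OF bounded_linear_vec_nth]]) simp
  then show ?thesis
    unfolding gradF_def by (rule continuous_on_vec_lambda)
qed

lemma continuous_on_favg:
  assumes "\<forall>i. smooth_strongly_convex \<mu> L (f i) (g i)"
  shows "continuous_on UNIV (favg f)"
proof -
  have "continuous_on UNIV (f i)" for i
    using assms by (auto simp: smooth_strongly_convex_def gderiv_def continuous_on_eq_continuous_within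
        intro!: has_derivative_continuous)
  then show ?thesis
    unfolding favg_def by (intro continuous_intros) auto
qed

lemma continuous_on_matrix_mult_right: "continuous_on UNIV (\<lambda>A. (V :: real ^ 'n ^ 'm) ** (A :: real ^ 'd ^ 'n))"
  by (intro linear_continuous_on) (simp add: linear_linear linear_matrix_mult_right)

lemma continuous_on_row_avg: "continuous_on UNIV (row_avg :: real ^ 'd ^ 'n \<Rightarrow> real ^ 'd)"
  by (intro linear_continuous_on) (simp add: linear_linear linear_row_avg)

locale ssgt_run = ssgt_method f g xs E W N \<mu> L \<theta> \<alpha> \<beta> \<gamma> \<tau> p q \<eta>
  for f :: "'n::finite \<Rightarrow> real ^ 'd \<Rightarrow> real"
    and g xs E W N \<mu> L \<theta> \<alpha> \<beta> \<gamma> \<tau> p q \<eta> +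
  fixes M :: "'w measure"
    and \<xi> \<zeta> :: "nat \<Rightarrow> 'w \<Rightarrow> real"
    and X0 :: "real ^ 'd ^ 'n"
    and X Y Z U Q G :: "nat \<Rightarrow> 'w \<Rightarrow> real ^ 'd ^ 'n"
  assumes noise: "ssgt_noise M p q \<xi> \<zeta>"
    and run: "\<forall>\<omega> \<in> space M. ssgt_iterates g W \<alpha> \<beta> \<gamma> \<tau> \<eta> X0 (\<lambda>k. \<xi> k \<omega>) (\<lambda>k. \<zeta> k \<omega>)
           (\<lambda>k. X k \<omega>) (\<lambda>k. Y k \<omega>) (\<lambda>k. Z k \<omega>) (\<lambda>k. U k \<omega>) (\<lambda>k. Q k \<omega>) (\<lambda>k. G k \<omega>)"
begin

sublocale prob_space M
  using noise by (simp add: ssgt_noise_def)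

lemma noise_measurable [measurable]: "\<xi> k \<in> borel_measurable M" "\<zeta> k \<in> borel_measurable M"
  using noise by (simp_all add: ssgt_noise_def)

lemma noise_prob:
  "prob {\<omega> \<in> space M. \<xi> k \<omega> = 1} = p" "prob {\<omega> \<in> space M. \<xi> k \<omega> = 0} = 1 - p"
  "prob {\<omega> \<in> space M. \<zeta> k \<omega> = 1 / q} = q" "prob {\<omega> \<in> space M. \<zeta> k \<omega> = 0} = 1 - q"
  using noise by (simp_all add: ssgt_noise_def)

lemma iterates_0:
  assumes "\<omega> \<in> space M"
  shows "Y 0 \<omega> = X0" "Z 0 \<omega> = X0" "U 0 \<omega> = X0" "Q 0 \<omega> = X0" "G 0 \<omega> = gradF g X0"
  using run assms by (auto simp: ssgt_iterates_def)

lemma iterates_Suc: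
  assumes "\<omega> \<in> space M"
  shows "X k \<omega> = mix_point (Y k \<omega>) (Z k \<omega>) (U k \<omega>)"
    "Z (Suc k) \<omega> = next_Z (\<zeta> k \<omega>) (X k \<omega>) (Z k \<omega>) (Q k \<omega>) (G k \<omega>)"
    "Y (Suc k) \<omega> = X k \<omega> + \<gamma> *\<^sub>R (Z (Suc k) \<omega> - Z k \<omega>)"
    "U (Suc k) \<omega> = W ** (\<xi> k \<omega> *\<^sub>R X k \<omega> + (1 - \<xi> k \<omega>) *\<^sub>R U k \<omega>)"
    "Q (Suc k) \<omega> = \<xi> k \<omega> *\<^sub>R X k \<omega> + (1 - \<xi> k \<omega>) *\<^sub>R Q k \<omega>"
    "G (Suc k) \<omega> = W ** G k \<omega> + \<xi> k \<omega> *\<^sub>R (gradF g (X k \<omega>) - gradF g (Q k \<omega>))"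
  using run assms by (auto simp: ssgt_iterates_def mix_point_def next_Z_def)

lemma AE_noise_values: "AE \<omega> in M. \<forall>k. \<xi> k \<omega> \<in> {0, 1} \<and> \<zeta> k \<omega> \<in> {0, 1 / q}"
proof -
  have two: "AE \<omega> in M. v \<omega> \<in> {0, c}"
    if [measurable]: "v \<in> borel_measurable M" and "c \<noteq> 0"
      and "prob {\<omega> \<in> space M. v \<omega> = c} = r" "prob {\<omega> \<in> space M. v \<omega> = 0} = 1 - r"
    for v :: "'w \<Rightarrow> real" and c r
  proof -
    let ?A = "{\<omega> \<in> space M. v \<omega> = c}" and ?B = "{\<omega> \<in> space M. v \<omega> = 0}"
    have "prob (?A \<union> ?B) = prob ?A + prob ?B"
      using \<open>c \<noteq> 0\<close> by (intro finite_measure_Union) auto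
    then have "prob (?A \<union> ?B) = 1"
      using that by simp
    then have "AE \<omega> in M. \<omega> \<in> ?A \<union> ?B"
      by (subst AE_in_set_eq_1) auto
    then show ?thesis
      by eventually_elim auto
  qed
  have "AE \<omega> in M. \<xi> k \<omega> \<in> {0, 1} \<and> \<zeta> k \<omega> \<in> {0, 1 / q}" for k
    using two[OF _ _ noise_prob(1,2)] two[OF _ _ noise_prob(3,4)] param_range by simp
  then show ?thesis
    by (simp add: AE_all_countable)
qed

text \<open>
The paths on which the noise takes only its nominal values. They have full measure; on the
others the noise, and with it the iterates, may take any value.
\<close>

definition good :: "'w set" where
  "good = {\<omega> \<in> space M. \<forall>k. \<xi> k \<omega> \<in> {0, 1} \<and> \<zeta> k \<omega> \<in> {0, 1 / q}}"

lemma AE_good: "AE \<omega> in M. \<omega> \<in> good"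
  using AE_noise_values AE_space by eventually_elim (auto simp: good_def)

lemma tracking:
  assumes "\<omega> \<in> good"
  shows "row_avg (U k \<omega>) = row_avg (Q k \<omega>) \<and> row_avg (G k \<omega>) = row_avg (gradF g (Q k \<omega>))"
proof (induction k)
  case 0
  then show ?case
    using assms by (simp add: good_def iterates_0)
next
  case (Suc k)
  have "\<omega> \<in> space M" and "\<xi> k \<omega> = 0 \<or> \<xi> k \<omega> = 1"
    using assms by (auto simp: good_def)
  then show ?case
    using Suc by (auto simp: iterates_Suc(4-6) row_avg_gossip[OF gossip] row_avg_linear)
qed

definition state where
  "state k \<omega> = (Y k \<omega>, Z k \<omega>, U k \<omega>, Q k \<omega>, G k \<omega>)"

text \<open>
On the good paths each step has at most four outcomes. This replaces moment estimates: every measurable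
function of the state is essentially bounded and therefore integrable.
\<close>

lemma finite_state_range: "\<exists>S. finite S \<and> (\<forall>\<omega>\<in>good. state k \<omega> \<in> S)"
proof (induction k)
  case 0
  then show ?case
    by (intro exI[of _ "{(X0, X0, X0, X0, gradF g X0)}"]) (auto simp: state_def good_def iterates_0)
next
  case (Suc k)
  then obtain S where S: "finite S" "\<And>\<omega>. \<omega> \<in> good \<Longrightarrow> state k \<omega> \<in> S"
    by blast
  define step where "step = (\<lambda>((a, b), (Y, Z, U, Q, G)).
    let X = mix_point Y Z U; Z' = next_Z b X Z Q G
    in (X + \<gamma> *\<^sub>R (Z' - Z), Z', W ** (a *\<^sub>R X + (1 - a) *\<^sub>R U), a *\<^sub>R X + (1 - a) *\<^sub>R Q,
        W ** G + a *\<^sub>R (gradF g X - gradF g Q)))"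
  have "state (Suc k) \<omega> \<in> step ` (({0, 1} \<times> {0, 1 / q}) \<times> S)" if "\<omega> \<in> good" for \<omega>
  proof (rule image_eqI)
    show "state (Suc k) \<omega> = step ((\<xi> k \<omega>, \<zeta> k \<omega>), state k \<omega>)"
      using that by (simp add: state_def step_def good_def iterates_Suc Let_def)
    show "((\<xi> k \<omega>, \<zeta> k \<omega>), state k \<omega>) \<in> ({0, 1} \<times> {0, 1 / q}) \<times> S"
      using that S(2)[OF that] by (auto simp: good_def)
  qed
  moreover have "finite (step ` (({0, 1} \<times> {0, 1 / q}) \<times> S))"
    using S(1) by simp
  ultimately show ?case by blast
qed

lemma integrable_state_fun:
  fixes h :: "_ \<Rightarrow> real"
  assumes "(\<lambda>\<omega>. h (state k \<omega>)) \<in> borel_measurable M"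
  shows "integrable M (\<lambda>\<omega>. h (state k \<omega>))"
proof -
  obtain S where S: "finite S" "\<And>\<omega>. \<omega> \<in> good \<Longrightarrow> state k \<omega> \<in> S"
    using finite_state_range[of k] by blast
  have "AE \<omega> in M. state k \<omega> \<in> S"
    using AE_good by eventually_elim (rule S(2))
  with S(1) show ?thesis
    by (rule integrable_finite_range) (rule assms)
qed

lemma matrix_mult_measurable [measurable (raw)]:
  "h \<in> borel_measurable F \<Longrightarrow> (\<lambda>\<omega>. (V :: real ^ 'n ^ 'n) ** (h \<omega> :: real ^ 'd ^ 'n)) \<in> borel_measurable F"
  by (rule borel_measurable_continuous_on[OF continuous_on_matrix_mult_right])

lemma gradF_measurable [measurable (raw)]:
  "h \<in> borel_measurable F \<Longrightarrow> (\<lambda>\<omega>. gradF g (h \<omega>)) \<in> borel_measurable F"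
  by (rule borel_measurable_continuous_on[OF continuous_on_gradF[OF agents]])

lemma row_avg_measurable [measurable (raw)]:
  "h \<in> borel_measurable F \<Longrightarrow> (\<lambda>\<omega>. row_avg (h \<omega> :: real ^ 'd ^ 'n)) \<in> borel_measurable F"
  by (rule borel_measurable_continuous_on[OF continuous_on_row_avg])

lemma favg_measurable [measurable (raw)]:
  "h \<in> borel_measurable F \<Longrightarrow> (\<lambda>\<omega>. favg f (h \<omega>)) \<in> borel_measurable F"
  by (rule borel_measurable_continuous_on[OF continuous_on_favg[OF agents]])

lemma mix_point_measurable [measurable (raw)]:
  assumes [measurable]: "y \<in> borel_measurable F" "z \<in> borel_measurable F" "u \<in> borel_measurable F"
  shows "(\<lambda>\<omega>. mix_point (y \<omega>) (z \<omega>) (u \<omega>)) \<in> borel_measurable F"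
  unfolding mix_point_def by measurable

lemma next_Z_measurable [measurable (raw)]:
  assumes [measurable]: "b \<in> borel_measurable F" "x \<in> borel_measurable F" "z \<in> borel_measurable F"
    "v \<in> borel_measurable F" "h \<in> borel_measurable F"
  shows "(\<lambda>\<omega>. next_Z (b \<omega>) (x \<omega>) (z \<omega>) (v \<omega>) (h \<omega>)) \<in> borel_measurable F"
  unfolding next_Z_def by measurable

lemma phi_YZ_measurable [measurable (raw)]:
  assumes [measurable]: "y \<in> borel_measurable F" "z \<in> borel_measurable F"
  shows "(\<lambda>\<omega>. phi_YZ (y \<omega>) (z \<omega>)) \<in> borel_measurable F"
  unfolding phi_YZ_def by measurable

lemma phi_UQG_measurable [measurable (raw)]:
  assumes [measurable]: "u \<in> borel_measurable F" "v \<in> borel_measurable F" "h \<in> borel_measurable F"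
  shows "(\<lambda>\<omega>. phi_UQG (u \<omega>) (v \<omega>) (h \<omega>)) \<in> borel_measurable F"
  unfolding phi_UQG_def by measurable

lemma iterates_measurable:
  assumes "space F = space M"
    and noise_F: "\<And>j. j < k \<Longrightarrow> \<xi> j \<in> borel_measurable F" "\<And>j. j < k \<Longrightarrow> \<zeta> j \<in> borel_measurable F"
  shows "Y k \<in> borel_measurable F \<and> Z k \<in> borel_measurable F \<and> U k \<in> borel_measurable F
    \<and> Q k \<in> borel_measurable F \<and> G k \<in> borel_measurable F"
  using noise_F
proof (induction k)
  case 0
  have "h \<in> borel_measurable F" if "\<And>\<omega>. \<omega> \<in> space M \<Longrightarrow> h \<omega> = c" for h :: "'w \<Rightarrow> real ^ 'd ^ 'n" and c
    by (rule measurable_cong[THEN iffD2, of _ _ "\<lambda>_. c"]) (use that assms(1) in auto)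
  then show ?case
    using iterates_0 by blast
next
  case (Suc k)
  have IH [measurable]: "Y k \<in> borel_measurable F" "Z k \<in> borel_measurable F" "U k \<in> borel_measurable F"
    "Q k \<in> borel_measurable F" "G k \<in> borel_measurable F"
    using Suc by (auto simp: less_Suc_eq)
  have [measurable]: "\<xi> k \<in> borel_measurable F" "\<zeta> k \<in> borel_measurable F"
    using Suc by auto
  have X [measurable]: "X k \<in> borel_measurable F"
    by (rule measurable_cong[THEN iffD2, of _ _ "\<lambda>\<omega>. mix_point (Y k \<omega>) (Z k \<omega>) (U k \<omega>)"])
      (use iterates_Suc(1) assms(1) in auto)
  have Z [measurable]: "Z (Suc k) \<in> borel_measurable F"
    by (rule measurable_cong[THEN iffD2, of _ _ "\<lambda>\<omega>. next_Z (\<zeta> k \<omega>) (X k \<omega>) (Z k \<omega>) (Q k \<omega>) (G k \<omega>)"])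
      (use iterates_Suc(2) assms(1) in auto)
  have "Y (Suc k) \<in> borel_measurable F"
    by (rule measurable_cong[THEN iffD2, of _ _ "\<lambda>\<omega>. X k \<omega> + \<gamma> *\<^sub>R (Z (Suc k) \<omega> - Z k \<omega>)"])
      (use iterates_Suc(3) assms(1) in auto)
  moreover have "U (Suc k) \<in> borel_measurable F"
    by (rule measurable_cong[THEN iffD2, of _ _ "\<lambda>\<omega>. W ** (\<xi> k \<omega> *\<^sub>R X k \<omega> + (1 - \<xi> k \<omega>) *\<^sub>R U k \<omega>)"])
      (use iterates_Suc(4) assms(1) in auto)
  moreover have "Q (Suc k) \<in> borel_measurable F"
    by (rule measurable_cong[THEN iffD2, of _ _ "\<lambda>\<omega>. \<xi> k \<omega> *\<^sub>R X k \<omega> + (1 - \<xi> k \<omega>) *\<^sub>R Q k \<omega>"])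
      (use iterates_Suc(5) assms(1) in auto)
  moreover have "G (Suc k) \<in> borel_measurable F"
    by (rule measurable_cong[THEN iffD2, of _ _
          "\<lambda>\<omega>. W ** G k \<omega> + \<xi> k \<omega> *\<^sub>R (gradF g (X k \<omega>) - gradF g (Q k \<omega>))"])
      (use iterates_Suc(6) assms(1) in auto)
  ultimately show ?case
    using Z by blast
qed

abbreviation "Phi k \<omega> \<equiv> phi (Y k \<omega>) (Z k \<omega>) (U k \<omega>) (Q k \<omega>) (G k \<omega>)"

lemma Phi_integrable: "integrable M (Phi k)"
proof -
  have [measurable]: "Y k \<in> borel_measurable M" "Z k \<in> borel_measurable M" "U k \<in> borel_measurable M"
    "Q k \<in> borel_measurable M" "G k \<in> borel_measurable M"
    using iterates_measurable[of M k] by auto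
  have "(\<lambda>\<omega>. Phi k \<omega>) \<in> borel_measurable M"
    unfolding phi_split by measurable
  then show ?thesis
    using integrable_state_fun[of "\<lambda>(Y, Z, U, Q, G). phi Y Z U Q G" k] by (simp add: state_def)
qed

text \<open>
On a good path the new Lyapunov value is the sum, over the outcomes of \<open>\<zeta> k\<close> and of \<open>\<xi> k\<close>, of a function of the old
state times the indicator of the outcome. The old state is measurable in the filtration and the outcomes are independent
of it, so conditioning replaces the indicators by their probabilities and \<open>expected_phi_decrease\<close> applies.
\<close>

lemma cond_exp_Phi_Suc_le:
  "AE \<omega> in M. real_cond_exp M (ssgt_filtration M \<xi> \<zeta> k) (Phi (Suc k)) \<omega> \<le> (1 - \<delta>) * Phi k \<omega>"
proof -
  let ?F = "ssgt_filtration M \<xi> \<zeta> k"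
  have subalg: "subalgebra M ?F"
    by (rule subalgebra_filtration) auto
  interpret F: finite_measure_subalgebra M ?F
    by unfold_locales (rule subalg)
  have meas_F [measurable]: "Y k \<in> borel_measurable ?F" "Z k \<in> borel_measurable ?F" "U k \<in> borel_measurable ?F"
    "Q k \<in> borel_measurable ?F" "G k \<in> borel_measurable ?F"
    using iterates_measurable[OF space_filtration noise_measurable_filtration] by auto

  define Xs where "Xs \<omega> = mix_point (Y k \<omega>) (Z k \<omega>) (U k \<omega>)" for \<omega>
  define Zs where "Zs b \<omega> = next_Z b (Xs \<omega>) (Z k \<omega>) (Q k \<omega>) (G k \<omega>)" for b \<omega>
  define HZ where "HZ b \<omega> = phi_YZ (Xs \<omega> + \<gamma> *\<^sub>R (Zs b \<omega> - Z k \<omega>)) (Zs b \<omega>)" for b \<omega>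
  define HU where "HU a \<omega> = phi_UQG (W ** (a *\<^sub>R Xs \<omega> + (1 - a) *\<^sub>R U k \<omega>)) (a *\<^sub>R Xs \<omega> + (1 - a) *\<^sub>R Q k \<omega>)
      (W ** G k \<omega> + a *\<^sub>R (gradF g (Xs \<omega>) - gradF g (Q k \<omega>)))" for a \<omega>
  have HZ_meas [measurable]: "HZ b \<in> borel_measurable ?F" for b
    unfolding HZ_def Zs_def Xs_def by measurable
  have HU_meas [measurable]: "HU a \<in> borel_measurable ?F" for a
    unfolding HU_def Xs_def by measurable
  have HZ_int: "integrable M (HZ b)" for b
  proof -
    define h where "h = (\<lambda>(Y, Z, U, Q, G). let X = mix_point Y Z U; Z' = next_Z b X Z Q G
        in phi_YZ (X + \<gamma> *\<^sub>R (Z' - Z)) Z')"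
    have eq: "HZ b = (\<lambda>\<omega>. h (state k \<omega>))"
      by (simp add: fun_eq_iff h_def state_def HZ_def Zs_def Xs_def Let_def)
    show ?thesis
      using measurable_from_subalg[OF subalg HZ_meas[of b]] unfolding eq by (rule integrable_state_fun)
  qed
  have HU_int: "integrable M (HU a)" for a
  proof -
    define h where "h = (\<lambda>(Y, Z, U, Q, G). let X = mix_point Y Z U
        in phi_UQG (W ** (a *\<^sub>R X + (1 - a) *\<^sub>R U)) (a *\<^sub>R X + (1 - a) *\<^sub>R Q)
          (W ** G + a *\<^sub>R (gradF g X - gradF g Q)))"
    have eq: "HU a = (\<lambda>\<omega>. h (state k \<omega>))"
      by (simp add: fun_eq_iff h_def state_def HU_def Xs_def Let_def)
    show ?thesis
      using measurable_from_subalg[OF subalg HU_meas[of a]] unfolding eq by (rule integrable_state_fun)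
  qed

  define BZ where "BZ b = {\<omega> \<in> space M. \<zeta> k \<omega> = b}" for b
  define BU where "BU a = {\<omega> \<in> space M. \<xi> k \<omega> = a}" for a
  have B_meas [measurable]: "BZ b \<in> events" "BU a \<in> events" for a b
    by (simp_all add: BZ_def BU_def)
  have indep: "indep_vars (\<lambda>_. borel) (\<lambda>k \<omega>. (\<xi> k \<omega>, \<zeta> k \<omega>)) UNIV"
    using noise by (simp add: ssgt_noise_def)
  have indep_Z: "prob (A \<inter> BZ b) = prob A * prob (BZ b)" if "A \<in> sets ?F" for A b
    using indep_filtration_event[OF indep that, of "UNIV \<times> {b}"] by (simp add: BZ_def borel_Times)
  have indep_U: "prob (A \<inter> BU a) = prob A * prob (BU a)" if "A \<in> sets ?F" for A a
    using indep_filtration_event[OF indep that, of "{a} \<times> UNIV"] by (simp add: BU_def borel_Times)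
  define PZ where "PZ b \<omega> = HZ b \<omega> * indicator (BZ b) \<omega>" for b \<omega>
  define PU where "PU a \<omega> = HU a \<omega> * indicator (BU a) \<omega>" for a \<omega>
  have ceZ: "AE \<omega> in M. real_cond_exp M ?F (PZ b) \<omega> = HZ b \<omega> * prob (BZ b)" for b
    unfolding PZ_def[abs_def] by (rule real_cond_exp_indep_event[OF subalg B_meas(1) indep_Z HZ_meas HZ_int])
  have ceU: "AE \<omega> in M. real_cond_exp M ?F (PU a) \<omega> = HU a \<omega> * prob (BU a)" for a
    unfolding PU_def[abs_def] by (rule real_cond_exp_indep_event[OF subalg B_meas(2) indep_U HU_meas HU_int])
  have prob_B: "prob (BZ (1 / q)) = q" "prob (BZ 0) = 1 - q" "prob (BU 1) = p" "prob (BU 0) = 1 - p"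
    by (simp_all only: BZ_def BU_def noise_prob)
  have PZ_int: "integrable M (PZ b)" for b
    using integrable_mult_indicator[OF B_meas(1) HZ_int] by (simp add: PZ_def[abs_def] mult.commute)
  have PU_int: "integrable M (PU a)" for a
    using integrable_mult_indicator[OF B_meas(2) HU_int] by (simp add: PU_def[abs_def] mult.commute)

  have "AE \<omega> in M. Phi (Suc k) \<omega> = (PZ (1 / q) \<omega> + PZ 0 \<omega>) + (PU 1 \<omega> + PU 0 \<omega>)"
    using AE_good
  proof eventually_elim
    case (elim \<omega>)
    then have \<omega>: "\<omega> \<in> space M" and x: "\<xi> k \<omega> = 0 \<or> \<xi> k \<omega> = 1" and z: "\<zeta> k \<omega> = 0 \<or> \<zeta> k \<omega> = 1 / q"
      by (auto simp: good_def)
    have "phi_YZ (Y (Suc k) \<omega>) (Z (Suc k) \<omega>) = HZ (\<zeta> k \<omega>) \<omega>"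
      using \<omega> by (simp add: HZ_def Zs_def Xs_def iterates_Suc)
    also have "\<dots> = PZ (1 / q) \<omega> + PZ 0 \<omega>"
      using z \<omega> param_range by (auto simp: PZ_def BZ_def)
    finally have 1: "phi_YZ (Y (Suc k) \<omega>) (Z (Suc k) \<omega>) = PZ (1 / q) \<omega> + PZ 0 \<omega>" .
    have "phi_UQG (U (Suc k) \<omega>) (Q (Suc k) \<omega>) (G (Suc k) \<omega>) = HU (\<xi> k \<omega>) \<omega>"
      using \<omega> by (simp add: HU_def Xs_def iterates_Suc)
    also have "\<dots> = PU 1 \<omega> + PU 0 \<omega>"
      using x \<omega> by (auto simp: PU_def BU_def)
    finally show ?case
      using 1 by (simp add: phi_split)
  qed
  then have "AE \<omega> in M. real_cond_exp M ?F (Phi (Suc k)) \<omega>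
      = real_cond_exp M ?F (\<lambda>\<omega>. (PZ (1 / q) \<omega> + PZ 0 \<omega>) + (PU 1 \<omega> + PU 0 \<omega>)) \<omega>"
    using Phi_integrable[of "Suc k"] PZ_int PU_int
    by (intro F.real_cond_exp_cong) (auto intro!: borel_measurable_add borel_measurable_integrable)
  moreover have "AE \<omega> in M. real_cond_exp M ?F (\<lambda>\<omega>. (PZ (1 / q) \<omega> + PZ 0 \<omega>) + (PU 1 \<omega> + PU 0 \<omega>)) \<omega>
      = real_cond_exp M ?F (\<lambda>\<omega>. PZ (1 / q) \<omega> + PZ 0 \<omega>) \<omega> + real_cond_exp M ?F (\<lambda>\<omega>. PU 1 \<omega> + PU 0 \<omega>) \<omega>"
    using PZ_int PU_int by (intro F.real_cond_exp_add) auto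
  moreover have "AE \<omega> in M. real_cond_exp M ?F (\<lambda>\<omega>. PZ (1 / q) \<omega> + PZ 0 \<omega>) \<omega>
      = real_cond_exp M ?F (PZ (1 / q)) \<omega> + real_cond_exp M ?F (PZ 0) \<omega>"
    using PZ_int by (intro F.real_cond_exp_add) auto
  moreover have "AE \<omega> in M. real_cond_exp M ?F (\<lambda>\<omega>. PU 1 \<omega> + PU 0 \<omega>) \<omega>
      = real_cond_exp M ?F (PU 1) \<omega> + real_cond_exp M ?F (PU 0) \<omega>"
    using PU_int by (intro F.real_cond_exp_add) auto
  ultimately show ?thesis
    using ceZ[of "1 / q"] ceZ[of 0] ceU[of 1] ceU[of 0] AE_good
  proof eventually_elim
    case (elim \<omega>)
    then have tr: "row_avg (U k \<omega>) = row_avg (Q k \<omega>)" "row_avg (G k \<omega>) = row_avg (gradF g (Q k \<omega>))"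
      using tracking by blast+
    have "real_cond_exp M ?F (Phi (Suc k)) \<omega>
        = (q * HZ (1 / q) \<omega> + (1 - q) * HZ 0 \<omega>) + (p * HU 1 \<omega> + (1 - p) * HU 0 \<omega>)"
      using elim by (simp add: prob_B mult.commute)
    also have "\<dots> \<le> (1 - \<delta>) * Phi k \<omega>"
      using expected_phi_decrease[OF tr, of "Y k \<omega>" "Z k \<omega>"]
      by (simp add: HZ_def HU_def Zs_def Xs_def)
    finally show ?case .
  qed
qed

lemma expectation_Phi_le: "expectation (Phi k) \<le> (1 - \<delta>) ^ k * expectation (Phi 0)"
proof (induction k)
  case (Suc k)
  let ?F = "ssgt_filtration M \<xi> \<zeta> k"
  have subalg: "subalgebra M ?F"
    by (rule subalgebra_filtration) auto
  interpret F: finite_measure_subalgebra M ?F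
    by unfold_locales (rule subalg)
  have "expectation (Phi (Suc k)) = expectation (real_cond_exp M ?F (Phi (Suc k)))"
    by (rule F.real_cond_exp_int(2)[OF Phi_integrable, symmetric])
  also have "\<dots> \<le> expectation (\<lambda>\<omega>. (1 - \<delta>) * Phi k \<omega>)"
    by (intro integral_mono_AE cond_exp_Phi_Suc_le F.real_cond_exp_int(1) integrable_mult_right Phi_integrable)
  also have "\<dots> = (1 - \<delta>) * expectation (Phi k)"
    by simp
  also have "\<dots> \<le> (1 - \<delta>) * ((1 - \<delta>) ^ k * expectation (Phi 0))"
    using Suc delta_less_1 by (intro mult_left_mono) auto
  finally show ?case by simp
qed simp

lemma expectation_Phi_nonneg: "0 \<le> expectation (Phi k)"
  by (rule Bochner_Integration.integral_nonneg) (rule phi_nonneg)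

lemma expectation_Phi_0: "\<omega> \<in> space M \<Longrightarrow> expectation (Phi 0) = Phi 0 \<omega>"
proof -
  assume \<omega>: "\<omega> \<in> space M"
  have "expectation (Phi 0) = expectation (\<lambda>_. Phi 0 \<omega>)"
    using \<omega> by (intro Bochner_Integration.integral_cong) (auto simp: iterates_0)
  then show ?thesis by (simp add: prob_space)
qed

lemma expectation_grad_count_le:
  "expectation (\<lambda>\<omega>. real (grad_count \<xi> \<zeta> K \<omega>)) \<le> 1 + real K * (p + q)"
proof -
  define B where "B k = {\<omega> \<in> space M. \<xi> k \<omega> \<noteq> 0 \<or> \<zeta> k \<omega> \<noteq> 0}" for k
  have B [measurable]: "B k \<in> events" for k
    unfolding B_def by measurable
  have "prob (B k) \<le> p + q" for k
  proof -
    have "B k \<subseteq> (space M - {\<omega> \<in> space M. \<xi> k \<omega> = 0}) \<union> (space M - {\<omega> \<in> space M. \<zeta> k \<omega> = 0})"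
      by (auto simp: B_def)
    then have "prob (B k) \<le> prob ((space M - {\<omega> \<in> space M. \<xi> k \<omega> = 0}) \<union> (space M - {\<omega> \<in> space M. \<zeta> k \<omega> = 0}))"
      by (intro finite_measure_mono) auto
    also have "\<dots> \<le> prob (space M - {\<omega> \<in> space M. \<xi> k \<omega> = 0}) + prob (space M - {\<omega> \<in> space M. \<zeta> k \<omega> = 0})"
      by (intro measure_Un_le) auto
    also have "\<dots> = p + q"
      by (subst (1 2) prob_compl) (auto simp: noise_prob)
    finally show ?thesis .
  qed
  have "real (grad_count \<xi> \<zeta> K \<omega>) = 1 + (\<Sum>k<K. indicator (B k) \<omega>)" if "\<omega> \<in> space M" for \<omega>
  proof -
    have "(\<Sum>k<K. indicator (B k) \<omega> :: real) = (\<Sum>k<K. if \<xi> k \<omega> \<noteq> 0 \<or> \<zeta> k \<omega> \<noteq> 0 then 1 else 0)"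
      using that by (intro sum.cong) (auto simp: B_def indicator_def)
    also have "\<dots> = real (card {k \<in> {..<K}. \<xi> k \<omega> \<noteq> 0 \<or> \<zeta> k \<omega> \<noteq> 0})"
      by (subst sum.inter_filter[symmetric]) auto
    finally show ?thesis
      by (simp add: grad_count_def)
  qed
  then have "expectation (\<lambda>\<omega>. real (grad_count \<xi> \<zeta> K \<omega>)) = expectation (\<lambda>\<omega>. 1 + (\<Sum>k<K. indicator (B k) \<omega>))"
    by (intro Bochner_Integration.integral_cong) auto
  also have "\<dots> = 1 + (\<Sum>k<K. prob (B k))"
  proof -
    have int: "integrable M (indicat_real (B k))" for k
      by (intro integrable_real_indicator) (auto simp: less_top[symmetric])
    have "expectation (\<lambda>\<omega>. 1 + (\<Sum>k<K. indicat_real (B k) \<omega>))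
        = expectation (\<lambda>_. 1) + expectation (\<lambda>\<omega>. \<Sum>k<K. indicat_real (B k) \<omega>)"
      by (intro Bochner_Integration.integral_add Bochner_Integration.integrable_sum int) simp
    also have "expectation (\<lambda>\<omega>. \<Sum>k<K. indicat_real (B k) \<omega>) = (\<Sum>k<K. expectation (indicat_real (B k)))"
      by (intro Bochner_Integration.integral_sum int)
    finally show ?thesis
      by (simp add: prob_space)
  qed
  also have "\<dots> \<le> 1 + (\<Sum>k<K. p + q)"
    using \<open>\<And>k. prob (B k) \<le> p + q\<close> by (intro add_left_mono sum_mono) auto
  finally show ?thesis by simp
qed

end

section \<open>The recommended parameters\<close>

text \<open>
With \<open>s = sqrt \<kappa>\<close> everything is explicit: \<open>1 / \<alpha> = 23 * s\<close>, \<open>1 / \<gamma> = 23 / 2 * s - 3 / 4\<close>, \<open>\<eta> * L = \<theta> * s / 5000\<close> and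
\<open>\<beta> = \<theta> / (10000 * s)\<close>, so each condition reduces to a numerical inequality for \<open>s \<ge> 1\<close>. The smallest term of \<open>ssgt_delta\<close> is
\<open>p_hat\<close>, equal to \<open>\<theta> / (4232 * (23 * s + 1))\<close>, and \<open>101568 = 4232 * 24\<close>.
\<close>

lemma recommended_parameters:
  fixes N \<mu> L \<kappa> \<theta> \<alpha> \<beta> \<gamma> \<tau> p q \<eta> :: real
  assumes "0 < \<mu>" "\<mu> \<le> L" "\<kappa> = L / \<mu>" "0 < \<theta>" "\<theta> \<le> 1" "0 < N"
    and \<tau>: "\<tau> = 1 / 2" and \<alpha>: "\<alpha> = 1 / (23 * sqrt \<kappa>)" and \<gamma>: "\<gamma> = 4 * \<alpha> / (4 - 4 * \<tau> - 3 * \<alpha>)"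
    and p: "p = \<theta> / 4232" and q: "q = \<theta> / 4232"
    and \<eta>: "\<eta> = \<theta> * sqrt \<kappa> / (5000 * L)" and \<beta>: "\<beta> = \<mu> * \<eta> / 2"
  shows "ssgt_admissible N \<mu> L \<theta> \<alpha> \<beta> \<gamma> \<tau> p q \<eta>"
    and "\<theta> / (101568 * sqrt \<kappa>) \<le> ssgt_delta \<theta> \<alpha> \<beta> \<gamma> \<tau> p"
proof -
  define s where "s = sqrt \<kappa>"
  have L: "0 < L"
    using assms by simp
  have s: "1 \<le> s"
    using assms by (simp add: s_def)
  have "s\<^sup>2 = L / \<mu>"
    using assms L by (simp add: s_def)
  then have L_eq: "L = \<mu> * s\<^sup>2"
    using assms by (simp add: field_simps)
  have \<alpha>_s: "\<alpha> = 1 / (23 * s)"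
    by (simp add: \<alpha> s_def)
  have \<gamma>_s: "\<gamma> = 4 / (46 * s - 3)"
    using s by (simp add: \<gamma> \<tau> \<alpha>_s field_simps)
  have \<eta>L: "\<eta> * L = \<theta> * s / 5000"
    using L by (simp add: \<eta> s_def)
  have \<beta>_s: "\<beta> = \<theta> / (10000 * s)"
    using assms(1) s by (simp add: \<beta> \<eta> s_def[symmetric] L_eq field_simps power2_eq_square)
  have \<gamma>_pos: "0 < \<gamma>" and \<gamma>_le: "\<gamma> * s \<le> 4 / 43"
    using s by (simp_all add: \<gamma>_s field_simps)
  have \<gamma>_less: "\<gamma> < 1 / 10"
    using s by (simp add: \<gamma>_s field_simps)
  have \<eta>_pos: "0 < \<eta>"
    using assms(4) s L by (simp add: \<eta> s_def[symmetric])
  have A: "(1 - \<alpha> - \<tau>) / \<alpha> = 23 / 2 * s - 1"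
    using s by (simp add: \<alpha>_s \<tau> field_simps)
  have inv_\<gamma>: "1 / \<gamma> = 23 / 2 * s - 3 / 4"
    using s by (simp add: \<gamma>_s field_simps)
  have c3: "c3 N L \<alpha> \<gamma> \<tau> = (23 * s - 3 / 4) * L / N"
  proof -
    have "c3 N L \<alpha> \<gamma> \<tau> = ((1 - \<alpha> - \<tau>) / \<alpha> + 1 / \<gamma> + 1) * L / N"
      using \<open>0 < N\<close> by (simp add: c3_def add_divide_distrib distrib_right)
    also have "(1 - \<alpha> - \<tau>) / \<alpha> + 1 / \<gamma> + 1 = 23 * s - 3 / 4"
      using A inv_\<gamma> by linarith
    finally show ?thesis .
  qed
  have rng: "ssgt_param_range \<alpha> \<beta> \<gamma> \<tau> p q \<eta>"
  proof -
    have "0 < \<alpha>" "\<alpha> < 1" "0 < \<beta>" "\<beta> < 1"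
      using s assms(4,5) by (simp_all add: \<alpha>_s \<beta>_s field_simps)
    then show ?thesis
      using \<gamma>_pos \<gamma>_less \<eta>_pos assms(4,5) by (simp add: ssgt_param_range_def \<tau> p q)
  qed
  have \<gamma>\<eta>L: "\<gamma> * (\<eta> * L) \<le> \<theta> / 10000"
  proof -
    have "\<gamma> * (\<eta> * L) = \<gamma> * s * (\<theta> / 5000)"
      by (simp add: \<eta>L)
    also have "\<dots> \<le> 4 / 43 * (\<theta> / 5000)"
      using assms(4,5) by (intro mult_right_mono \<gamma>_le) auto
    also have "\<dots> \<le> \<theta> / 10000"
      using assms(4,5) by simp
    finally show ?thesis .
  qed
  have i: "ssgt_cond_i L \<theta> \<alpha> \<beta> \<gamma> \<tau> p \<eta>"
    unfolding ssgt_cond_i_def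
  proof (intro conjI)
    have "\<beta> / \<theta> \<le> 1 / 10000"
      using s assms(4,5) by (simp add: \<beta>_s field_simps)
    then have "\<gamma> * (\<beta> / \<theta>) \<le> 1 * (1 / 10000)"
      using \<gamma>_pos \<gamma>_less s assms(4,5) by (intro mult_mono) (auto simp: \<beta>_s)
    then have "(\<gamma> * (\<beta> / \<theta>))\<^sup>2 \<le> (1 * (1 / 10000))\<^sup>2"
      using \<gamma>_pos s assms(4,5) by (intro power_mono) (auto simp: \<beta>_s)
    then have "192 * (\<gamma> * (\<beta> / \<theta>))\<^sup>2 \<le> 1 / 10000"
      by (simp only: power2_eq_square)
    moreover have "192 * (1 - \<tau>) * \<gamma>\<^sup>2 * \<beta>\<^sup>2 / (\<tau> * \<theta>\<^sup>2) = 192 * (\<gamma> * (\<beta> / \<theta>))\<^sup>2"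
      by (simp add: \<tau> power_mult_distrib power_divide)
    moreover have "16 * p / \<theta> = 16 / 4232"
      using assms(4,5) by (simp add: p)
    moreover have "2 * (1 - \<tau>) / (2 - \<tau>) = 2 / 3"
      by (simp add: \<tau>)
    ultimately show "2 * (1 - \<tau>) / (2 - \<tau>) + 192 * (1 - \<tau>) * \<gamma>\<^sup>2 * \<beta>\<^sup>2 / (\<tau> * \<theta>\<^sup>2) + \<tau> / 4 + 16 * p / \<theta>
        \<le> 1 - \<tau> / 8"
      using \<tau> by linarith
    have "2 * \<alpha> \<le> \<gamma>"
      using s by (simp add: \<alpha>_s \<gamma>_s field_simps)
    then have "(2 * \<alpha>)\<^sup>2 \<le> \<gamma>\<^sup>2"
      using s by (intro power_mono) (auto simp: \<alpha>_s)
    then have "4 * \<alpha>\<^sup>2 \<le> \<gamma>\<^sup>2"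
      by (simp add: power_mult_distrib)
    then have "\<alpha>\<^sup>2 * 2 \<le> \<gamma>\<^sup>2"
      using zero_le_power2[of \<alpha>] by linarith
    then show "\<alpha>\<^sup>2 / ((1 - \<tau>) * \<gamma>\<^sup>2) \<le> 1"
      using \<gamma>_pos by (simp add: \<tau> divide_le_eq)
    have "(\<gamma> * (\<eta> * L))\<^sup>2 \<le> (\<theta> / 10000)\<^sup>2"
      using \<gamma>_pos \<eta>_pos L by (intro power_mono \<gamma>\<eta>L) auto
    then have "(\<gamma> * (\<eta> * L))\<^sup>2 \<le> \<theta>\<^sup>2 / 100000000"
      by (simp only: power_divide) simp
    moreover have "\<theta> / 2 * \<theta> = \<theta>\<^sup>2 / 2"
      by (simp add: power2_eq_square)
    ultimately have "192 * (\<gamma> * (\<eta> * L))\<^sup>2 \<le> \<theta> / 2 * \<theta>"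
      using zero_le_power2[of \<theta>] by linarith
    then show "192 * (1 - \<tau>) * \<gamma>\<^sup>2 * \<eta>\<^sup>2 * L\<^sup>2 / (\<tau> * \<theta>) \<le> \<theta> / 2"
      using assms(4,5) by (simp add: \<tau> divide_le_eq power_mult_distrib)
  qed
  have ii: "ssgt_cond_ii N L \<theta> \<alpha> \<gamma> \<tau> p q \<eta>"
    unfolding ssgt_cond_ii_def
  proof (intro conjI)
    have "2 * \<eta> * L\<^sup>2 / (q * N) = (2 * (\<eta> * L) / q) * (L / N)"
      by (simp add: power2_eq_square)
    also have "2 * (\<eta> * L) / q = 8464 / 5000 * s"
      using assms(4,5) by (simp add: \<eta>L q)
    also have "8464 / 5000 * s * (L / N) \<le> (23 * s - 3 / 4) / 2 * (L / N)"
      using s L \<open>0 < N\<close> by (intro mult_right_mono) auto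
    finally show "2 * \<eta> * L\<^sup>2 / (q * N) \<le> c3 N L \<alpha> \<gamma> \<tau> / 2"
      by (simp add: c3 mult.commute)
    have "c2 L \<theta> \<gamma> \<tau> p q \<eta> \<le> 9 / 1000 / L\<^sup>2"
    proof -
      have \<eta>_L: "\<eta> = \<theta> * s / 5000 / L"
        using \<eta>L L by (simp add: field_simps)
      have "c2 L \<theta> \<gamma> \<tau> p q \<eta> = (768 * 4234 / 25000000 * (\<gamma> * s)\<^sup>2 + 32 / 4232) / L\<^sup>2"
        unfolding c2_def \<eta>_L \<tau> p q using assms(4) L by (simp add: field_simps power2_eq_square)
      also have "\<dots> \<le> (768 * 4234 / 25000000 * (4 / 43)\<^sup>2 + 32 / 4232) / L\<^sup>2"
        using \<gamma>_pos s by (intro divide_right_mono add_right_mono mult_left_mono power_mono \<gamma>_le) auto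
      also have "\<dots> \<le> 9 / 1000 / L\<^sup>2"
        by (intro divide_right_mono) (auto simp: power2_eq_square)
      finally show ?thesis .
    qed
    then have "c3 N L \<alpha> \<gamma> \<tau> * c2 L \<theta> \<gamma> \<tau> p q \<eta> \<le> c3 N L \<alpha> \<gamma> \<tau> * (9 / 1000 / L\<^sup>2)"
      using s L \<open>0 < N\<close> by (intro mult_left_mono) (auto simp: c3)
    also have "\<dots> = 9 / 1000 * (23 * s - 3 / 4) / (L * N)"
      using L by (simp add: c3 power2_eq_square)
    also have "\<dots> \<le> 4232 / 10000 * s / (L * N)"
      using s L \<open>0 < N\<close> by (intro divide_right_mono) auto
    also have "\<dots> = \<eta> / (2 * q * N)"
      using assms(4) by (simp add: \<eta> s_def q)
    finally show "c3 N L \<alpha> \<gamma> \<tau> * c2 L \<theta> \<gamma> \<tau> p q \<eta> \<le> \<eta> / (2 * q * N)" .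
    have "8 * \<eta> * L / q = 8 * (\<eta> * L) / q"
      by (simp only: mult.assoc)
    also have "\<dots> = 33856 / 5000 * s"
      using assms(4) by (simp add: \<eta>L q)
    also have "\<dots> \<le> 23 / 2 * s"
      using s by simp
    also have "\<dots> = \<tau> / \<alpha>"
      by (simp add: \<tau> \<alpha>_s)
    finally show "8 * \<eta> * L / q \<le> \<tau> / \<alpha>" .
  qed
  have iii: "ssgt_cond_iii \<mu> L \<alpha> \<beta> \<gamma> \<tau> \<eta>"
    unfolding ssgt_cond_iii_def
  proof (intro conjI)
    show "L * \<gamma> \<le> 1 / (4 * \<eta>)"
      using \<gamma>\<eta>L \<eta>_pos assms(5) by (simp add: field_simps)
    show "\<beta> / (2 * \<eta>) \<le> \<mu> / 4"
      using \<eta>_pos by (simp add: \<beta>)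
  qed (use A inv_\<gamma> in linarith)+
  show "ssgt_admissible N \<mu> L \<theta> \<alpha> \<beta> \<gamma> \<tau> p q \<eta>"
    using rng i ii iii by (simp add: ssgt_admissible_def)

  define r where "r = \<theta> / (101568 * s)"
  have r_le: "r \<le> \<theta> / 101568" "r \<le> 1 / (101568 * s)"
    using s assms(4,5) by (simp_all add: r_def field_simps)
  have "r \<le> \<gamma> / 4"
  proof -
    have "1 / (101568 * s) \<le> 1 / (46 * s - 3)"
      using s by (intro divide_left_mono) auto
    also have "\<dots> = \<gamma> / 4"
      using s by (simp add: \<gamma>_s field_simps)
    finally show ?thesis
      using r_le(2) by (rule order.trans[rotated])
  qed
  moreover have "r \<le> p_hat \<alpha> \<tau> p"
  proof -
    have "p_hat \<alpha> \<tau> p = \<theta> / (4232 * (23 * s + 1))"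
      using s by (simp add: p_hat_def \<alpha>_s \<tau> p field_simps)
    moreover have "r \<le> \<theta> / (4232 * (23 * s + 1))"
      unfolding r_def using s assms(4,5) by (intro divide_left_mono) auto
    ultimately show ?thesis by simp
  qed
  moreover have "r \<le> \<beta> / (1 + \<beta>)"
  proof -
    have "\<beta> \<le> 1" "0 < \<beta>"
      using rng by (auto simp: ssgt_param_range_def)
    then have "\<beta> / 2 \<le> \<beta> / (1 + \<beta>)"
      by (intro divide_left_mono) auto
    moreover have "r \<le> \<beta> / 2"
      using s assms(4,5) by (simp add: r_def \<beta>_s field_simps)
    ultimately show ?thesis by (rule order.trans[rotated])
  qed
  moreover have "r \<le> p / 2" "r \<le> \<tau>" "r \<le> \<theta> / 2"
    using r_le(1) assms(4,5) by (simp_all add: p \<tau>)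
  ultimately show "\<theta> / (101568 * sqrt \<kappa>) \<le> ssgt_delta \<theta> \<alpha> \<beta> \<gamma> \<tau> p"
    by (simp add: ssgt_delta_def s_def[symmetric] r_def[symmetric])
qed

lemma geometric_iteration_count:
  fixes \<delta> \<epsilon> :: real
  assumes "0 < \<delta>" "\<delta> < 1" "0 < \<epsilon>" "\<epsilon> < 1"
  obtains K where "(1 - \<delta>) ^ K \<le> \<epsilon>" "real K \<le> ln (1 / \<epsilon>) / \<delta> + 1"
proof
  define K where "K = nat \<lceil>ln (1 / \<epsilon>) / \<delta>\<rceil>"
  have pos: "0 < ln (1 / \<epsilon>) / \<delta>"
    using assms by simp
  then show "real (nat \<lceil>ln (1 / \<epsilon>) / \<delta>\<rceil>) \<le> ln (1 / \<epsilon>) / \<delta> + 1"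
    by linarith
  have "ln (1 / \<epsilon>) / \<delta> \<le> real K"
    unfolding K_def by linarith
  then have "ln (1 / \<epsilon>) \<le> \<delta> * real K"
    using assms by (simp add: field_simps)
  have "(1 - \<delta>) ^ K \<le> exp (- \<delta>) ^ K"
    using exp_ge_add_one_self[of "- \<delta>"] assms by (intro power_mono) auto
  also have "\<dots> = exp (- (\<delta> * real K))"
    by (simp add: exp_of_nat_mult[symmetric] mult.commute)
  also have "\<dots> \<le> exp (- ln (1 / \<epsilon>))"
    using \<open>ln (1 / \<epsilon>) \<le> \<delta> * real K\<close> by simp
  also have "\<dots> = \<epsilon>"
    using assms by (simp add: ln_div)
  finally show "(1 - \<delta>) ^ nat \<lceil>ln (1 / \<epsilon>) / \<delta>\<rceil> \<le> \<epsilon>"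
    by (simp add: K_def)
qed

section \<open>Linear convergence and complexity\<close>

theorem theorem1:
  fixes f :: "'n::finite \<Rightarrow> real ^ 'd \<Rightarrow> real"
    and g :: "'n \<Rightarrow> real ^ 'd \<Rightarrow> real ^ 'd"
    and xs :: "real ^ 'd"
    and E :: "('n \<times> 'n) set"
    and W :: "real ^ 'n ^ 'n"
    and \<mu> L \<kappa> \<theta> \<alpha> \<beta> \<gamma> \<tau> p q \<eta> \<delta> :: real
    and M :: "'w measure"
    and \<xi> \<zeta> :: "nat \<Rightarrow> 'w \<Rightarrow> real"
    and X0 :: "real ^ 'd ^ 'n"
    and X Y Z U Q G :: "nat \<Rightarrow> 'w \<Rightarrow> real ^ 'd ^ 'n"
    and \<Phi> :: "nat \<Rightarrow> 'w \<Rightarrow> real"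
  assumes "0 < \<mu>" and "\<mu> \<le> L"
    and "\<forall>i. smooth_strongly_convex \<mu> L (f i) (g i)"
    and "\<forall>x. favg f xs \<le> favg f x"
    and "\<kappa> = L / \<mu>"
    and "undirected_connected E" and "gossip_matrix E \<theta> W"
    and "ssgt_noise M p q \<xi> \<zeta>"
    and "\<forall>\<omega> \<in> space M. ssgt_iterates g W \<alpha> \<beta> \<gamma> \<tau> \<eta> X0 (\<lambda>k. \<xi> k \<omega>) (\<lambda>k. \<zeta> k \<omega>)
           (\<lambda>k. X k \<omega>) (\<lambda>k. Y k \<omega>) (\<lambda>k. Z k \<omega>) (\<lambda>k. U k \<omega>) (\<lambda>k. Q k \<omega>) (\<lambda>k. G k \<omega>)"
    and "\<forall>k \<omega>. \<Phi> k \<omega> = ssgt_Phi f xs L \<theta> \<alpha> \<beta> \<gamma> \<tau> p q \<eta> (Y k \<omega>) (Z k \<omega>) (U k \<omega>) (Q k \<omega>) (G k \<omega>)"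
    and "\<delta> = ssgt_delta \<theta> \<alpha> \<beta> \<gamma> \<tau> p"
  shows
    "(ssgt_admissible (real CARD('n)) \<mu> L \<theta> \<alpha> \<beta> \<gamma> \<tau> p q \<eta> \<longrightarrow>
        0 < \<delta> \<and> \<delta> < 1 \<and>
        (\<forall>k. integrable M (\<Phi> k)) \<and>
        (\<forall>k. AE \<omega> in M.
           real_cond_exp M (ssgt_filtration M \<xi> \<zeta> k) (\<Phi> (Suc k)) \<omega> \<le> (1 - \<delta>) * \<Phi> k \<omega>) \<and>
        (\<forall>k. 0 \<le> integral\<^sup>L M (\<Phi> k) \<and> integral\<^sup>L M (\<Phi> k) \<le> (1 - \<delta>) ^ k * integral\<^sup>L M (\<Phi> 0)))
     \<and>
     (\<tau> = 1 / 2 \<and> \<alpha> = 1 / (23 * sqrt \<kappa>) \<and> \<gamma> = 4 * \<alpha> / (4 - 4 * \<tau> - 3 * \<alpha>) \<and>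
      p = \<theta> / 4232 \<and> q = \<theta> / 4232 \<and> \<eta> = \<theta> * sqrt \<kappa> / (5000 * L) \<and> \<beta> = \<mu> * \<eta> / 2 \<longrightarrow>
        ssgt_admissible (real CARD('n)) \<mu> L \<theta> \<alpha> \<beta> \<gamma> \<tau> p q \<eta> \<and>
        (\<forall>\<epsilon>. 0 < \<epsilon> \<and> \<epsilon> \<le> 1 / 2 \<longrightarrow>
           (\<exists>K. (\<forall>\<omega> \<in> space M. integral\<^sup>L M (\<Phi> K) \<le> \<epsilon> * \<Phi> 0 \<omega>) \<and>
                integral\<^sup>L M (\<lambda>\<omega>. real (grad_count \<xi> \<zeta> K \<omega>)) \<le> bigO_const * (sqrt \<kappa> * ln (1 / \<epsilon>)) \<and>
                real (comm_rounds K) \<le> bigO_const * (sqrt \<kappa> / \<theta> * ln (1 / \<epsilon>)))))"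
proof -
  let ?adm = "ssgt_admissible (real CARD('n)) \<mu> L \<theta> \<alpha> \<beta> \<gamma> \<tau> p q \<eta>"
  let ?recommended = "\<tau> = 1 / 2 \<and> \<alpha> = 1 / (23 * sqrt \<kappa>) \<and> \<gamma> = 4 * \<alpha> / (4 - 4 * \<tau> - 3 * \<alpha>) \<and>
      p = \<theta> / 4232 \<and> q = \<theta> / 4232 \<and> \<eta> = \<theta> * sqrt \<kappa> / (5000 * L) \<and> \<beta> = \<mu> * \<eta> / 2"
  have run: "ssgt_run f g xs E W (real CARD('n)) \<mu> L \<theta> \<alpha> \<beta> \<gamma> \<tau> p q \<eta> M \<xi> \<zeta> X0 X Y Z U Q G" if ?adm
    by (intro ssgt_run.intro ssgt_method.intro ssgt_run_axioms.intro) (use assms that in auto)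
  have \<Phi>: "\<Phi> = (\<lambda>k \<omega>. ssgt_Phi f xs L \<theta> \<alpha> \<beta> \<gamma> \<tau> p q \<eta> (Y k \<omega>) (Z k \<omega>) (U k \<omega>) (Q k \<omega>) (G k \<omega>))"
    using assms(10) by (simp add: fun_eq_iff)
  have rate: "0 < \<delta> \<and> \<delta> < 1 \<and> (\<forall>k. integrable M (\<Phi> k)) \<and>
        (\<forall>k. AE \<omega> in M.
           real_cond_exp M (ssgt_filtration M \<xi> \<zeta> k) (\<Phi> (Suc k)) \<omega> \<le> (1 - \<delta>) * \<Phi> k \<omega>) \<and>
        (\<forall>k. 0 \<le> integral\<^sup>L M (\<Phi> k) \<and> integral\<^sup>L M (\<Phi> k) \<le> (1 - \<delta>) ^ k * integral\<^sup>L M (\<Phi> 0))"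
    if ?adm
  proof -
    interpret ssgt_run f g xs E W "real CARD('n)" \<mu> L \<theta> \<alpha> \<beta> \<gamma> \<tau> p q \<eta> M \<xi> \<zeta> X0 X Y Z U Q G
      by (rule run[OF that])
    show ?thesis
      unfolding assms(11) \<Phi>
      using delta_pos delta_less_1 Phi_integrable cond_exp_Phi_Suc_le expectation_Phi_nonneg
        expectation_Phi_le by blast
  qed
  have complexity: "?adm \<and> (\<forall>\<epsilon>. 0 < \<epsilon> \<and> \<epsilon> \<le> 1 / 2 \<longrightarrow>
           (\<exists>K. (\<forall>\<omega> \<in> space M. integral\<^sup>L M (\<Phi> K) \<le> \<epsilon> * \<Phi> 0 \<omega>) \<and>
                integral\<^sup>L M (\<lambda>\<omega>. real (grad_count \<xi> \<zeta> K \<omega>)) \<le> bigO_const * (sqrt \<kappa> * ln (1 / \<epsilon>)) \<and>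
                real (comm_rounds K) \<le> bigO_const * (sqrt \<kappa> / \<theta> * ln (1 / \<epsilon>))))"
    if rec: ?recommended
  proof -
    have \<theta>: "0 < \<theta>" "\<theta> \<le> 1"
      using assms(7) by (rule gossip_matrix_range)+
    define s where "s = sqrt \<kappa>"
    have s: "1 \<le> s"
      using assms(1,2,5) by (simp add: s_def)
    have "0 < real CARD('n)"
      by simp
    note recommended = recommended_parameters[OF assms(1,2,5) \<theta> this]
    have adm: ?adm
      using rec by (intro recommended(1)) blast+
    have \<delta>_ge: "\<theta> / (101568 * s) \<le> \<delta>"
      unfolding assms(11) s_def using rec by (intro recommended(2)) blast+
    interpret ssgt_run f g xs E W "real CARD('n)" \<mu> L \<theta> \<alpha> \<beta> \<gamma> \<tau> p q \<eta> M \<xi> \<zeta> X0 X Y Z U Q G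
      by (rule run[OF adm])
    note R = rate[OF adm]
    have "\<exists>K. (\<forall>\<omega> \<in> space M. integral\<^sup>L M (\<Phi> K) \<le> \<epsilon> * \<Phi> 0 \<omega>) \<and>
          integral\<^sup>L M (\<lambda>\<omega>. real (grad_count \<xi> \<zeta> K \<omega>)) \<le> bigO_const * (s * ln (1 / \<epsilon>)) \<and>
          real (comm_rounds K) \<le> bigO_const * (s / \<theta> * ln (1 / \<epsilon>))"
      if \<epsilon>: "0 < \<epsilon>" "\<epsilon> \<le> 1 / 2" for \<epsilon>
    proof -
      define l where "l = ln (1 / \<epsilon>)"
      \<comment> \<open>\<open>l\<close> is bounded away from \<open>0\<close>, so the rounding of \<open>K\<close> and the initial gradient are absorbed by the constant\<close>
      have "1 / 2 \<le> l"
        using ln_le_minus_one[of \<epsilon>] \<epsilon> by (simp add: l_def ln_div)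
      obtain K where K: "(1 - \<delta>) ^ K \<le> \<epsilon>" "real K \<le> l / \<delta> + 1"
        using geometric_iteration_count[of \<delta> \<epsilon>] R \<epsilon> by (auto simp: l_def)
      have decay: "integral\<^sup>L M (\<Phi> K) \<le> \<epsilon> * \<Phi> 0 \<omega>" if "\<omega> \<in> space M" for \<omega>
      proof -
        have "integral\<^sup>L M (\<Phi> K) \<le> (1 - \<delta>) ^ K * integral\<^sup>L M (\<Phi> 0)"
          using R by blast
        also have "\<dots> \<le> \<epsilon> * integral\<^sup>L M (\<Phi> 0)"
          using R by (intro mult_right_mono K) auto
        also have "integral\<^sup>L M (\<Phi> 0) = \<Phi> 0 \<omega>"
          unfolding \<Phi> by (rule expectation_Phi_0[OF that])
        finally show ?thesis .
      qed
      define m where "m = s * l"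
      have m: "1 \<le> 2 * m"
        using mult_mono[of 1 s "1 / 2" l] s \<open>1 / 2 \<le> l\<close> by (simp add: m_def)
      have m_le: "m \<le> m / \<theta>"
        using \<theta> m by (simp add: le_divide_eq mult_left_le)
      have "l / \<delta> \<le> l / (\<theta> / (101568 * s))"
        using \<delta>_ge \<theta> s R \<open>1 / 2 \<le> l\<close> by (intro divide_left_mono mult_pos_pos divide_pos_pos) auto
      also have "\<dots> = 101568 * (m / \<theta>)"
        by (simp add: m_def)
      finally have "l / \<delta> \<le> 101568 * (m / \<theta>)" .
      with K(2) have "real K \<le> 101568 * (m / \<theta>) + 1"
        by (rule order.trans[OF _ add_right_mono])
      also have "\<dots> \<le> 101568 * (m / \<theta>) + 2 * (m / \<theta>)"
        using m m_le by (intro add_left_mono) simp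
      finally have K_le: "real K \<le> 101570 * (m / \<theta>)"
        by simp
      have "integral\<^sup>L M (\<lambda>\<omega>. real (grad_count \<xi> \<zeta> K \<omega>)) \<le> 1 + real K * (p + q)"
        by (rule expectation_grad_count_le)
      also have "\<dots> \<le> 1 + 101570 * (m / \<theta>) * (p + q)"
        using K_le param_range by (intro add_left_mono mult_right_mono) auto
      also have "\<dots> = 1 + 101570 / 2116 * m"
      proof -
        have pq: "p + q = \<theta> / 2116"
          using rec by simp
        show ?thesis
          unfolding pq using \<theta> by simp
      qed
      also have "\<dots> \<le> bigO_const * m"
        using m by (simp add: bigO_const_def)
      finally have grads: "integral\<^sup>L M (\<lambda>\<omega>. real (grad_count \<xi> \<zeta> K \<omega>)) \<le> bigO_const * (s * l)"
        by (simp only: m_def)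
      have "101570 * (m / \<theta>) \<le> bigO_const * (m / \<theta>)"
        using m \<theta> by (intro mult_right_mono) (auto simp: bigO_const_def)
      with K_le have "real (comm_rounds K) \<le> bigO_const * (s / \<theta> * l)"
        by (simp add: comm_rounds_def m_def)
      with decay grads show ?thesis
        unfolding l_def by blast
    qed
    with adm show ?thesis
      unfolding s_def by blast
  qed
  show ?thesis
    using rate complexity by blast
qed

end
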